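(* Let $d\in\mathbb{N}$, $d\ge 1$, and let $j_{d/2,1}$ be the first positive zero of the Bessel function of the first kind $J_{d/2}$. For every $\tilde q>\frac{j_{d/2,1}}{\pi}$, the super resolution problem in dimension $d$ is well-conditioned for $\tilde q$. That is: for every $\alpha_{\min}>0$ there exists a constant $c_{\tilde q,\alpha_{\min}}>0$ (which may depend on $d$, $\tilde q$ and $\alpha_{\min}$, but not on $n$, $\delta$, or the parameter configuration) such that for every bandlimit $n>0$, every noise level $\delta>0$, every finite nonempty set $Y\subset\mathbb{T}^d$ with $n\cdot\operatorname{sep} Y\ge\tilde q$, and all weights $\alpha=(\alpha_t)_{t\in Y}\in\mathbb{C}^{|Y|}$ with $\min_{t\in Y}|\alpha_t|=\alpha_{\min}$, the Fisher information matrix $J(\alpha,Y)$ of the super resolution problem satisfies $$n^{-d}\,\lambda_{\min}\bigl(J(\alpha,Y)\bigr)\ \ge\ \delta^{-2}\,c_{\tilde q,\alpha_{\min}} .$$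
   Context: $\mathbb{T}=\mathbb{R}/\mathbb{Z}$. For a finite nonempty set $Y\subset\mathbb{T}^d$ (points identified with representatives in $\mathbb{R}^d$), its separation is $$\operatorname{sep}Y=\min\{\|t-t'+\ell\|_2 : t,t'\in Y,\ \ell\in\mathbb{Z}^d,\ t-t'+\ell\neq 0\}.$$ $\lambda_{\min}$ denotes the smallest eigenvalue of a Hermitian matrix. Super resolution problem: given a real bandlimit $n>0$, let $\mathcal{I}=\{k\in\mathbb{Z}^d:\|k\|_2\le n\}$. The measurements are $\hat\mu(k)=\sum_{t\in Y}\alpha_t e^{-2\pi i\, t\cdot k}+\hat\rho(k)$, $k\in\mathcal{I}$, with noise vector $\hat\rho\sim\mathcal{CN}(0,\delta^2 I)$, and the unknown parameters are the weights $\alpha_t$ and the coordinates $t_1,\dots,t_d$ of the nodes $t\in Y$. The Fisher information matrix of this problem is $$J(\alpha,Y)=\delta^{-2}G^*G\in\mathbb{C}^{|Y|(d+1)\times|Y|(d+1)},\qquad G=\left(\mathscr{A},\tilde{\mathscr{A}}_1,\dots,\tilde{\mathscr{A}}_d\right)D_\alpha ,$$ where $\mathscr{A}=\left(e^{-2\pi i\,t\cdot k}\right)_{k\in\mathcal{I},\,t\in Y}\in\mathbb{C}^{|\mathcal{I}|\times|Y|}$, $\tilde{\mathscr{A}}_s=\left(-2\pi i\,k_s e^{-2\pi i\,t\cdot k}\right)_{k\in\mathcal{I},\,t\in Y}\in\mathbb{C}^{|\mathcal{I}|\times|Y|}$ for $s=1,\dots,d$, and $D_\alpha$ is the diagonal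 matrix whose diagonal consists of $|Y|$ ones followed by $d$ copies of the weight vector $(\alpha_t)_{t\in Y}$. *)

theory Defs
  imports "HOL-Analysis.Analysis"
begin

text \<open>The power series of the Bessel function of the first kind; meant for \<open>x > 0\<close> only, because of \<open>powr\<close>.\<close>

definition bessel_J :: "real \<Rightarrow> real \<Rightarrow> real" where
  "bessel_J \<nu> x = (\<Sum>m. (-1) ^ m / (fact m * Gamma (real m + \<nu> + 1)) * (x / 2) powr (2 * real m + \<nu>))"

definition bessel_first_zero :: "real \<Rightarrow> real" where
  "bessel_first_zero \<nu> = (LEAST x. 0 < x \<and> bessel_J \<nu> x = 0)"

definition int_lattice :: "(real ^ 'd) set" where
  "int_lattice = {l. \<forall>i. l $ i \<in> \<int>}"

text \<open>A finite nonempty subset of the torus $(\mathbb{R}/\mathbb{Z})^d$ is given by a set of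
  representatives in $\mathbb{R}^d$, exactly one (chosen arbitrarily) for each of its points.\<close>

definition torus_config :: "(real ^ 'd) set \<Rightarrow> bool" where
  "torus_config Y \<longleftrightarrow> finite Y \<and> Y \<noteq> {} \<and>
     (\<forall>t\<in>Y. \<forall>t'\<in>Y. t - t' \<in> int_lattice \<longrightarrow> t = t')"

text \<open>The infimum is a minimum, see \<open>sep_attained\<close> below.\<close>

definition sep :: "(real ^ 'd) set \<Rightarrow> real" where
  "sep Y = Inf {norm (t - t' + l) | t t' l.
     t \<in> Y \<and> t' \<in> Y \<and> l \<in> int_lattice \<and> t - t' + l \<noteq> 0}"

definition freqs :: "real \<Rightarrow> (real ^ 'd) set" where
  "freqs n = {k \<in> int_lattice. norm k \<le> n}"

text \<open>Matrices are functions of a row and a column index, to be read on explicit finite index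
  sets.  The rows of \<open>fisher_G\<close> are indexed by \<open>freqs n\<close>.  Its columns are indexed by
  \<open>params Y\<close>, where \<open>(None, t)\<close> stands for the weight of the node \<open>t\<close> and \<open>(Some s, t)\<close> for the
  \<open>s\<close>-th coordinate of \<open>t\<close>.\<close>

definition params :: "(real ^ 'd) set \<Rightarrow> ('d option \<times> (real ^ 'd)) set" where
  "params Y = UNIV \<times> Y"

definition fourier_mat :: "real ^ 'd \<Rightarrow> real ^ 'd \<Rightarrow> complex" where
  "fourier_mat k t = exp (- 2 * of_real pi * \<i> * of_real (t \<bullet> k))"

definition fourier_deriv_mat :: "'d \<Rightarrow> real ^ 'd \<Rightarrow> real ^ 'd \<Rightarrow> complex" where
  "fourier_deriv_mat s k t =
     - 2 * of_real pi * \<i> * of_real (k $ s) * exp (- 2 * of_real pi * \<i> * of_real (t \<bullet> k))"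

fun block_mat :: "real ^ 'd \<Rightarrow> 'd option \<times> (real ^ 'd) \<Rightarrow> complex" where
  "block_mat k (None, t) = fourier_mat k t"
| "block_mat k (Some s, t) = fourier_deriv_mat s k t"

fun weight_diag :: "(real ^ 'd \<Rightarrow> complex) \<Rightarrow> 'd option \<times> (real ^ 'd) \<Rightarrow> complex" where
  "weight_diag \<alpha> (None, t) = 1"
| "weight_diag \<alpha> (Some s, t) = \<alpha> t"

definition fisher_G :: "(real ^ 'd \<Rightarrow> complex) \<Rightarrow> real ^ 'd \<Rightarrow> 'd option \<times> (real ^ 'd) \<Rightarrow> complex" where
  "fisher_G \<alpha> k p = block_mat k p * weight_diag \<alpha> p"

definition fisher_information ::
    "real \<Rightarrow> real \<Rightarrow> (real ^ 'd \<Rightarrow> complex) \<Rightarrow>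
     'd option \<times> (real ^ 'd) \<Rightarrow> 'd option \<times> (real ^ 'd) \<Rightarrow> complex" where
  "fisher_information n \<delta> \<alpha> p q =
     of_real (1 / \<delta>\<^sup>2) * (\<Sum>k\<in>freqs n. cnj (fisher_G \<alpha> k p) * fisher_G \<alpha> k q)"

definition eigenvalue_on :: "'i set \<Rightarrow> ('i \<Rightarrow> 'i \<Rightarrow> complex) \<Rightarrow> complex \<Rightarrow> bool" where
  "eigenvalue_on S M z \<longleftrightarrow>
     (\<exists>v. (\<exists>i\<in>S. v i \<noteq> 0) \<and> (\<forall>i\<in>S. (\<Sum>j\<in>S. M i j * v j) = z * v i))"

text \<open>Meant for Hermitian matrices on a finite nonempty index set; their eigenvalues are real.\<close>

definition lambda_min :: "'i set \<Rightarrow> ('i \<Rightarrow> 'i \<Rightarrow> complex) \<Rightarrow> real" where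
  "lambda_min S M = Min {x::real. eigenvalue_on S M (complex_of_real x)}"

lemma finite_freqs: "finite (freqs n :: (real ^ 'd) set)"
proof -
  let ?B = "real_of_int ` {- \<lceil>\<bar>n\<bar>\<rceil> .. \<lceil>\<bar>n\<bar>\<rceil>}"
  have "vec_nth ` (freqs n :: (real ^ 'd) set) \<subseteq> (UNIV \<rightarrow>\<^sub>E ?B)"
  proof (clarsimp simp: PiE_def Pi_def)
    fix k :: "real ^ 'd" and i
    assume k: "k \<in> freqs n"
    then obtain z where z: "k $ i = real_of_int z"
      unfolding freqs_def int_lattice_def Ints_def by blast
    have "\<bar>k $ i\<bar> \<le> n"
      using k component_le_norm_cart[of k i] by (auto simp: freqs_def)
    then have "z \<in> {- \<lceil>\<bar>n\<bar>\<rceil> .. \<lceil>\<bar>n\<bar>\<rceil>}"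
      unfolding z atLeastAtMost_iff by linarith
    with z show "k $ i \<in> ?B" by blast
  qed
  moreover have "finite ((UNIV :: 'd set) \<rightarrow>\<^sub>E ?B)"
    by (rule finite_PiE) auto
  ultimately have "finite (vec_nth ` (freqs n :: (real ^ 'd) set))"
    by (rule finite_subset)
  then show ?thesis
    by (rule finite_imageD) (simp add: inj_on_def vec_nth_inject)
qed

lemma sep_attained:
  fixes Y :: "(real ^ 'd) set"
  assumes "finite Y" "Y \<noteq> {}"
  shows "sep Y \<in> {norm (t - t' + l) | t t' l.
     t \<in> Y \<and> t' \<in> Y \<and> l \<in> int_lattice \<and> t - t' + l \<noteq> 0}" (is "_ \<in> ?D")
proof -
  obtain t0 where t0: "t0 \<in> Y" using assms by blast
  let ?one = "1 :: real ^ 'd"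
  have "?one \<in> int_lattice" "?one \<noteq> 0" by (auto simp: int_lattice_def)
  then have D0: "norm ?one \<in> ?D"
    using t0 by (intro CollectI exI[of _ t0] exI[of _ ?one]) auto
  let ?E = "{x \<in> ?D. x \<le> norm ?one}"
  let ?F = "\<lambda>(t, t'). (\<lambda>l. norm (t - t' + l)) ` freqs (norm ?one + norm (t - t'))"
  have "?E \<subseteq> (\<Union>p\<in>Y \<times> Y. ?F p)"
  proof
    fix x assume "x \<in> ?E"
    then obtain t t' l where x: "x = norm (t - t' + l)" "t \<in> Y" "t' \<in> Y" "l \<in> int_lattice"
      "x \<le> norm ?one" by blast
    have "norm l \<le> norm (t - t' + l) + norm (t - t')"
      using norm_triangle_ineq4[of "t - t' + l" "t - t'"] by simp
    then have "l \<in> freqs (norm ?one + norm (t - t'))"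
      using x by (auto simp: freqs_def)
    then show "x \<in> (\<Union>p\<in>Y \<times> Y. ?F p)" using x by auto
  qed
  moreover have "finite (\<Union>p\<in>Y \<times> Y. ?F p)"
    using assms(1) finite_freqs by auto
  ultimately have fin: "finite ?E" by (rule finite_subset)
  have ne: "?E \<noteq> {}" using D0 by blast
  have mem: "Min ?E \<in> ?E" using Min_in[OF fin ne] .
  have "Min ?E \<le> x" if "x \<in> ?D" for x
  proof (cases "x \<le> norm ?one")
    case True
    then show ?thesis using that fin by (intro Min_le) auto
  next
    case False
    then show ?thesis using mem by auto
  qed
  then have "Inf ?D = Min ?E"
    using mem by (intro cInf_eq_minimum) auto
  then show ?thesis using mem unfolding sep_def by simp
qed

end

theory Submission
  imports Defs "Jordan_Normal_Form.Spectral_Radius"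
begin

text \<open>
  Let \<open>P k\<close> be the \<open>k\<close>-th entry of \<open>G v\<close>; the claim is a lower bound for \<open>\<Sum> |P k|\<^sup>2\<close> over the
  frequencies \<open>|k| \<le> n\<close>.  Fix a function \<open>f\<close> that lives on the ball of radius \<open>R\<close>, with \<open>R\<close> slightly
  less than half the separation, and vanishes on the sphere together with its gradient \<open>V\<close>.  Placing
  a copy of \<open>a f + b \<bullet> V\<close> at every node, with coefficients read off from \<open>v\<close>, gives a function \<open>F\<close>
  on the torus with Fourier coefficients \<open>g k * P k\<close>, where \<open>g\<close> is the Fourier transform of \<open>f\<close>.
  Only frequencies \<open>|k| \<le> n\<close> contribute positively to the sum of \<open>(1 - (|k| / n)\<^sup>2) |g k|\<^sup>2 |P k|\<^sup>2\<close>,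
  which by Parseval is \<open>\<integral> |F|\<^sup>2 - (2 \<pi> n)\<^sup>-\<^sup>2 \<integral> |\<nabla> F|\<^sup>2\<close>.  As the balls are disjoint and
  \<open>f\<close> is radial, this splits into one diagonal term for each entry of \<open>v\<close>.  The terms
  are positive when \<open>\<integral> |\<Delta> f|\<^sup>2 < (2 \<pi> n)\<^sup>2 \<integral> |\<nabla> f|\<^sup>2\<close>, so the best \<open>f\<close> is the first buckling
  mode of the clamped ball, whose gradient consists of the eigenfunctions
  \<open>x\<^sub>i |x| powr (- d / 2) J\<^bsub>d/2\<^esub>(j |x| / R)\<close> of the Dirichlet Laplacian.  The condition
  becomes \<open>j / R < 2 \<pi> n\<close>, that is, \<open>2 R n > j / \<pi>\<close>.
\<close>

(* From here on, "$" is only the component of a vector in real ^ 'd. *)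
no_notation vec_index (infixl "$" 100)

section \<open>Eigenvalues of Hermitian matrices\<close>

text \<open>Parseval is needed in two one-sided forms. The mass of \<open>F\<close> must be
  recovered from its Fourier coefficients, so \<open>F\<close> has to be approximated by
  trigonometric polynomials and has to be continuous; it is, as \<open>f\<close> and
  \<open>V\<close> vanish on the sphere. Its gradient contains second derivatives of
  \<open>f\<close> and may jump there, but its mass is needed only from above, and that is Bessel's
  inequality. The diagonal terms of weights and of coordinates have different sizes. Both are
  compared with (1 - \<theta>) \<integral> f^2: the first by an estimate of the energy of
  \<open>f\<close> by the load, the second by a Poincare inequality, which is strong enough because
  the radius is at most 1/2 (the separation never exceeds 1). The factor \<integral> f^2 then
  cancels. The radius is r / (2 n) with a fixed r strictly between j / pi and q. What remains of
  \<open>f\<close> is \<theta> = (j / (pi r))^2, free of n, and the volume of the ball, proportional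
  to n^(-d). This yields the power of n in the theorem and a constant that depends neither on n nor
  on the number of nodes.\<close>

lemma eigenvalue_on_spectrum:
  fixes M :: "'i \<Rightarrow> 'i \<Rightarrow> complex"
  assumes h: "bij_betw h {0..<N} S"
  shows "{z. eigenvalue_on S M z} = spectrum (mat N N (\<lambda>(i, j). M (h i) (h j)))"
proof -
  let ?A = "mat N N (\<lambda>(i, j). M (h i) (h j))"
  have reindex: "(\<Sum>j\<in>S. g j) = (\<Sum>j=0..<N. g (h j))" for g :: "'i \<Rightarrow> complex"
    using sum.reindex_bij_betw[OF h, of g] by simp
  have "eigenvalue_on S M z \<longleftrightarrow> eigenvalue ?A z" for z
  proof
    assume "eigenvalue_on S M z"
    then obtain v i where i: "i \<in> S" "v i \<noteq> 0"
      and v: "\<And>i. i \<in> S \<Longrightarrow> (\<Sum>j\<in>S. M i j * v j) = z * v i"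
      unfolding eigenvalue_on_def by blast
    obtain m where m: "m < N" "h m = i"
      using i h unfolding bij_betw_def by auto
    let ?w = "vec N (\<lambda>i. v (h i))"
    have "vec_index ?w m \<noteq> 0" using i m by simp
    then have "?w \<noteq> 0\<^sub>v N" using m by (metis index_zero_vec(1))
    moreover have "?A *\<^sub>v ?w = z \<cdot>\<^sub>v ?w"
    proof (intro eq_vecI)
      fix i assume "i < dim_vec (z \<cdot>\<^sub>v ?w)"
      then have i: "i < N" by simp
      then have "h i \<in> S" using h by (auto simp: bij_betw_def)
      from v[OF this] i show "vec_index (?A *\<^sub>v ?w) i = vec_index (z \<cdot>\<^sub>v ?w) i"
        by (simp add: scalar_prod_def reindex)
    qed simp
    ultimately have "eigenvector ?A ?w z" by (simp add: eigenvector_def)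
    then show "eigenvalue ?A z" unfolding eigenvalue_def by blast
  next
    assume "eigenvalue ?A z"
    then obtain w where w: "w \<in> carrier_vec N" "w \<noteq> 0\<^sub>v N" "?A *\<^sub>v w = z \<cdot>\<^sub>v w"
      unfolding eigenvalue_def eigenvector_def by auto
    define v where "v = (\<lambda>i. vec_index w (the_inv_into {0..<N} h i))"
    have vh: "v (h i) = vec_index w i" if "i < N" for i
      using that h by (simp add: v_def the_inv_into_f_f bij_betw_def)
    obtain m where m: "m < N" "vec_index w m \<noteq> 0"
      using w(1,2) by (metis carrier_vecD eq_vecI index_zero_vec(1) index_zero_vec(2))
    have "\<exists>i\<in>S. v i \<noteq> 0"
      using m vh h by (intro bexI[of _ "h m"]) (auto simp: bij_betw_def)
    moreover have "(\<Sum>j\<in>S. M i j * v j) = z * v i" if i: "i \<in> S" for i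
    proof -
      obtain m where m: "m < N" "h m = i"
        using i h unfolding bij_betw_def by auto
      have "vec_index (?A *\<^sub>v w) m = vec_index (z \<cdot>\<^sub>v w) m" using w by simp
      then have "(\<Sum>j=0..<N. M (h m) (h j) * vec_index w j) = z * vec_index w m"
        using m(1) w(1) by (simp add: scalar_prod_def)
      then show ?thesis
        unfolding reindex m(2)[symmetric] by (simp add: vh m(1))
    qed
    ultimately show "eigenvalue_on S M z" unfolding eigenvalue_on_def by blast
  qed
  then show ?thesis unfolding spectrum_def by auto
qed

text \<open>Testing with an eigenvector shows that every complex eigenvalue is real and at least
  \<open>c\<close>. This alone does not bound a \<open>Min\<close>: passing to a matrix shows that
  the set of eigenvalues is finite and, over the complex numbers, not empty.\<close>

lemma lambda_min_ge:
  fixes M :: "'i \<Rightarrow> 'i \<Rightarrow> complex"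
  assumes S: "finite S" "S \<noteq> {}"
    and M: "\<And>v. \<exists>r\<ge>c * (\<Sum>i\<in>S. (cmod (v i))\<^sup>2).
               (\<Sum>i\<in>S. cnj (v i) * (\<Sum>j\<in>S. M i j * v j)) = complex_of_real r"
  shows "lambda_min S M \<ge> c"
proof -
  obtain h where h: "bij_betw h {0..<card S} S"
    using ex_bij_betw_nat_finite S(1) by blast
  let ?A = "mat (card S) (card S) (\<lambda>(i, j). M (h i) (h j))"
  let ?E = "{x::real. eigenvalue_on S M (complex_of_real x)}"
  have A: "?A \<in> carrier_mat (card S) (card S)" by simp
  note spec = eigenvalue_on_spectrum[OF h, of M]
  have real_ge: "\<exists>x\<ge>c. z = complex_of_real x" if z: "eigenvalue_on S M z" for z
  proof -
    obtain v i where i: "i \<in> S" "v i \<noteq> 0"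
      and v: "\<And>i. i \<in> S \<Longrightarrow> (\<Sum>j\<in>S. M i j * v j) = z * v i"
      using z unfolding eigenvalue_on_def by blast
    let ?n = "\<Sum>i\<in>S. (cmod (v i))\<^sup>2"
    have pos: "?n > 0"
      using i S by (intro sum_pos2[of _ i]) auto
    obtain r where r: "r \<ge> c * ?n" "(\<Sum>i\<in>S. cnj (v i) * (\<Sum>j\<in>S. M i j * v j)) = complex_of_real r"
      using M by blast
    have "cnj (v i) * (z * v i) = z * complex_of_real ((cmod (v i))\<^sup>2)" for i
      by (simp only: complex_norm_square) (simp add: algebra_simps)
    then have "(\<Sum>i\<in>S. cnj (v i) * (\<Sum>j\<in>S. M i j * v j)) = (\<Sum>i\<in>S. z * complex_of_real ((cmod (v i))\<^sup>2))"
      by (intro sum.cong refl) (simp only: v)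
    then have "z * complex_of_real ?n = complex_of_real r"
      unfolding r(2) sum_distrib_left[symmetric] of_real_sum by simp
    moreover have "complex_of_real ?n \<noteq> 0"
      using pos by (simp only: of_real_eq_0_iff)
    ultimately have "z = complex_of_real (r / ?n)"
      unfolding of_real_divide by (intro eq_divide_imp)
    moreover have "r / ?n \<ge> c" using pos r(1) by (simp add: field_simps)
    ultimately show ?thesis by blast
  qed
  have "card S > 0" using S by (simp add: card_gt_0_iff)
  then obtain z where "eigenvalue_on S M z"
    using spectrum_non_empty[OF A] spec by blast
  then have ne: "?E \<noteq> {}" using real_ge by blast
  have "complex_of_real ` ?E \<subseteq> spectrum ?A" using spec by auto
  then have "finite (complex_of_real ` ?E)"
    using card_finite_spectrum(1)[OF A] finite_subset by blast
  then have fin: "finite ?E"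
    by (rule finite_imageD) (auto simp: inj_on_def)
  have "x \<ge> c" if "x \<in> ?E" for x
    using real_ge[of "complex_of_real x"] that by auto
  then show ?thesis
    unfolding lambda_min_def using fin ne by (subst Min_ge_iff) auto
qed

section \<open>The first zero of the Bessel function\<close>

definition bessel_coeff :: "real \<Rightarrow> nat \<Rightarrow> real" where
  "bessel_coeff \<nu> m = (-1) ^ m / (fact m * Gamma (real m + \<nu> + 1))"

text \<open>The entire function W with
  \<open>bessel_J \<nu> x = (x / 2) powr \<nu> * W (x\<^sup>2 / 4)\<close> for x > 0. Being a power
  series in the square, it becomes a smooth function of a vector through
  \<open>x \<bullet> x\<close>, also at the origin.\<close>

definition bessel_series :: "real \<Rightarrow> real \<Rightarrow> real" where
  "bessel_series \<nu> s = (\<Sum>m. bessel_coeff \<nu> m * s ^ m)"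

context
  fixes \<nu> :: real
  assumes \<nu>: "\<nu> > 0"
begin

lemma bessel_coeff_Suc:
  "(real m + 1) * (real m + \<nu> + 1) * bessel_coeff \<nu> (Suc m) = - bessel_coeff \<nu> m"
proof -
  have eq: "real (Suc m) + \<nu> + 1 = (real m + \<nu> + 1) + 1" by simp
  have "real m + \<nu> + 1 \<notin> \<int>\<^sub>\<le>\<^sub>0" using \<nu> by (auto elim!: nonpos_Ints_cases)
  then have "Gamma (real (Suc m) + \<nu> + 1) = (real m + \<nu> + 1) * Gamma (real m + \<nu> + 1)"
    unfolding eq by (rule Gamma_plus1)
  then have c_Suc: "bessel_coeff \<nu> (Suc m)
      = - ((-1) ^ m) / (((real m + 1) * fact m) * ((real m + \<nu> + 1) * Gamma (real m + \<nu> + 1)))"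
    unfolding bessel_coeff_def by (simp add: add_ac)
  have "real m + 1 \<noteq> 0" "real m + \<nu> + 1 \<noteq> 0" using \<nu> by auto
  then show ?thesis
    unfolding bessel_coeff_def[of _ m] by (subst c_Suc) simp
qed

lemma abs_bessel_coeff_le: "fact m * \<bar>bessel_coeff \<nu> m\<bar> \<le> \<bar>bessel_coeff \<nu> 0\<bar>"
proof (induction m)
  case (Suc m)
  have "(real m + 1) * \<bar>bessel_coeff \<nu> (Suc m)\<bar> * 1
      \<le> (real m + 1) * \<bar>bessel_coeff \<nu> (Suc m)\<bar> * (real m + \<nu> + 1)"
    using \<nu> by (intro mult_left_mono) auto
  also have "\<dots> = \<bar>(real m + 1) * (real m + \<nu> + 1) * bessel_coeff \<nu> (Suc m)\<bar>"
    using \<nu> by (simp add: abs_mult)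
  also have "\<dots> = \<bar>bessel_coeff \<nu> m\<bar>" unfolding bessel_coeff_Suc by simp
  finally have "fact m * ((real m + 1) * \<bar>bessel_coeff \<nu> (Suc m)\<bar>) \<le> fact m * \<bar>bessel_coeff \<nu> m\<bar>"
    by (intro mult_left_mono) auto
  with Suc show ?case by (simp add: algebra_simps)
qed simp

lemma summable_bessel_series: "summable (\<lambda>m. bessel_coeff \<nu> m * s ^ m)"
proof (rule summable_comparison_test')
  show "summable (\<lambda>m. \<bar>bessel_coeff \<nu> 0\<bar> * (inverse (fact m) * \<bar>s\<bar> ^ m))"
    by (intro summable_mult summable_exp)
  show "norm (bessel_coeff \<nu> m * s ^ m) \<le> \<bar>bessel_coeff \<nu> 0\<bar> * (inverse (fact m) * \<bar>s\<bar> ^ m)" for m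
    using mult_right_mono[OF abs_bessel_coeff_le[of m], of "inverse (fact m) * \<bar>s\<bar> ^ m"]
    by (simp add: abs_mult power_abs field_simps)
qed

lemma bessel_J_eq:
  assumes "x > 0"
  shows "bessel_J \<nu> x = (x / 2) powr \<nu> * bessel_series \<nu> (x\<^sup>2 / 4)"
proof -
  have "(x / 2) powr (2 * real m + \<nu>) = (x / 2) powr \<nu> * (x\<^sup>2 / 4) ^ m" for m
  proof -
    have "(x / 2) powr (2 * real m) = (x / 2) ^ (2 * m)"
      using assms powr_realpow[of "x / 2" "2 * m"] by simp
    also have "\<dots> = (x\<^sup>2 / 4) ^ m"
      by (simp add: power_mult power_divide)
    finally show ?thesis by (simp add: powr_add)
  qed
  then have "bessel_J \<nu> x = (\<Sum>m. (x / 2) powr \<nu> * (bessel_coeff \<nu> m * (x\<^sup>2 / 4) ^ m))"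
    unfolding bessel_J_def bessel_coeff_def by (simp add: mult_ac)
  also have "\<dots> = (x / 2) powr \<nu> * bessel_series \<nu> (x\<^sup>2 / 4)"
    unfolding bessel_series_def by (rule suminf_mult[OF summable_bessel_series])
  finally show ?thesis .
qed

text \<open>Bessel's equation, rewritten for \<open>bessel_series\<close>; coefficient by
  coefficient it is the recursion \<open>bessel_coeff_Suc\<close>.\<close>

lemma bessel_series_ode:
  "\<exists>W' W''. \<forall>s. (bessel_series \<nu> has_real_derivative W' s) (at s) \<and>
     (W' has_real_derivative W'' s) (at s) \<and>
     isCont W'' s \<and> s * W'' s + (\<nu> + 1) * W' s + bessel_series \<nu> s = 0"
proof -
  let ?c = "bessel_coeff \<nu>"
  note c = summable_bessel_series
  have c1: "summable (\<lambda>m. diffs ?c m * s ^ m)" for s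
    by (rule termdiff_converges_all) (rule c)
  have c2: "summable (\<lambda>m. diffs (diffs ?c) m * s ^ m)" for s
    by (rule termdiff_converges_all) (rule c1)
  define W' where "W' = (\<lambda>s. \<Sum>m. diffs ?c m * s ^ m)"
  define W'' where "W'' = (\<lambda>s. \<Sum>m. diffs (diffs ?c) m * s ^ m)"
  have "(bessel_series \<nu> has_real_derivative W' s) (at s)" for s
    unfolding W'_def bessel_series_def[abs_def]
    by (rule termdiffs_strong_converges_everywhere) (rule c)
  moreover have "(W' has_real_derivative W'' s) (at s)" for s
    unfolding W'_def W''_def
    by (rule termdiffs_strong_converges_everywhere) (rule c1)
  moreover have "isCont W'' s" for s
    unfolding W''_def
    by (rule DERIV_isCont, rule termdiffs_strong_converges_everywhere) (rule c2)
  moreover have "s * W'' s + (\<nu> + 1) * W' s + bessel_series \<nu> s = 0" for s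
  proof -
    let ?a = "\<lambda>m. real m * diffs ?c m * s ^ m"
    have "(\<lambda>m. s * (diffs (diffs ?c) m * s ^ m)) sums (s * W'' s)"
      unfolding W''_def by (intro sums_mult summable_sums c2)
    then have "(\<lambda>m. ?a (Suc m)) sums (s * W'' s)"
      by (simp add: diffs_def mult_ac)
    \<comment> \<open>\<open>?a 0 = 0\<close>, so shifting the index back adds nothing.\<close>
    then have "?a sums (s * W'' s)"
      by (subst (asm) sums_Suc_iff) simp
    moreover have "(\<lambda>m. (\<nu> + 1) * (diffs ?c m * s ^ m)) sums ((\<nu> + 1) * W' s)"
      unfolding W'_def by (intro sums_mult summable_sums c1)
    moreover have "(\<lambda>m. ?c m * s ^ m) sums bessel_series \<nu> s"
      unfolding bessel_series_def by (intro summable_sums c)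
    ultimately have "(\<lambda>m. ?a m + (\<nu> + 1) * (diffs ?c m * s ^ m) + ?c m * s ^ m)
        sums (s * W'' s + (\<nu> + 1) * W' s + bessel_series \<nu> s)"
      by (intro sums_add)
    moreover have "?a m + (\<nu> + 1) * (diffs ?c m * s ^ m) + ?c m * s ^ m = 0" for m
    proof -
      have "?a m + (\<nu> + 1) * (diffs ?c m * s ^ m) + ?c m * s ^ m
          = ((real m + 1) * (real m + \<nu> + 1) * ?c (Suc m) + ?c m) * s ^ m"
        by (simp add: diffs_def algebra_simps)
      then show ?thesis unfolding bessel_coeff_Suc by simp
    qed
    ultimately have "(\<lambda>m. 0) sums (s * W'' s + (\<nu> + 1) * W' s + bessel_series \<nu> s)" by simp
    then show ?thesis using sums_unique2[OF _ sums_zero] by blast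
  qed
  ultimately show ?thesis by blast
qed

lemma bessel_series_0: "bessel_series \<nu> 0 > 0"
  using \<nu> powser_zero[of "bessel_coeff \<nu>"] Gamma_real_pos[of "\<nu> + 1"]
  by (simp add: bessel_series_def bessel_coeff_def)

lemma isCont_bessel_series: "isCont (bessel_series \<nu>) s"
proof -
  obtain W' W'' where W: "\<And>s. (bessel_series \<nu> has_real_derivative W' s) (at s)"
    "\<And>s. (W' has_real_derivative W'' s) (at s)"
    "\<And>s. s * W'' s + (\<nu> + 1) * W' s + bessel_series \<nu> s = 0"
    using bessel_series_ode by blast
  show ?thesis by (rule DERIV_isCont[OF W(1)])
qed

text \<open>If there were no zero, then \<open>p = - W' / W\<close> would solve the Riccati equation
  \<open>p' = p\<^sup>2 - (\<nu> + 1) p / s + 1 / s\<close> on the half-line; but its solutions blow up.\<close>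

lemma bessel_series_has_zero: "\<exists>s>0. bessel_series \<nu> s = 0"
proof (rule ccontr)
  let ?W = "bessel_series \<nu>"
  assume "\<not> ?thesis"
  then have nz: "?W s \<noteq> 0" if "s > 0" for s using that by blast
  obtain W' W'' where W': "\<And>s. (?W has_real_derivative W' s) (at s)"
    and W'': "\<And>s. (W' has_real_derivative W'' s) (at s)"
    and ode: "\<And>s. s * W'' s + (\<nu> + 1) * W' s + ?W s = 0"
    using bessel_series_ode by blast
  define p where "p = (\<lambda>s. - W' s / ?W s)"
  define p' where "p' = (\<lambda>s. (p s)\<^sup>2 - (\<nu> + 1) * p s / s + 1 / s)"
  have p: "(p has_real_derivative p' s) (at s)" if "s > 0" for s
  proof -
    have "(p has_real_derivative - ((W'' s * ?W s - W' s * W' s) / (?W s * ?W s))) (at s)"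
      unfolding p_def using nz[OF that] by (auto intro!: derivative_eq_intros W' W'')
    also have "- ((W'' s * ?W s - W' s * W' s) / (?W s * ?W s)) = p' s"
    proof -
      have eq: "W'' s = - ((\<nu> + 1) * W' s + ?W s) / s" using ode[of s] that by (simp add: field_simps)
      show ?thesis
        unfolding p'_def p_def eq using that nz[OF that]
        by (simp add: field_simps power2_eq_square)
    qed
    finally show ?thesis .
  qed
  \<comment> \<open>Beyond this threshold half of the term 1 / s dominates (\<nu> + 1)^2 / (2 s^2),
    the amount that completes the square in the Riccati equation.\<close>
  define a where "a = (\<nu> + 1)\<^sup>2"
  have a: "a > 0" using \<nu> by (simp add: a_def)
  have p'_ge: "p' s \<ge> (p s)\<^sup>2 / 2 + 1 / (2 * s)" if "s \<ge> a" for s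
  proof -
    have s: "s > 0" using a that by simp
    have "(p s)\<^sup>2 / 2 - (\<nu> + 1) * p s / s + a / (2 * s\<^sup>2) = (p s - (\<nu> + 1) / s)\<^sup>2 / 2"
      using s by (simp add: a_def power2_eq_square field_simps)
    moreover have "a / (2 * s\<^sup>2) \<le> 1 / (2 * s)"
      using s that by (simp add: power2_eq_square field_simps)
    ultimately have "(p s)\<^sup>2 / 2 - (\<nu> + 1) * p s / s + 1 / (2 * s) \<ge> 0"
      using zero_le_power2[of "p s - (\<nu> + 1) / s"] by linarith
    moreover have "1 / s = 1 / (2 * s) + 1 / (2 * s)" by simp
    ultimately show ?thesis unfolding p'_def by linarith
  qed
  text \<open>Since \<open>p' \<ge> 1 / (2 s)\<close>, the divergence of the logarithm makes \<open>p\<close> positive eventually.\<close>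
  have "\<exists>b\<ge>a. p b > 0"
  proof -
    have "p s - ln s / 2 \<ge> p a - ln a / 2" if "s \<ge> a" for s
      using that
    proof (rule DERIV_nonneg_imp_nondecreasing)
      fix x assume x: "a \<le> x" "x \<le> s"
      then have x0: "x > 0" using a by simp
      have "((\<lambda>x. p x - ln x / 2) has_real_derivative p' x - 1 / (2 * x)) (at x)"
        using x0 by (auto intro!: derivative_eq_intros p)
      moreover have "p' x - 1 / (2 * x) \<ge> 0"
        using p'_ge[OF x(1)] zero_le_power2[of "p x"] by linarith
      ultimately show "\<exists>y. ((\<lambda>x. p x - ln x / 2) has_real_derivative y) (at x) \<and> 0 \<le> y"
        by blast
    qed
    moreover obtain s where "s \<ge> a" "ln s \<ge> ln a - 2 * p a + 2"
    proof
      show "max a (exp (ln a - 2 * p a + 2)) \<ge> a" by simp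
      show "ln (max a (exp (ln a - 2 * p a + 2))) \<ge> ln a - 2 * p a + 2"
        using a by (subst ln_ge_iff) auto
    qed
    ultimately have "p s - ln s / 2 \<ge> p a - ln a / 2" "ln s \<ge> ln a - 2 * p a + 2" "s \<ge> a" by auto
    then have "p s > 0" by linarith
    with \<open>s \<ge> a\<close> show ?thesis by blast
  qed
  then obtain b where b: "b \<ge> a" "p b > 0" by blast
  have mono: "p b \<le> p s" if "s \<ge> b" for s
    using that
  proof (rule DERIV_nonneg_imp_nondecreasing)
    fix x assume "b \<le> x" "x \<le> s"
    then have "x \<ge> a" "x > 0" using b a by auto
    then show "\<exists>y. (p has_real_derivative y) (at x) \<and> 0 \<le> y"
      using p[of x] p'_ge[of x] zero_le_power2[of "p x"] zero_le_divide_1_iff[of "2 * x"]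
      by (intro exI[of _ "p' x"] conjI) linarith+
  qed
  \<comment> \<open>\<open>p' \<ge> p\<^sup>2 / 2\<close> makes 1 / p fall with slope at most -1/2.
    It would reach 0 by the point \<open>b + 2 / p b\<close>, where p is still positive.\<close>
  have "1 / p s + s / 2 \<le> 1 / p b + b / 2" if "s \<ge> b" for s
    using that
  proof (rule DERIV_nonpos_imp_nonincreasing)
    fix x assume x: "b \<le> x" "x \<le> s"
    then have x0: "x \<ge> a" "x > 0" using b a by auto
    have px: "p x > 0" using mono[OF x(1)] b by simp
    have "((\<lambda>x. 1 / p x + x / 2) has_real_derivative - p' x / (p x * p x) + 1 / 2) (at x)"
      using px by (auto intro!: derivative_eq_intros p x0)
    moreover have "p' x \<ge> (p x)\<^sup>2 / 2"
      using p'_ge[OF x0(1)] x0(2) zero_le_divide_1_iff[of "2 * x"] by linarith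
    then have "- p' x / (p x * p x) + 1 / 2 \<le> 0"
      using px by (simp add: field_simps power2_eq_square)
    ultimately show "\<exists>y. ((\<lambda>x. 1 / p x + x / 2) has_real_derivative y) (at x) \<and> y \<le> 0"
      by blast
  qed
  then have "1 / p (b + 2 / p b) + (b + 2 / p b) / 2 \<le> 1 / p b + b / 2"
    using b by simp
  moreover have "1 / p (b + 2 / p b) > 0"
    using mono[of "b + 2 / p b"] b by simp
  ultimately show False by (simp add: add_divide_distrib)
qed

text \<open>\<open>LEAST\<close> names an actual zero only if there is a smallest positive one. By
  continuity the zeros form a closed set, and a positive value at 0 keeps them away from the
  origin.\<close>

lemma bessel_first_zero:
  shows "bessel_first_zero \<nu> > 0"
    and "bessel_series \<nu> ((bessel_first_zero \<nu>)\<^sup>2 / 4) = 0"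
proof -
  \<comment> \<open>Admitting x = 0 makes the set closed; \<open>bessel_series_0\<close> shows that
    0 does not belong to it.\<close>
  define Z where "Z = {x. 0 \<le> x \<and> bessel_series \<nu> (x\<^sup>2 / 4) = 0}"
  have cont: "continuous_on UNIV (\<lambda>x. bessel_series \<nu> (x\<^sup>2 / 4))"
    by (intro continuous_on_compose2[OF continuous_at_imp_continuous_on[of UNIV "bessel_series \<nu>"]]
        continuous_intros) (auto intro: isCont_bessel_series)
  have "closed {x. bessel_series \<nu> (x\<^sup>2 / 4) = 0}"
    by (intro closed_Collect_eq cont continuous_intros)
  then have "closed Z"
    unfolding Z_def Collect_conj_eq by (intro closed_Int closed_Collect_le) (auto intro: continuous_intros)
  moreover have "Z \<noteq> {}"
  proof -
    obtain s where s: "s > 0" "bessel_series \<nu> s = 0" using bessel_series_has_zero by blast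
    then have "2 * sqrt s \<in> Z" by (simp add: Z_def power_mult_distrib)
    then show ?thesis by blast
  qed
  moreover have bdd: "bdd_below Z" unfolding Z_def by (rule bdd_belowI[of _ 0]) simp
  ultimately have Inf: "Inf Z \<in> Z" by (intro closed_contains_Inf)
  have pos: "x > 0" if "x \<in> Z" for x
    using that bessel_series_0 unfolding Z_def by (cases "x = 0") auto
  have "bessel_first_zero \<nu> = Inf Z"
    unfolding bessel_first_zero_def
  proof (rule Least_equality)
    show "0 < Inf Z \<and> bessel_J \<nu> (Inf Z) = 0"
      using pos[OF Inf] Inf by (simp add: bessel_J_eq Z_def)
    fix y assume "0 < y \<and> bessel_J \<nu> y = 0"
    then have "y \<in> Z" by (auto simp: bessel_J_eq Z_def)
    then show "Inf Z \<le> y" using bdd by (rule cInf_lower)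
  qed
  then show "bessel_first_zero \<nu> > 0" "bessel_series \<nu> ((bessel_first_zero \<nu>)\<^sup>2 / 4) = 0"
    using pos[OF Inf] Inf by (auto simp: Z_def)
qed

end

section \<open>Integration by parts on a ball\<close>

definition has_partial :: "'d \<Rightarrow> (real ^ 'd \<Rightarrow> 'b) \<Rightarrow> (real ^ 'd \<Rightarrow> 'b::real_normed_vector) \<Rightarrow> bool" where
  "has_partial i \<phi> g \<longleftrightarrow>
     (\<forall>x. ((\<lambda>t. \<phi> (x + t *\<^sub>R axis i 1)) has_vector_derivative g x) (at 0))"

lemma has_partial_mult:
  fixes \<phi> \<psi> :: "real ^ 'd \<Rightarrow> 'b::real_normed_algebra"
  assumes "has_partial i \<phi> g" "has_partial i \<psi> h"
  shows "has_partial i (\<lambda>x. \<phi> x * \<psi> x) (\<lambda>x. \<phi> x * h x + g x * \<psi> x)"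
  unfolding has_partial_def
proof
  fix x
  show "((\<lambda>t. \<phi> (x + t *\<^sub>R axis i 1) * \<psi> (x + t *\<^sub>R axis i 1)) has_vector_derivative
          \<phi> x * h x + g x * \<psi> x) (at 0)"
    using has_vector_derivative_mult[of _ _ 0 UNIV] assms by (force simp: has_partial_def)
qed

lemma has_partial_add:
  assumes "has_partial i \<phi> g" "has_partial i \<psi> h"
  shows "has_partial i (\<lambda>x. \<phi> x + \<psi> x) (\<lambda>x. g x + h x)"
  using assms by (auto simp: has_partial_def intro!: has_vector_derivative_add)

lemma has_partial_const: "has_partial i (\<lambda>x. c) (\<lambda>x. 0)"
  by (simp add: has_partial_def)

lemma has_partial_of_real:
  assumes "has_partial i \<phi> g"
  shows "has_partial i (\<lambda>x. complex_of_real (\<phi> x)) (\<lambda>x. complex_of_real (g x))"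
  unfolding has_partial_def
proof
  fix x
  have "((\<lambda>t. \<phi> (x + t *\<^sub>R axis i 1)) has_real_derivative g x) (at 0)"
    using assms by (simp add: has_partial_def has_real_derivative_iff_has_vector_derivative)
  then show "((\<lambda>t. complex_of_real (\<phi> (x + t *\<^sub>R axis i 1))) has_vector_derivative
      complex_of_real (g x)) (at 0)"
    by (rule has_vector_derivative_of_real)
qed

lemma has_partial_component:
  "has_partial i (\<lambda>x. x $ j) (\<lambda>x. if i = j then 1 else 0)"
  unfolding has_partial_def
  by (auto simp: axis_def intro!: derivative_eq_intros)

text \<open>Radial functions are written through \<open>x \<bullet> x\<close> instead of the norm,
  so that the chain rule also holds at the origin.\<close>

lemma has_partial_radial:
  fixes \<Psi> \<psi> :: "real \<Rightarrow> real"
  assumes "\<And>s. (\<Psi> has_real_derivative \<psi> s) (at s)"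
  shows "has_partial i (\<lambda>x :: real ^ 'd. \<Psi> (x \<bullet> x)) (\<lambda>x. 2 * x $ i * \<psi> (x \<bullet> x))"
  unfolding has_partial_def
proof
  fix x :: "real ^ 'd"
  have eq: "(x + t *\<^sub>R axis i 1) \<bullet> (x + t *\<^sub>R axis i 1) = x \<bullet> x + 2 * t * x $ i + t\<^sup>2"
    for t :: real
    by (simp add: inner_axis inner_axis' power2_eq_square algebra_simps)
  have "((\<lambda>t. x \<bullet> x + 2 * t * x $ i + t\<^sup>2) has_real_derivative 2 * x $ i) (at 0)"
    by (auto intro!: derivative_eq_intros)
  then have "((\<lambda>t. \<Psi> (x \<bullet> x + 2 * t * x $ i + t\<^sup>2)) has_real_derivative
      \<psi> (x \<bullet> x) * (2 * x $ i)) (at 0)"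
    using assms[of "x \<bullet> x"] by (intro DERIV_chain2[where f = \<Psi>]) simp_all
  then show "((\<lambda>t. \<Psi> ((x + t *\<^sub>R axis i 1) \<bullet> (x + t *\<^sub>R axis i 1))) has_vector_derivative
      2 * x $ i * \<psi> (x \<bullet> x)) (at 0)"
    unfolding eq by (simp add: has_real_derivative_iff_has_vector_derivative mult_ac)
qed

lemma has_partial_shift:
  assumes "has_partial i \<phi> g"
  shows "((\<lambda>t. \<phi> (x + t *\<^sub>R axis i 1)) has_vector_derivative g (x + s *\<^sub>R axis i 1)) (at s)"
proof -
  have "((\<lambda>t. t - s) has_vector_derivative 1) (at s)"
    by (auto intro!: derivative_eq_intros)
  moreover have "((\<lambda>t. \<phi> ((x + s *\<^sub>R axis i 1) + t *\<^sub>R axis i 1)) has_vector_derivative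
      g (x + s *\<^sub>R axis i 1)) (at (s - s))"
    using assms by (simp add: has_partial_def)
  ultimately have "((\<lambda>t. \<phi> ((x + s *\<^sub>R axis i 1) + t *\<^sub>R axis i 1)) \<circ> (\<lambda>t. t - s)
      has_vector_derivative 1 *\<^sub>R g (x + s *\<^sub>R axis i 1)) (at s)"
    by (rule vector_diff_chain_at)
  then show ?thesis by (simp add: o_def algebra_simps)
qed

lemma has_partial_bound:
  fixes \<phi> :: "real ^ 'd \<Rightarrow> 'b::real_normed_vector"
  assumes \<phi>: "has_partial i \<phi> g"
    and B: "\<And>y. y \<in> cball 0 R \<Longrightarrow> norm (g y) \<le> B"
    and x: "x \<in> cball 0 R" "x + s *\<^sub>R axis i 1 \<in> cball 0 R"
  shows "norm (\<phi> (x + s *\<^sub>R axis i 1) - \<phi> x) \<le> B * \<bar>s\<bar>"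
proof -
  let ?b = "axis i 1 :: real ^ 'd"
  have seg: "x + t *\<^sub>R ?b \<in> cball 0 R" if "t \<in> closed_segment 0 s" for t
  proof -
    have "\<exists>u. 0 \<le> u \<and> u \<le> 1 \<and> t = u * s"
      using that by (auto simp: closed_segment_def)
    then obtain u where u: "0 \<le> u" "u \<le> 1" "t = u * s"
      by blast
    have "x + t *\<^sub>R ?b = (1 - u) *\<^sub>R x + u *\<^sub>R (x + s *\<^sub>R ?b)"
      unfolding u(3) by (simp add: algebra_simps)
    then show ?thesis
      using convexD_alt[OF convex_cball x u(1,2)] by simp
  qed
  have "norm (\<phi> (x + s *\<^sub>R ?b) - \<phi> (x + 0 *\<^sub>R ?b)) \<le> B * norm (s - 0)"
  proof (rule differentiable_bound)
    fix t assume t: "t \<in> closed_segment 0 s"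
    show "((\<lambda>t. \<phi> (x + t *\<^sub>R ?b)) has_derivative (\<lambda>h. h *\<^sub>R g (x + t *\<^sub>R ?b))) (at t within closed_segment 0 s)"
      using has_partial_shift[OF \<phi>] unfolding has_vector_derivative_def
      by (rule has_derivative_at_withinI)
    show "onorm (\<lambda>h. h *\<^sub>R g (x + t *\<^sub>R ?b)) \<le> B"
    proof (rule onorm_le)
      fix h show "norm (h *\<^sub>R g (x + t *\<^sub>R ?b)) \<le> B * norm h"
        using mult_right_mono[OF B[OF seg[OF t]], of "\<bar>h\<bar>"] by (simp add: mult.commute)
    qed
  qed auto
  then show ?thesis by simp
qed

text \<open>A function that vanishes on the sphere stays Lipschitz when it is cut off at the sphere.\<close>

lemma has_partial_bound_cutoff:
  fixes \<phi> :: "real ^ 'd \<Rightarrow> 'b::real_normed_vector"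
  assumes \<phi>: "has_partial i \<phi> g"
    and B: "\<And>y. y \<in> cball 0 R \<Longrightarrow> norm (g y) \<le> B"
    and zero: "\<And>y. norm y = R \<Longrightarrow> \<phi> y = 0"
    and "B \<ge> 0"
  defines "u \<equiv> \<lambda>x. indicator (cball 0 R) x *\<^sub>R \<phi> x"
  shows "norm (u (x + s *\<^sub>R axis i 1) - u x) \<le> B * \<bar>s\<bar>"
proof -
  let ?b = "axis i 1 :: real ^ 'd"
  have exit: "norm (\<phi> x) \<le> B * \<bar>s\<bar>" if x: "x \<in> cball 0 R" "x + s *\<^sub>R ?b \<notin> cball 0 R"
    for x :: "real ^ 'd" and s :: real
  proof -
    \<comment> \<open>The segment meets the sphere on its way out. There \<phi> vanishes, so the
      part of the segment up to that point bounds the value at x.\<close>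
    have "\<exists>t\<ge>0. t \<le> 1 \<and> norm (x + (t * s) *\<^sub>R ?b) = R"
      using x by (intro IVT') (auto intro!: continuous_intros)
    then obtain t where t: "0 \<le> t" "t \<le> 1" "norm (x + (t * s) *\<^sub>R ?b) = R" by blast
    have "norm (\<phi> (x + (t * s) *\<^sub>R ?b) - \<phi> x) \<le> B * \<bar>t * s\<bar>"
      by (rule has_partial_bound[OF \<phi> B]) (use x t in auto)
    also have "\<dots> \<le> B * \<bar>s\<bar>"
    proof -
      show ?thesis
        using t \<open>B \<ge> 0\<close> by (intro mult_left_mono) (auto simp: abs_mult mult_left_le_one_le)
    qed
    finally show ?thesis using zero[OF t(3)] by simp
  qed
  show ?thesis
  proof (cases "x \<in> cball 0 R"; cases "x + s *\<^sub>R ?b \<in> cball 0 R")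
    assume "x \<in> cball 0 R" "x + s *\<^sub>R ?b \<in> cball 0 R"
    then show ?thesis using has_partial_bound[OF \<phi> B, where x = x and s = s] unfolding u_def by simp
  next
    assume "x \<in> cball 0 R" "x + s *\<^sub>R ?b \<notin> cball 0 R"
    then show ?thesis using exit[where x = x and s = s] unfolding u_def by simp
  next
    assume "x \<notin> cball 0 R" "x + s *\<^sub>R ?b \<in> cball 0 R"
    then show ?thesis using exit[where x = "x + s *\<^sub>R ?b" and s = "- s"] unfolding u_def by simp
  next
    assume "x \<notin> cball 0 R" "x + s *\<^sub>R ?b \<notin> cball 0 R"
    then show ?thesis using \<open>B \<ge> 0\<close> unfolding u_def by simp
  qed
qed

lemma lborel_translation:
  fixes u :: "'a::euclidean_space \<Rightarrow> 'b::euclidean_space"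
  assumes "integrable lborel u"
  shows "integrable lborel (\<lambda>x. u (x + a))"
    and "(\<integral>x. u (x + a) \<partial>lborel) = (\<integral>x. u x \<partial>lborel)"
proof -
  have u: "u \<in> borel_measurable borel"
    using borel_measurable_integrable[OF assms] by simp
  have "integrable (distr lborel borel ((+) a)) u"
    using assms by (simp add: lborel_distr_plus)
  then show "integrable lborel (\<lambda>x. u (x + a))"
    using u by (subst (asm) integrable_distr_eq) (auto simp: add.commute)
  have "(\<integral>x. u x \<partial>distr lborel borel ((+) a)) = (\<integral>x. u (a + x) \<partial>lborel)"
    using u by (subst integral_distr) auto
  then show "(\<integral>x. u (x + a) \<partial>lborel) = (\<integral>x. u x \<partial>lborel)"
    by (simp add: lborel_distr_plus add.commute)
qed

text \<open>Translation invariance replaces the divergence theorem: the difference quotients of the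
  cut-off function have integral 0. They converge to \<open>g\<close> inside the ball and to 0
  outside, and the Lipschitz bound for the cut-off function dominates them.\<close>

lemma integral_partial_ball:
  fixes \<phi> :: "real ^ 'd \<Rightarrow> 'b::euclidean_space"
  assumes \<phi>: "has_partial i \<phi> g"
    and cont: "continuous_on UNIV \<phi>" "continuous_on UNIV g"
    and zero: "\<And>y. norm y = R \<Longrightarrow> \<phi> y = 0"
  shows "(LINT x:cball 0 R|lborel. g x) = 0"
proof -
  let ?b = "axis i 1 :: real ^ 'd"
  let ?C = "cball 0 R :: (real ^ 'd) set"
  define u where "u = (\<lambda>x. indicator ?C x *\<^sub>R \<phi> x)"
  obtain B where B: "B \<ge> 0" "\<And>y. y \<in> ?C \<Longrightarrow> norm (g y) \<le> B"
  proof -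
    have "compact (g ` ?C)"
      by (intro compact_continuous_image continuous_on_subset[OF cont(2)]) auto
    then obtain B where "\<forall>y\<in>g ` ?C. norm y \<le> B"
      using compact_imp_bounded bounded_iff by metis
    then show ?thesis by (intro that[of "\<bar>B\<bar>"]) force+
  qed
  have int_u: "integrable lborel u"
    unfolding u_def by (intro borel_integrable_compact continuous_on_subset[OF cont(1)]) auto
  have int_g: "integrable lborel (\<lambda>x. indicator ?C x *\<^sub>R g x)"
    by (intro borel_integrable_compact continuous_on_subset[OF cont(2)]) auto
  define h where "h = (\<lambda>m. inverse (real (Suc m)))"
  have h: "h m > 0" "h m \<le> 1" for m by (auto simp: h_def field_simps)
  have h0: "h \<longlonglongrightarrow> 0" unfolding h_def by (rule LIMSEQ_inverse_real_of_nat)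
  define D where "D = (\<lambda>m x. inverse (h m) *\<^sub>R (u (x + h m *\<^sub>R ?b) - u x))"
  note int_ut = lborel_translation[OF int_u]
  have "(\<integral>x. D m x \<partial>lborel) = 0" for m
    unfolding D_def using int_u int_ut by simp
  moreover have "(\<lambda>m. \<integral>x. D m x \<partial>lborel) \<longlonglongrightarrow> (\<integral>x. indicator ?C x *\<^sub>R g x \<partial>lborel)"
  proof (rule integral_dominated_convergence)
    show "(\<lambda>x. indicator ?C x *\<^sub>R g x) \<in> borel_measurable lborel"
      using int_g by (rule borel_measurable_integrable)
    show "D m \<in> borel_measurable lborel" for m
      unfolding D_def using int_u int_ut by (intro borel_measurable_integrable) auto
    \<comment> \<open>All steps \<open>h m\<close> are at most 1, so every quotient lives on the
      ball of radius R + 1.\<close>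
    show "integrable lborel (\<lambda>x. indicator (cball 0 (R + 1) :: (real ^ 'd) set) x *\<^sub>R B)"
      by (intro borel_integrable_compact) auto
    show "AE x in lborel. norm (D m x) \<le> indicator (cball 0 (R + 1)) x *\<^sub>R B" for m
    proof (rule AE_I2)
      fix x
      have "norm (u (x + h m *\<^sub>R ?b) - u x) \<le> B * h m"
        using has_partial_bound_cutoff[OF \<phi> B(2) zero B(1), where x = x and s = "h m"] h[of m] by (simp add: u_def)
      then have le: "norm (D m x) \<le> B"
        using h(1)[of m] unfolding D_def norm_scaleR by (simp add: field_simps)
      show "norm (D m x) \<le> indicator (cball 0 (R + 1)) x *\<^sub>R B"
      proof (cases "x \<in> cball 0 (R + 1)")
        case False
        have "norm x \<le> norm (x + h m *\<^sub>R ?b) + norm (h m *\<^sub>R ?b)"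
          using norm_triangle_ineq4[of "x + h m *\<^sub>R ?b" "h m *\<^sub>R ?b"] by simp
        then have "x + h m *\<^sub>R ?b \<notin> ?C" "x \<notin> ?C" using False h[of m] by auto
        then show ?thesis using B(1) by (simp add: D_def u_def)
      qed (use le in simp)
    qed
    \<comment> \<open>On the sphere itself the quotients may have the wrong limit.\<close>
    have "sphere 0 R \<in> null_sets (lborel :: (real ^ 'd) measure)"
      using negligible_sphere[of 0 R]
      by (auto simp: null_sets_completion_iff negligible_iff_null_sets negligible_convex_frontier)
    then have "AE x in lborel. x \<notin> (sphere 0 R :: (real ^ 'd) set)"
      by (rule AE_not_in)
    then show "AE x in lborel. (\<lambda>m. D m x) \<longlonglongrightarrow> indicator ?C x *\<^sub>R g x"
    proof eventually_elim
      case (elim x)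
      have lim: "(\<lambda>m. x + h m *\<^sub>R ?b) \<longlonglongrightarrow> x"
        using tendsto_add[OF tendsto_const tendsto_scaleR[OF h0 tendsto_const]] by fastforce
      show ?case
      proof (cases "x \<in> ball 0 R")
        case True
        then have "\<forall>\<^sub>F m in sequentially. x + h m *\<^sub>R ?b \<in> ball 0 R"
          using lim open_ball topological_tendstoD by blast
        then have ev: "\<forall>\<^sub>F m in sequentially. D m x = (\<phi> (x + h m *\<^sub>R ?b) - \<phi> x) /\<^sub>R h m"
          by (rule eventually_mono) (use True in \<open>auto simp: D_def u_def\<close>)
        have "((\<lambda>t. (\<phi> (x + t *\<^sub>R ?b) - \<phi> x) /\<^sub>R t - g x) \<longlongrightarrow> 0) (at 0)"
        proof (rule tendsto_norm_zero_cancel, rule Lim_transform_eventually)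
          show "((\<lambda>t. norm (\<phi> (x + t *\<^sub>R ?b) - \<phi> x - t *\<^sub>R g x) / norm t) \<longlongrightarrow> 0) (at 0)"
            using \<phi> unfolding has_partial_def has_vector_derivative_def has_derivative_at by force
          have "norm (\<phi> (x + t *\<^sub>R ?b) - \<phi> x - t *\<^sub>R g x) / norm t
              = norm ((\<phi> (x + t *\<^sub>R ?b) - \<phi> x) /\<^sub>R t - g x)" if "t \<noteq> 0" for t
          proof -
            have "(\<phi> (x + t *\<^sub>R ?b) - \<phi> x) /\<^sub>R t - g x = (\<phi> (x + t *\<^sub>R ?b) - \<phi> x - t *\<^sub>R g x) /\<^sub>R t"
              using that by (simp add: scaleR_diff_right)
            then show ?thesis by (simp add: divide_inverse mult.commute)
          qed
          then show "\<forall>\<^sub>F t in at 0. norm (\<phi> (x + t *\<^sub>R ?b) - \<phi> x - t *\<^sub>R g x) / norm t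
              = norm ((\<phi> (x + t *\<^sub>R ?b) - \<phi> x) /\<^sub>R t - g x)"
            by (simp add: eventually_at_filter)
        qed
        then have "((\<lambda>t. (\<phi> (x + t *\<^sub>R ?b) - \<phi> x) /\<^sub>R t) \<longlongrightarrow> g x) (at 0)"
          by (simp add: LIM_zero_iff)
        then have "(\<lambda>m. (\<phi> (x + h m *\<^sub>R ?b) - \<phi> x) /\<^sub>R h m) \<longlonglongrightarrow> g x"
          using filterlim_compose[of _ _ "at 0" h sequentially] h0 h(1)
          by (force simp: filterlim_at less_imp_neq[symmetric])
        then show ?thesis
          using True by (subst tendsto_cong[OF ev]) auto
      next
        case False
        then have "x \<in> - ?C" using elim by auto
        then have "\<forall>\<^sub>F m in sequentially. x + h m *\<^sub>R ?b \<in> - ?C"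
          using lim topological_tendstoD[of _ x sequentially "- ?C"] by auto
        then have ev: "\<forall>\<^sub>F m in sequentially. D m x = 0"
          by (rule eventually_mono) (use \<open>x \<in> - ?C\<close> in \<open>auto simp: D_def u_def\<close>)
        then show ?thesis
          using \<open>x \<in> - ?C\<close> by (subst tendsto_cong[OF ev]) auto
      qed
    qed
  qed
  ultimately show ?thesis
    unfolding set_lebesgue_integral_def by (simp add: LIMSEQ_const_iff)
qed

section \<open>Integrals over a ball and moments of radial functions\<close>

abbreviation ball_integral :: "real \<Rightarrow> ('a::euclidean_space \<Rightarrow> 'b::euclidean_space) \<Rightarrow> 'b" where
  "ball_integral R f \<equiv> (LINT x:cball 0 R|lborel. f x)"

lemma set_integrable_cball:
  fixes f :: "'a::euclidean_space \<Rightarrow> 'b::euclidean_space"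
  assumes "continuous_on UNIV f"
  shows "set_integrable lborel (cball 0 R) f"
  unfolding set_integrable_def
  by (intro borel_integrable_compact continuous_on_subset[OF assms]) auto

lemma ball_integral_add:
  fixes f g :: "'a::euclidean_space \<Rightarrow> 'b::euclidean_space"
  assumes "continuous_on UNIV f" "continuous_on UNIV g"
  shows "ball_integral R (\<lambda>x. f x + g x) = ball_integral R f + ball_integral R g"
  using assms by (intro set_integral_add set_integrable_cball)

lemma ball_integral_sum:
  fixes f :: "'i \<Rightarrow> 'a::euclidean_space \<Rightarrow> 'b::euclidean_space"
  assumes "\<And>i. i \<in> A \<Longrightarrow> continuous_on UNIV (f i)"
  shows "ball_integral R (\<lambda>x. \<Sum>i\<in>A. f i x) = (\<Sum>i\<in>A. ball_integral R (f i))"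
  unfolding set_lebesgue_integral_def scaleR_sum_right
  using assms set_integrable_cball unfolding set_integrable_def by (intro Bochner_Integration.integral_sum) blast

lemma ball_integral_mono:
  fixes f g :: "'a::euclidean_space \<Rightarrow> real"
  assumes "continuous_on UNIV f" "continuous_on UNIV g"
    and "\<And>x. norm x \<le> R \<Longrightarrow> f x \<le> g x"
  shows "ball_integral R f \<le> ball_integral R g"
  using assms by (intro set_integral_mono set_integrable_cball) auto

lemma ball_integral_nonneg:
  fixes f :: "'a::euclidean_space \<Rightarrow> real"
  assumes "\<And>x. f x \<ge> 0"
  shows "ball_integral R f \<ge> 0"
  unfolding set_lebesgue_integral_def using assms by (intro Bochner_Integration.integral_nonneg) simp

lemma antiderivative_exists:
  fixes \<psi> :: "real \<Rightarrow> real"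
  assumes "continuous_on UNIV \<psi>"
  shows "\<exists>\<Psi>. \<forall>s. (\<Psi> has_real_derivative \<psi> s) (at s)"
proof -
  have "\<exists>F. \<forall>x::real. -\<infinity> < ereal x \<longrightarrow> ereal x < \<infinity> \<longrightarrow> (F has_vector_derivative \<psi> x) (at x)"
    using assms by (intro einterval_antiderivative) (auto simp: continuous_on_eq_continuous_at)
  then show ?thesis by (auto simp: has_real_derivative_iff_has_vector_derivative)
qed

text \<open>Take \<Psi> with derivative \<psi> / 2 and value 0 at R^2. The i-th derivative of x_j
  \<Psi>(|x|^2) is x_i x_j \<psi>(|x|^2), plus \<Psi>(|x|^2) if i = j, and its integral is 0. So the
  mixed moments vanish and the others do not depend on i.\<close>

lemma integral_radial_moments:
  fixes \<psi> :: "real \<Rightarrow> real"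
  assumes "continuous_on UNIV \<psi>" "R \<ge> 0"
  shows "\<exists>m. \<forall>i j. ball_integral R (\<lambda>x :: real ^ 'd. x $ i * x $ j * \<psi> (x \<bullet> x)) = (if i = j then m else 0)"
proof -
  have "continuous_on UNIV (\<lambda>s. \<psi> s / 2)" using assms(1) by (intro continuous_intros) auto
  from antiderivative_exists[OF this]
  obtain \<Psi>\<^sub>0 where \<Psi>\<^sub>0: "\<And>s. (\<Psi>\<^sub>0 has_real_derivative \<psi> s / 2) (at s)" by blast
  define \<Psi> where "\<Psi> = (\<lambda>s. \<Psi>\<^sub>0 s - \<Psi>\<^sub>0 (R\<^sup>2))"
  have \<Psi>: "(\<Psi> has_real_derivative \<psi> s / 2) (at s)" for s
    unfolding \<Psi>_def by (auto intro!: derivative_eq_intros \<Psi>\<^sub>0)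
  have "continuous_on UNIV \<Psi>"
    using \<Psi> by (intro continuous_at_imp_continuous_on ballI DERIV_isCont)
  then have cont: "continuous_on UNIV (\<lambda>x :: real ^ 'd. \<psi> (x \<bullet> x))"
      "continuous_on UNIV (\<lambda>x :: real ^ 'd. \<Psi> (x \<bullet> x))"
    by (auto intro!: continuous_on_compose2[OF assms(1)] continuous_on_compose2[of UNIV \<Psi>]
        intro: continuous_intros)
  have zero: "\<Psi> (y \<bullet> y) = 0" if "norm y = R" for y :: "real ^ 'd"
    using that by (simp add: \<Psi>_def dot_square_norm)
  have "ball_integral R (\<lambda>x :: real ^ 'd. x $ i * x $ j * \<psi> (x \<bullet> x))
      = (if i = j then - ball_integral R (\<lambda>x :: real ^ 'd. \<Psi> (x \<bullet> x)) else 0)" for i j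
  proof -
    let ?g = "\<lambda>x :: real ^ 'd. x $ i * x $ j * \<psi> (x \<bullet> x)"
    let ?h = "\<lambda>x :: real ^ 'd. (if i = j then 1 else 0) * \<Psi> (x \<bullet> x)"
    have "has_partial i (\<lambda>x. x $ j * \<Psi> (x \<bullet> x))
        (\<lambda>x. x $ j * (2 * x $ i * (\<psi> (x \<bullet> x) / 2)) + (if i = j then 1 else 0) * \<Psi> (x \<bullet> x))"
      by (intro has_partial_mult has_partial_component has_partial_radial \<Psi>)
    then have "has_partial i (\<lambda>x. x $ j * \<Psi> (x \<bullet> x)) (\<lambda>x. ?g x + ?h x)"
      by (simp add: mult_ac)
    then have "ball_integral R (\<lambda>x. ?g x + ?h x) = 0"
      by (rule integral_partial_ball)
        (auto intro!: continuous_intros cont simp: zero)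
    moreover have "ball_integral R (\<lambda>x. ?g x + ?h x) = ball_integral R ?g + ball_integral R ?h"
      by (intro ball_integral_add continuous_intros cont)
    ultimately show ?thesis by auto
  qed
  then show ?thesis by blast
qed

section \<open>Buckling modes of the ball\<close>

text \<open>The gradient \<open>V\<close> of \<open>f\<close> vanishes on the sphere and each of its components is an eigenfunction
  of the Dirichlet Laplacian; so \<open>f\<close> is a buckling mode of the clamped ball, with load \<open>\<mu>\<close>.\<close>

locale buckling_mode =
  fixes R \<mu> m :: real
    and f :: "real ^ 'd \<Rightarrow> real"
    and V :: "'d \<Rightarrow> real ^ 'd \<Rightarrow> real"
    and H T :: "'d \<Rightarrow> 'd \<Rightarrow> real ^ 'd \<Rightarrow> real"
  assumes R: "R > 0"
    and \<mu>: "\<mu> > 0"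
    and cont: "continuous_on UNIV f" "\<And>i. continuous_on UNIV (V i)"
      "\<And>i j. continuous_on UNIV (H i j)" "\<And>i j. continuous_on UNIV (T i j)"
    and sphere: "\<And>x. norm x = R \<Longrightarrow> f x = 0" "\<And>i x. norm x = R \<Longrightarrow> V i x = 0"
    and partial: "\<And>i. has_partial i f (V i)" "\<And>i j. has_partial i (V j) (H i j)"
      "\<And>i j. has_partial i (H i j) (T i j)"
    and eigen: "\<And>j x. (\<Sum>l\<in>UNIV. T l j x) = - \<mu> * V j x"
    and laplacian: "\<exists>c. \<forall>x. (\<Sum>l\<in>UNIV. H l l x) + \<mu> * f x = c"
    and moments: "\<And>i j. ball_integral R (\<lambda>x. V i x * V j x) = (if i = j then m else 0)"
    and nontrivial: "\<exists>x. norm x < R \<and> f x \<noteq> 0"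
begin

abbreviation "I \<equiv> ball_integral R"
definition "mass = I (\<lambda>x. f x * f x)"

lemmas cont' [continuous_intros] =
  cont(1)[THEN continuous_on_subset, OF subset_UNIV]
  cont(2)[THEN continuous_on_subset, OF subset_UNIV]
  cont(3)[THEN continuous_on_subset, OF subset_UNIV]
  cont(4)[THEN continuous_on_subset, OF subset_UNIV]

text \<open>The integrand is half the derivative of f^2. Together with \<open>moments\<close> this
  makes \<open>f\<close> and the components of \<open>V\<close> orthogonal on the ball.\<close>

lemma integral_f_V: "I (\<lambda>x. f x * V i x) = 0"
proof -
  have "I (\<lambda>x. f x * V i x + V i x * f x) = 0"
    by (rule integral_partial_ball[OF has_partial_mult[OF partial(1) partial(1)]])
      (auto intro!: continuous_intros sphere)
  then show ?thesis
    by (subst (asm) ball_integral_add) (auto intro!: continuous_intros simp: mult.commute)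
qed

text \<open>Integration by parts against \<open>V i\<close>, which vanishes on the sphere;
  \<open>eigen\<close> turns the sum of the \<open>T l j\<close> into a multiple of
  \<open>V j\<close>.\<close>

lemma integral_H_H: "(\<Sum>l\<in>UNIV. I (\<lambda>x. H l i x * H l j x)) = (if i = j then \<mu> * m else 0)"
proof -
  have "I (\<lambda>x. V i x * T l j x) + I (\<lambda>x. H l i x * H l j x) = 0" for l
  proof -
    have "I (\<lambda>x. V i x * T l j x + H l i x * H l j x) = 0"
      by (rule integral_partial_ball[OF has_partial_mult[OF partial(2) partial(3)]])
        (auto intro!: continuous_intros simp: sphere)
    then show ?thesis
      by (subst (asm) ball_integral_add) (auto intro!: continuous_intros)
  qed
  then have "(\<Sum>l\<in>UNIV. I (\<lambda>x. H l i x * H l j x)) = - (\<Sum>l\<in>UNIV. I (\<lambda>x. V i x * T l j x))"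
    unfolding sum_negf[symmetric] by (intro sum.cong) (auto simp: add_eq_0_iff)
  also have "(\<Sum>l\<in>UNIV. I (\<lambda>x. V i x * T l j x)) = I (\<lambda>x. \<Sum>l\<in>UNIV. V i x * T l j x)"
    by (rule ball_integral_sum[symmetric]) (auto intro!: continuous_intros)
  also have "(\<lambda>x. \<Sum>l\<in>UNIV. V i x * T l j x) = (\<lambda>x. - \<mu> * (V i x * V j x))"
    unfolding sum_distrib_left[symmetric] eigen by (simp add: mult_ac)
  also have "I (\<lambda>x. - \<mu> * (V i x * V j x)) = - \<mu> * I (\<lambda>x. V i x * V j x)"
    by (rule set_integral_mult_right)
  finally show ?thesis using moments[of i j] by simp
qed

text \<open>The same integration by parts with \<open>f\<close> in the place of \<open>V i\<close>,
  which ends in \<open>integral_f_V\<close>.\<close>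

lemma integral_V_H: "(\<Sum>l\<in>UNIV. I (\<lambda>x. V l x * H l j x)) = 0"
proof -
  have "I (\<lambda>x. f x * T l j x) + I (\<lambda>x. V l x * H l j x) = 0" for l
  proof -
    have "I (\<lambda>x. f x * T l j x + V l x * H l j x) = 0"
      by (rule integral_partial_ball[OF has_partial_mult[OF partial(1) partial(3)]])
        (auto intro!: continuous_intros simp: sphere)
    then show ?thesis
      by (subst (asm) ball_integral_add) (auto intro!: continuous_intros)
  qed
  then have "(\<Sum>l\<in>UNIV. I (\<lambda>x. V l x * H l j x)) = - (\<Sum>l\<in>UNIV. I (\<lambda>x. f x * T l j x))"
    unfolding sum_negf[symmetric] by (intro sum.cong) (auto simp: add_eq_0_iff)
  also have "(\<Sum>l\<in>UNIV. I (\<lambda>x. f x * T l j x)) = I (\<lambda>x. \<Sum>l\<in>UNIV. f x * T l j x)"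
    by (rule ball_integral_sum[symmetric]) (auto intro!: continuous_intros)
  also have "(\<lambda>x. \<Sum>l\<in>UNIV. f x * T l j x) = (\<lambda>x. - \<mu> * (f x * V j x))"
    unfolding sum_distrib_left[symmetric] eigen by (simp add: mult_ac)
  also have "I (\<lambda>x. - \<mu> * (f x * V j x)) = - \<mu> * I (\<lambda>x. f x * V j x)"
    by (rule set_integral_mult_right)
  finally show ?thesis using integral_f_V[of j] by simp
qed

text \<open>This is \<open>0 \<le> \<integral> (\<Delta> f + \<mu> f)\<^sup>2\<close>, where \<open>\<integral> (\<Delta> f)\<^sup>2 = \<mu> \<integral> |\<nabla> f|\<^sup>2\<close>.\<close>

lemma gradient_le: "real CARD('d) * m \<le> \<mu> * mass"
proof -
  obtain c where c: "\<And>x. (\<Sum>l\<in>UNIV. H l l x) + \<mu> * f x = c" using laplacian by blast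
  define L where "L = (\<lambda>x. \<Sum>l\<in>UNIV. H l l x)"
  have contL: "continuous_on UNIV L" unfolding L_def by (intro continuous_intros)
  have f_H: "I (\<lambda>x. f x * H l l x) = - m" for l
  proof -
    have "I (\<lambda>x. f x * H l l x + V l x * V l x) = 0"
      by (rule integral_partial_ball[OF has_partial_mult[OF partial(1) partial(2)]])
        (auto intro!: continuous_intros simp: sphere)
    then have "I (\<lambda>x. f x * H l l x) + I (\<lambda>x. V l x * V l x) = 0"
      by (subst (asm) ball_integral_add) (auto intro!: continuous_intros)
    then show ?thesis by (simp add: moments)
  qed
  have fL: "I (\<lambda>x. f x * L x) = - (real CARD('d) * m)"
    unfolding L_def sum_distrib_left
    by (subst ball_integral_sum) (auto intro!: continuous_intros simp: f_H)
  have intL: "I L = 0"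
    unfolding L_def
  proof (subst ball_integral_sum)
    have "I (H l l) = 0" for l
      by (rule integral_partial_ball[OF partial(2)]) (auto intro!: continuous_intros simp: sphere)
    then show "(\<Sum>l\<in>UNIV. I (H l l)) = 0" by simp
  qed (intro continuous_intros)
  \<comment> \<open>The constant \<open>c\<close> replaces one factor, and only where the other
    factor contributes \<open>L\<close>: then \<open>c * L\<close> integrates to 0 and the integral
    of L^2 never appears.\<close>
  have "(L x + \<mu> * f x) * (L x + \<mu> * f x) = c * L x + \<mu> * (f x * L x) + \<mu> * \<mu> * (f x * f x)" for x
  proof -
    have "c = L x + \<mu> * f x" using c[of x] by (simp add: L_def)
    then show ?thesis by (simp add: algebra_simps)
  qed
  then have "0 \<le> I (\<lambda>x. c * L x + \<mu> * (f x * L x) + \<mu> * \<mu> * (f x * f x))"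
    by (intro ball_integral_nonneg) (metis zero_le_square)
  also have "\<dots> = c * I L + \<mu> * I (\<lambda>x. f x * L x) + \<mu> * \<mu> * mass"
    unfolding mass_def by (simp add: ball_integral_add continuous_intros cont contL)
  finally have "\<mu> * (real CARD('d) * m) \<le> \<mu> * (\<mu> * mass)"
    unfolding fL intL by (simp add: mult_ac)
  then show ?thesis using \<mu> by simp
qed

text \<open>Integrating the divergence of f^2 x expresses d times the mass by the integral of f
  times the radial derivative. The result serves to compare the mass of \<open>f\<close> with that
  of \<open>V i\<close>, so that weights and coordinates get the same constant.\<close>

lemma poincare: "real CARD('d) * mass \<le> 4 * R\<^sup>2 * m"
proof -
  let ?d = "real CARD('d)"
  have d: "?d > 0" by simp
  have comp: "I (\<lambda>x. f x * f x) + 2 * I (\<lambda>x. x $ l * (f x * V l x)) = 0" for l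
  proof -
    have "I (\<lambda>x. x $ l * (f x * V l x + V l x * f x) + (if l = l then 1 else 0) * (f x * f x)) = 0"
      by (rule integral_partial_ball[OF has_partial_mult[OF has_partial_component
            has_partial_mult[OF partial(1) partial(1)]]])
        (auto intro!: continuous_intros simp: sphere)
    then have "I (\<lambda>x. f x * f x + 2 * (x $ l * (f x * V l x))) = 0"
      by (simp add: algebra_simps)
    then show ?thesis
      by (subst (asm) ball_integral_add) (auto intro!: continuous_intros)
  qed
  \<comment> \<open>The weight d / 2 lets half of the left-hand side be absorbed. The other term
    leaves 2 R^2 m, because the squared gradient integrates to d m.\<close>
  have sq: "- 2 * (\<Sum>l\<in>UNIV. x $ l * (f x * V l x))
      \<le> ?d / 2 * (f x * f x) + 2 * R\<^sup>2 / ?d * (\<Sum>l\<in>UNIV. V l x * V l x)" if "norm x \<le> R" for x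
  proof -
    define v where "v = (\<chi> l. V l x)"
    have s: "(\<Sum>l\<in>UNIV. x $ l * (f x * V l x)) = f x * (x \<bullet> v)"
      by (simp add: v_def inner_vec_def sum_distrib_left mult_ac)
    have vv: "(\<Sum>l\<in>UNIV. V l x * V l x) = v \<bullet> v"
      by (simp add: v_def inner_vec_def)
    have "(x \<bullet> v)\<^sup>2 \<le> (x \<bullet> x) * (v \<bullet> v)" by (rule Cauchy_Schwarz_ineq)
    also have "\<dots> \<le> R\<^sup>2 * (v \<bullet> v)"
      using that by (intro mult_right_mono) (auto simp: dot_square_norm power_mono)
    finally have cs: "2 / ?d * (x \<bullet> v)\<^sup>2 \<le> 2 / ?d * (R\<^sup>2 * (v \<bullet> v))"
      by (intro mult_left_mono) auto
    have "?d / 2 * (f x * f x) + 2 / ?d * (x \<bullet> v)\<^sup>2 + 2 * (f x * (x \<bullet> v))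
        = (?d * f x + 2 * (x \<bullet> v))\<^sup>2 / (2 * ?d)"
      using d by (simp add: field_simps power2_eq_square)
    then have "- 2 * (f x * (x \<bullet> v)) \<le> ?d / 2 * (f x * f x) + 2 / ?d * (x \<bullet> v)\<^sup>2"
      using zero_le_power2[of "?d * f x + 2 * (x \<bullet> v)"] d
      by (smt (verit) divide_nonneg_pos)
    with cs show ?thesis unfolding s vv by simp
  qed
  have "?d * mass = (\<Sum>l\<in>(UNIV :: 'd set). I (\<lambda>x. f x * f x))" by (simp add: mass_def)
  also have "\<dots> = (\<Sum>l\<in>UNIV. - 2 * I (\<lambda>x. x $ l * (f x * V l x)))"
    using comp by (intro sum.cong refl) (simp add: add_eq_0_iff)
  also have "\<dots> = - 2 * I (\<lambda>x. \<Sum>l\<in>UNIV. x $ l * (f x * V l x))"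
    unfolding sum_distrib_left[symmetric]
    by (subst ball_integral_sum) (auto intro!: continuous_intros)
  also have "\<dots> = I (\<lambda>x. - 2 * (\<Sum>l\<in>UNIV. x $ l * (f x * V l x)))"
    by (rule set_integral_mult_right[symmetric])
  also have "\<dots> \<le> I (\<lambda>x. ?d / 2 * (f x * f x) + 2 * R\<^sup>2 / ?d * (\<Sum>l\<in>UNIV. V l x * V l x))"
    using sq by (intro ball_integral_mono continuous_intros) auto
  also have "\<dots> = ?d / 2 * mass + 2 * R\<^sup>2 / ?d * (\<Sum>l\<in>UNIV. I (\<lambda>x. V l x * V l x))"
    by (simp add: ball_integral_add ball_integral_sum continuous_intros cont mass_def)
  also have "\<dots> = ?d / 2 * mass + 2 * R\<^sup>2 * m"
    by (simp add: moments)
  finally show ?thesis by (simp add: mult_ac)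
qed

lemma mass_pos: "mass > 0"
proof -
  obtain x0 where x0: "norm x0 < R" "f x0 \<noteq> 0" using nontrivial by blast
  define \<epsilon> where "\<epsilon> = \<bar>f x0\<bar> / 2"
  have \<epsilon>: "\<epsilon> > 0" using x0 by (simp add: \<epsilon>_def)
  have "isCont f x0" using cont(1) by (simp add: continuous_on_eq_continuous_at)
  then obtain r0 where r0: "r0 > 0" "\<And>y. dist y x0 < r0 \<Longrightarrow> dist (f y) (f x0) < \<epsilon>"
    using \<epsilon> unfolding continuous_at_eps_delta dist_norm by metis
  define r where "r = min r0 (R - norm x0)"
  have r: "r > 0" using r0 x0 by (simp add: r_def)
  have sub: "y \<in> cball 0 R \<and> \<epsilon>\<^sup>2 \<le> f y * f y" if "y \<in> ball x0 r" for y
  proof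
    have "norm y \<le> norm x0 + dist y x0" by (metis dist_norm norm_triangle_sub)
    then show "y \<in> cball 0 R" using that by (simp add: r_def dist_commute)
    have "dist (f y) (f x0) < \<epsilon>" using that r0(2)[of y] by (simp add: r_def dist_commute)
    then have "\<bar>\<epsilon>\<bar> \<le> \<bar>f y\<bar>" unfolding \<epsilon>_def dist_real_def by linarith
    then show "\<epsilon>\<^sup>2 \<le> f y * f y" by (simp add: abs_le_square_iff power2_eq_square)
  qed
  have "0 < \<epsilon>\<^sup>2 * measure lborel (ball x0 r)"
    using \<epsilon> r content_ball_gt_0_iff[of x0 r] by simp
  also have "\<dots> = (\<integral>x. indicator (ball x0 r) x *\<^sub>R \<epsilon>\<^sup>2 \<partial>lborel)"
    by simp
  also have "\<dots> \<le> mass"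
    unfolding mass_def set_lebesgue_integral_def
  proof (rule integral_mono)
    show "integrable lborel (\<lambda>x. indicator (ball x0 r) x *\<^sub>R \<epsilon>\<^sup>2)"
      using emeasure_bounded_finite[of "ball x0 r"] by (intro integrable_scaleR_left integrable_real_indicator) auto
    show "integrable lborel (\<lambda>x. indicat_real (cball 0 R) x *\<^sub>R (f x * f x))"
      using set_integrable_cball[of "\<lambda>x. f x * f x" R] unfolding set_integrable_def
      by (simp add: continuous_intros cont)
    show "indicator (ball x0 r) x *\<^sub>R \<epsilon>\<^sup>2 \<le> indicat_real (cball 0 R) x *\<^sub>R (f x * f x)" for x
      using sub[of x] by (auto simp: indicator_def)
  qed
  finally show ?thesis .
qed

text \<open>Pythagoras for the orthogonal functions \<open>f\<close> and \<open>V i\<close>. The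
  coefficients are real; complex ones are split later.\<close>

lemma mass_combination:
  "I (\<lambda>x. (a * f x + (\<Sum>i\<in>UNIV. b i * V i x))\<^sup>2) = a\<^sup>2 * mass + m * (\<Sum>i\<in>UNIV. (b i)\<^sup>2)"
proof -
  have "(a * f x + (\<Sum>i\<in>UNIV. b i * V i x))\<^sup>2 = a\<^sup>2 * (f x * f x) + (\<Sum>i\<in>UNIV. 2 * a * b i * (f x * V i x))
      + (\<Sum>i\<in>UNIV. \<Sum>j\<in>UNIV. b i * b j * (V i x * V j x))" for x
    unfolding power2_sum
    by (simp add: power2_eq_square sum_product sum_distrib_left mult_ac)
  then have "I (\<lambda>x. (a * f x + (\<Sum>i\<in>UNIV. b i * V i x))\<^sup>2) = a\<^sup>2 * mass
      + (\<Sum>i\<in>UNIV. 2 * a * b i * I (\<lambda>x. f x * V i x))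
      + (\<Sum>i\<in>UNIV. \<Sum>j\<in>UNIV. b i * b j * I (\<lambda>x. V i x * V j x))"
    by (simp add: ball_integral_add ball_integral_sum continuous_intros cont mass_def)
  then show ?thesis
    by (simp add: integral_f_V moments if_distrib sum.delta sum_distrib_left power2_eq_square mult_ac cong: if_cong)
qed

text \<open>The left-hand side is the Dirichlet energy of the combination in
  \<open>mass_combination\<close>. The mixed integrals are known only after summation over
  \<open>l\<close>, so the sums are interchanged.\<close>

lemma energy_combination:
  "(\<Sum>l\<in>UNIV. I (\<lambda>x. (a * V l x + (\<Sum>i\<in>UNIV. b i * H l i x))\<^sup>2))
     = a\<^sup>2 * (real CARD('d) * m) + \<mu> * m * (\<Sum>i\<in>UNIV. (b i)\<^sup>2)"
proof -
  have "(a * V l x + (\<Sum>i\<in>UNIV. b i * H l i x))\<^sup>2 = a\<^sup>2 * (V l x * V l x) + (\<Sum>i\<in>UNIV. 2 * a * b i * (V l x * H l i x))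
      + (\<Sum>i\<in>UNIV. \<Sum>j\<in>UNIV. b i * b j * (H l i x * H l j x))" for l x
    unfolding power2_sum
    by (simp add: power2_eq_square sum_product sum_distrib_left mult_ac)
  then have "I (\<lambda>x. (a * V l x + (\<Sum>i\<in>UNIV. b i * H l i x))\<^sup>2) = a\<^sup>2 * m
      + (\<Sum>i\<in>UNIV. 2 * a * b i * I (\<lambda>x. V l x * H l i x))
      + (\<Sum>i\<in>UNIV. \<Sum>j\<in>UNIV. b i * b j * I (\<lambda>x. H l i x * H l j x))" for l
    by (simp add: ball_integral_add ball_integral_sum continuous_intros cont moments)
  then have "(\<Sum>l\<in>UNIV. I (\<lambda>x. (a * V l x + (\<Sum>i\<in>UNIV. b i * H l i x))\<^sup>2))
      = a\<^sup>2 * (real CARD('d) * m)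
      + (\<Sum>l\<in>UNIV. \<Sum>i\<in>UNIV. 2 * a * b i * I (\<lambda>x. V l x * H l i x))
      + (\<Sum>l\<in>UNIV. \<Sum>i\<in>UNIV. \<Sum>j\<in>UNIV. b i * b j * I (\<lambda>x. H l i x * H l j x))"
    by (simp add: sum.distrib mult_ac)
  also have "(\<Sum>l\<in>UNIV. \<Sum>i\<in>UNIV. 2 * a * b i * I (\<lambda>x. V l x * H l i x))
      = (\<Sum>i\<in>UNIV. 2 * a * b i * (\<Sum>l\<in>UNIV. I (\<lambda>x. V l x * H l i x)))"
    by (subst sum.swap) (simp add: sum_distrib_left)
  also have "(\<Sum>l\<in>UNIV. \<Sum>i\<in>UNIV. \<Sum>j\<in>UNIV. b i * b j * I (\<lambda>x. H l i x * H l j x))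
      = (\<Sum>i\<in>UNIV. \<Sum>j\<in>UNIV. b i * b j * (\<Sum>l\<in>UNIV. I (\<lambda>x. H l i x * H l j x)))"
    unfolding sum_distrib_left by (subst sum.swap) (intro sum.cong refl sum.swap)
  finally show ?thesis
    by (simp add: integral_V_H integral_H_H if_distrib sum.delta sum_distrib_left power2_eq_square mult_ac cong: if_cong)
qed

end

lemma has_partial_eq:
  assumes "has_partial i \<phi> g" "\<And>x. g x = h x"
  shows "has_partial i \<phi> h"
proof -
  have "g = h" using assms(2) by blast
  with assms(1) show ?thesis by simp
qed

text \<open>With \<open>\<omega> s = W (\<mu> s / 4)\<close>, the functions \<open>x $ j * \<omega> (x \<bullet> x)\<close> are the eigenfunctions, and
  they form the gradient of \<open>K (x \<bullet> x)\<close>, where \<open>K' = \<omega> / 2\<close>.\<close>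

lemma bessel_buckling_mode:
  fixes j R :: real
  assumes j: "j > 0" "bessel_series (real CARD('d) / 2) (j\<^sup>2 / 4) = 0" and R: "R > 0"
  shows "\<exists>m (f :: real ^ 'd \<Rightarrow> real) V H T. buckling_mode R ((j / R)\<^sup>2) m f V H T"
proof -
  let ?d = "real CARD('d)"
  let ?W = "bessel_series (?d / 2)"
  define \<mu> where "\<mu> = (j / R)\<^sup>2"
  \<comment> \<open>\<open>?W\<close> takes a quarter of the square of the Bessel argument: j |x| /
    R becomes \<kappa> (x \<bullet> x), and the sphere of radius R corresponds to the zero
    j.\<close>
  define \<kappa> where "\<kappa> = \<mu> / 4"
  have d: "?d / 2 > 0" by simp
  obtain W' W'' where W: "\<And>s. (?W has_real_derivative W' s) (at s)"
    "\<And>s. (W' has_real_derivative W'' s) (at s)" "\<And>s. isCont W'' s"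
    "\<And>s. s * W'' s + (?d / 2 + 1) * W' s + ?W s = 0"
    using bessel_series_ode[OF d] by blast
  define \<omega> where "\<omega> = (\<lambda>s. ?W (\<kappa> * s))"
  define \<omega>' where "\<omega>' = (\<lambda>s. \<kappa> * W' (\<kappa> * s))"
  define \<omega>'' where "\<omega>'' = (\<lambda>s. \<kappa>\<^sup>2 * W'' (\<kappa> * s))"
  have lin: "((*) \<kappa> has_real_derivative \<kappa>) (at s)" for s
    by (auto intro!: derivative_eq_intros)
  have \<omega>: "(\<omega> has_real_derivative \<omega>' s) (at s)" for s
    unfolding \<omega>_def \<omega>'_def by (rule DERIV_cong[OF DERIV_chain2[OF W(1) lin]]) simp
  have \<omega>': "(\<omega>' has_real_derivative \<omega>'' s) (at s)" for s
    unfolding \<omega>'_def \<omega>''_def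
    by (rule DERIV_cong[OF DERIV_cmult[OF DERIV_chain2[OF W(2) lin]]]) (simp add: power2_eq_square)
  have ode: "s * \<omega>'' s + (?d / 2 + 1) * \<omega>' s + \<kappa> * \<omega> s = 0" for s
  proof -
    have "s * \<omega>'' s + (?d / 2 + 1) * \<omega>' s + \<kappa> * \<omega> s
        = \<kappa> * ((\<kappa> * s) * W'' (\<kappa> * s) + (?d / 2 + 1) * W' (\<kappa> * s) + ?W (\<kappa> * s))"
      unfolding \<omega>_def \<omega>'_def \<omega>''_def by (simp only: power2_eq_square algebra_simps)
    then show ?thesis by (simp only: W(4) mult_zero_right)
  qed
  have cont: "continuous_on UNIV \<omega>" "continuous_on UNIV \<omega>'" "continuous_on UNIV \<omega>''"
  proof -
    show "continuous_on UNIV \<omega>" "continuous_on UNIV \<omega>'"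
      by (intro continuous_at_imp_continuous_on ballI DERIV_isCont[OF \<omega>] DERIV_isCont[OF \<omega>'])+
    have "continuous_on UNIV W''" using W(3) by (intro continuous_at_imp_continuous_on) blast
    then have "continuous_on UNIV (\<lambda>s. W'' (\<kappa> * s))"
      by (rule continuous_on_compose2) (auto intro!: continuous_intros)
    then show "continuous_on UNIV \<omega>''"
      unfolding \<omega>''_def by (rule continuous_on_mult_left)
  qed
  have "continuous_on UNIV (\<lambda>s. \<omega> s / 2)" using cont(1) by (intro continuous_intros) auto
  from antiderivative_exists[OF this]
  obtain K\<^sub>0 where K\<^sub>0: "\<And>s. (K\<^sub>0 has_real_derivative \<omega> s / 2) (at s)" by blast
  \<comment> \<open>The constant of integration makes \<open>f\<close> vanish on the sphere; the
    gradient vanishes there because \<omega> does.\<close>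
  define K where "K = (\<lambda>s. K\<^sub>0 s - K\<^sub>0 (R\<^sup>2))"
  have K: "(K has_real_derivative \<omega> s / 2) (at s)" for s
    unfolding K_def by (auto intro!: derivative_eq_intros K\<^sub>0)
  have contK: "continuous_on UNIV K"
    by (intro continuous_at_imp_continuous_on ballI DERIV_isCont[OF K])
  have zero: "\<omega> (R\<^sup>2) = 0" "K (R\<^sup>2) = 0"
    using j R by (simp_all add: \<omega>_def K_def \<kappa>_def \<mu>_def power_divide)
  define f where "f = (\<lambda>x :: real ^ 'd. K (x \<bullet> x))"
  define V where "V = (\<lambda>i (x :: real ^ 'd). x $ i * \<omega> (x \<bullet> x))"
  define H where "H = (\<lambda>i j (x :: real ^ 'd).
      2 * x $ i * x $ j * \<omega>' (x \<bullet> x) + (if i = j then \<omega> (x \<bullet> x) else 0))"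
  define T where "T = (\<lambda>i j (x :: real ^ 'd).
      4 * (x $ i)\<^sup>2 * x $ j * \<omega>'' (x \<bullet> x) + 2 * x $ j * \<omega>' (x \<bullet> x)
      + (if i = j then 4 * x $ j * \<omega>' (x \<bullet> x) else 0))"
  obtain m where m: "\<And>i k. ball_integral R (\<lambda>x :: real ^ 'd. x $ i * x $ k * (\<omega> (x \<bullet> x) * \<omega> (x \<bullet> x)))
      = (if i = k then m else 0)"
    using integral_radial_moments[of "\<lambda>s. \<omega> s * \<omega> s" R] cont R by (auto intro: continuous_intros)
  have sq: "(\<Sum>l\<in>UNIV. (x $ l)\<^sup>2) = x \<bullet> x" for x :: "real ^ 'd"
    by (simp add: inner_vec_def power2_eq_square)
  note comp = continuous_on_compose2[OF cont(1)] continuous_on_compose2[OF cont(2)]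
    continuous_on_compose2[OF cont(3)] continuous_on_compose2[OF contK]
  note partial = has_partial_component has_partial_radial[OF \<omega>] has_partial_radial[OF \<omega>']
    has_partial_radial[OF K] has_partial_const
  have "buckling_mode R \<mu> m f V H T"
  proof
    show "R > 0" by (rule R)
    show "\<mu> > 0" using j R by (simp add: \<mu>_def)
    show "continuous_on UNIV f" "continuous_on UNIV (V i)" "continuous_on UNIV (H i k)"
      "continuous_on UNIV (T i k)" for i k
      unfolding f_def V_def H_def T_def
      by (cases "i = k"; auto intro!: continuous_intros comp)+
    show "f x = 0" "V i x = 0" if "norm x = R" for i x
      using that zero by (simp_all add: f_def V_def dot_square_norm)
    show "has_partial i f (V i)" for i
      unfolding f_def V_def by (rule has_partial_eq[OF partial(4)]) simp
    show "has_partial i (V k) (H i k)" for i k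
      unfolding V_def H_def
      by (rule has_partial_eq[OF has_partial_mult[OF partial(1,2)]]) (simp add: mult_ac)
    show "has_partial i (H i k) (T i k)" for i k
    proof -
      let ?\<delta> = "if i = k then 1 else 0 :: real"
      have "has_partial i (\<lambda>x. (2 * x $ i * x $ k) * \<omega>' (x \<bullet> x) + ?\<delta> * \<omega> (x \<bullet> x)) (T i k)"
        by (rule has_partial_eq[OF has_partial_add[OF
                has_partial_mult[OF has_partial_mult[OF has_partial_mult[OF partial(5) partial(1)] partial(1)] partial(3)]
                has_partial_mult[OF partial(5) partial(2)]]])
          (simp add: T_def power2_eq_square algebra_simps)
      moreover have "H i k = (\<lambda>x. (2 * x $ i * x $ k) * \<omega>' (x \<bullet> x) + ?\<delta> * \<omega> (x \<bullet> x))"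
        by (auto simp: H_def)
      ultimately show ?thesis by simp
    qed
    show "(\<Sum>l\<in>UNIV. T l k x) = - \<mu> * V k x" for k x
    proof -
      let ?s = "x \<bullet> x"
      have "(\<Sum>l\<in>UNIV. T l k x) = 4 * x $ k * \<omega>'' ?s * (\<Sum>l\<in>UNIV. (x $ l)\<^sup>2)
          + ?d * (2 * x $ k * \<omega>' ?s) + 4 * x $ k * \<omega>' ?s"
        unfolding T_def by (simp add: sum.distrib sum_distrib_left mult_ac)
      also have "\<dots> = 4 * x $ k * (?s * \<omega>'' ?s + (?d / 2 + 1) * \<omega>' ?s)"
        unfolding sq by (simp add: field_simps)
      also have "?s * \<omega>'' ?s + (?d / 2 + 1) * \<omega>' ?s = - \<kappa> * \<omega> ?s" using ode[of ?s] by linarith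
      finally show ?thesis by (simp add: V_def \<kappa>_def)
    qed
    show "\<exists>c. \<forall>x. (\<Sum>l\<in>UNIV. H l l x) + \<mu> * f x = c"
    proof -
      \<comment> \<open>\<Delta> f + \<mu> f as a function of s = x \<bullet> x. Its derivative is
        twice the left-hand side of \<open>ode\<close>.\<close>
      define g where "g = (\<lambda>s. 2 * s * \<omega>' s + ?d * \<omega> s + \<mu> * K s)"
      have "(g has_real_derivative 2 * (s * \<omega>'' s + (?d / 2 + 1) * \<omega>' s + \<kappa> * \<omega> s)) (at s)" for s
        unfolding g_def
        by (auto intro!: derivative_eq_intros \<omega> \<omega>' K simp: \<kappa>_def field_simps)
      then have "(g has_real_derivative 0) (at s)" for s unfolding ode by simp
      then have const: "g s = g 0" for s by (intro DERIV_isconst_all) blast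
      have "(\<Sum>l\<in>UNIV. H l l x) + \<mu> * f x = g (x \<bullet> x)" for x
      proof -
        have "(\<Sum>l\<in>UNIV. H l l x) = 2 * \<omega>' (x \<bullet> x) * (\<Sum>l\<in>UNIV. (x $ l)\<^sup>2) + ?d * \<omega> (x \<bullet> x)"
          unfolding H_def by (simp add: sum.distrib sum_distrib_left power2_eq_square mult_ac)
        then show ?thesis unfolding sq by (simp add: g_def f_def)
      qed
      then show ?thesis using const by auto
    qed
    show "ball_integral R (\<lambda>x. V i x * V k x) = (if i = k then m else 0)" for i k
      using m[of i k] by (simp add: V_def mult_ac)
    show "\<exists>x. norm x < R \<and> f x \<noteq> 0"
    proof -
      \<comment> \<open>\<open>K\<close> increases at 0, so \<open>f\<close> takes two different
        values near the origin, and one of them is not 0.\<close>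
      have "\<omega> 0 / 2 > 0" using bessel_series_0[OF d] by (simp add: \<omega>_def)
      then obtain e where e: "e > 0" "\<And>h. 0 < h \<Longrightarrow> h < e \<Longrightarrow> K 0 < K (0 + h)"
        using DERIV_pos_inc_right[OF K] by blast
      obtain h where h: "0 < h" "h < e" "h < R\<^sup>2"
        using dense[of 0 "min e (R\<^sup>2)"] e R by auto
      define x where "x = sqrt h *\<^sub>R (axis undefined 1 :: real ^ 'd)"
      have nx: "norm x = sqrt h" using h by (simp add: x_def)
      then have "x \<bullet> x = h" using h by (simp add: dot_square_norm)
      then have "f 0 < f x" using e(2)[OF h(1,2)] by (simp add: f_def)
      moreover have "norm x < R" using h R nx by (simp add: real_less_lsqrt)
      ultimately show ?thesis using R by (cases "f x = 0") (auto intro: exI[of _ 0])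
    qed
  qed
  then show ?thesis unfolding \<mu>_def by blast
qed

section \<open>Fourier series on the torus\<close>

lemma int_lattice_add: "k \<in> int_lattice \<Longrightarrow> l \<in> int_lattice \<Longrightarrow> k + l \<in> int_lattice"
  and int_lattice_minus: "k \<in> int_lattice \<Longrightarrow> - k \<in> int_lattice"
  and int_lattice_diff: "k \<in> int_lattice \<Longrightarrow> l \<in> int_lattice \<Longrightarrow> k - l \<in> int_lattice"
  and int_lattice_0: "0 \<in> int_lattice"
  and int_lattice_axis: "axis i 1 \<in> int_lattice"
  by (auto simp: int_lattice_def axis_def)

lemma int_lattice_inner: "k \<in> int_lattice \<Longrightarrow> l \<in> int_lattice \<Longrightarrow> k \<bullet> l \<in> \<int>"
  unfolding int_lattice_def inner_vec_def by (auto intro!: Ints_sum)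

section \<open>Fundamental domain, periodization and translation\<close>

definition unit_cube :: "(real ^ 'd) set" where
  "unit_cube = {x. \<forall>i. 0 \<le> x $ i \<and> x $ i < 1}"

definition torus :: "(real ^ 'd) measure" where
  "torus = restrict_space lborel unit_cube"

definition periodic :: "(real ^ 'd \<Rightarrow> 'b) \<Rightarrow> bool" where
  "periodic F \<longleftrightarrow> (\<forall>x. \<forall>l\<in>int_lattice. F (x + l) = F x)"

text \<open>The index set is finite when the support of \<open>u\<close> is bounded; otherwise the sum may be the junk value \<open>0\<close>.\<close>

definition periodize :: "(real ^ 'd \<Rightarrow> 'b::comm_monoid_add) \<Rightarrow> real ^ 'd \<Rightarrow> 'b" where
  "periodize u x = (\<Sum>l | l \<in> int_lattice \<and> u (x + l) \<noteq> 0. u (x + l))"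

lemma borel_unit_cube [measurable]: "unit_cube \<in> sets borel"
proof -
  have "(unit_cube :: (real ^ 'd) set) = (\<Inter>i. {x. 0 \<le> x $ i} \<inter> {x. x $ i < 1})"
    by (auto simp: unit_cube_def)
  also have "\<dots> \<in> sets borel"
  proof (rule sets.countable_INT'')
    show "{x :: real ^ 'd. 0 \<le> x $ i} \<inter> {x. x $ i < 1} \<in> sets borel" for i
      by (intro sets.Int borel_closed borel_open closed_Collect_le open_Collect_less)
        (auto intro!: continuous_intros)
  qed auto
  finally show ?thesis .
qed

lemma norm_unit_cube: "x \<in> unit_cube \<Longrightarrow> norm x \<le> real CARD('d)" for x :: "real ^ 'd"
proof -
  assume "x \<in> unit_cube"
  then have "(\<Sum>i\<in>UNIV. \<bar>x $ i\<bar>) \<le> (\<Sum>i\<in>(UNIV :: 'd set). 1)"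
    by (intro sum_mono) (auto simp: unit_cube_def less_imp_le)
  with norm_le_l1_cart[of x] show ?thesis by simp
qed

lemma unit_cube_translate: "\<exists>l\<in>int_lattice. x + l \<in> unit_cube"
proof (intro bexI)
  show "(\<chi> i. - real_of_int \<lfloor>x $ i\<rfloor>) \<in> int_lattice"
    by (auto simp: int_lattice_def)
  show "x + (\<chi> i. - real_of_int \<lfloor>x $ i\<rfloor>) \<in> unit_cube"
    unfolding unit_cube_def by (auto simp: algebra_simps) linarith+
qed

lemma unit_cube_unique:
  assumes "x + k \<in> unit_cube" "x + l \<in> unit_cube" "k \<in> int_lattice" "l \<in> int_lattice"
  shows "k = l"
proof (subst Finite_Cartesian_Product.vec_eq_iff, rule allI)
  fix i
  obtain a b where ab: "k $ i = real_of_int a" "l $ i = real_of_int b"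
    using assms(3,4) unfolding int_lattice_def Ints_def by blast
  have "0 \<le> x $ i + k $ i" "x $ i + k $ i < 1" "0 \<le> x $ i + l $ i" "x $ i + l $ i < 1"
    using assms(1,2) by (auto simp: unit_cube_def)
  then have "real_of_int a < real_of_int b + 1" "real_of_int b < real_of_int a + 1"
    unfolding ab by linarith+
  then have "a = b" by linarith
  then show "k $ i = l $ i" using ab by simp
qed

lemma emeasure_unit_cube: "emeasure lborel (unit_cube :: (real ^ 'd) set) = 1"
proof (rule antisym)
  have one: "(1 :: real ^ 'd) \<bullet> b = 1" if "b \<in> Basis" for b
    using that by (auto simp: Basis_vec_def inner_axis)
  have "emeasure lborel (unit_cube :: (real ^ 'd) set) \<le> emeasure lborel (cbox 0 1 :: (real ^ 'd) set)"
    by (intro emeasure_mono) (auto simp: unit_cube_def mem_box_cart less_imp_le)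
  also have "emeasure lborel (cbox 0 1 :: (real ^ 'd) set) = 1"
    by (subst emeasure_lborel_cbox) (auto simp: one)
  finally show "emeasure lborel (unit_cube :: (real ^ 'd) set) \<le> 1" .
  have "1 = emeasure lborel (box 0 1 :: (real ^ 'd) set)"
    by (subst emeasure_lborel_box) (auto simp: one)
  also have "\<dots> \<le> emeasure lborel (unit_cube :: (real ^ 'd) set)"
    by (intro emeasure_mono) (auto simp: unit_cube_def mem_box_cart less_imp_le)
  finally show "1 \<le> emeasure lborel (unit_cube :: (real ^ 'd) set)" .
qed

lemma integral_torus:
  "integral\<^sup>L torus F = (\<integral>x. indicator unit_cube x *\<^sub>R F x \<partial>lborel)"
  for F :: "real ^ 'd \<Rightarrow> 'b::{banach, second_countable_topology}"
  unfolding torus_def by (subst integral_restrict_space) auto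

lemma integrable_torus:
  "integrable torus F \<longleftrightarrow> integrable lborel (\<lambda>x. indicator unit_cube x *\<^sub>R F x)"
  for F :: "real ^ 'd \<Rightarrow> 'b::{banach, second_countable_topology}"
  unfolding torus_def by (subst integrable_restrict_space) auto

lemma emeasure_torus: "emeasure torus (space torus) = 1"
  unfolding torus_def
  by (subst emeasure_restrict_space) (auto simp: space_restrict_space emeasure_unit_cube)

lemma measurable_torus:
  "F \<in> borel_measurable borel \<Longrightarrow> F \<in> borel_measurable torus"
  unfolding torus_def by (rule measurable_restrict_space1) simp

lemma finite_measure_torus: "finite_measure torus"
  by (rule finite_measureI) (simp add: emeasure_torus)

lemma measure_torus: "measure torus (space torus) = 1"
  by (simp add: measure_def emeasure_torus)

lemma periodize_eq_sum:
  assumes "finite L" "L \<subseteq> int_lattice" "\<And>l. l \<in> int_lattice \<Longrightarrow> u (x + l) \<noteq> 0 \<Longrightarrow> l \<in> L"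
  shows "periodize u x = (\<Sum>l\<in>L. u (x + l))"
  unfolding periodize_def using assms by (intro sum.mono_neutral_left) auto

lemma finite_lattice_support:
  fixes u :: "real ^ 'd \<Rightarrow> 'b::zero"
  assumes "\<And>x. u x \<noteq> 0 \<Longrightarrow> norm x \<le> K"
  shows "l \<in> int_lattice \<Longrightarrow> u (x + l) \<noteq> 0 \<Longrightarrow> l \<in> freqs (K + norm x)"
    and "finite {l \<in> int_lattice. u (x + l) \<noteq> 0}"
proof -
  show *: "l \<in> freqs (K + norm x)" if "l \<in> int_lattice" "u (x + l) \<noteq> 0" for l
  proof -
    have "norm l \<le> norm (x + l) + norm x"
      using norm_triangle_ineq4[of "x + l" x] by simp
    then show ?thesis using assms[OF that(2)] that(1) by (auto simp: freqs_def)
  qed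
  show "finite {l \<in> int_lattice. u (x + l) \<noteq> 0}"
    by (rule finite_subset[OF _ finite_freqs]) (use * in blast)
qed

lemma periodic_periodize: "periodic (periodize u)" for u :: "real ^ 'd \<Rightarrow> 'b::comm_monoid_add"
  unfolding periodic_def
proof (intro allI ballI)
  fix x m :: "real ^ 'd"
  assume "m \<in> int_lattice"
  then show "periodize u (x + m) = periodize u x"
    unfolding periodize_def
    by (intro sum.reindex_bij_witness[where i = "\<lambda>l. l - m" and j = "\<lambda>l. l + m"])
      (auto simp: int_lattice_add int_lattice_diff add_ac)
qed

text \<open>Around each point a single finite set of lattice vectors contains the indices of all
  nonzero summands.\<close>

lemma continuous_periodize:
  fixes u :: "real ^ 'd \<Rightarrow> 'b::real_normed_vector"
  assumes cont: "continuous_on UNIV u" and supp: "\<And>x. u x \<noteq> 0 \<Longrightarrow> norm x \<le> K"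
  shows "continuous_on UNIV (periodize u)"
proof -
  have "isCont (periodize u) x" for x
  proof -
    let ?L = "freqs (K + (norm x + 1)) :: (real ^ 'd) set"
    have "periodize u y = (\<Sum>l\<in>?L. u (y + l))" if "y \<in> ball x 1" for y
    proof (rule periodize_eq_sum[OF finite_freqs])
      fix l assume "l \<in> int_lattice" "u (y + l) \<noteq> 0"
      then have "l \<in> freqs (K + norm y)" using finite_lattice_support(1)[of u K l y] supp by blast
      moreover have "norm y \<le> norm x + 1"
        using that norm_triangle_sub[of y x] by (simp add: dist_norm norm_minus_commute)
      ultimately show "l \<in> ?L" by (auto simp: freqs_def)
    qed (auto simp: freqs_def)
    moreover have "continuous_on (ball x 1) (\<lambda>y. \<Sum>l\<in>?L. u (y + l))"
      by (intro continuous_intros continuous_on_compose2[OF cont]) auto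
    ultimately have "continuous_on (ball x 1) (periodize u)"
      by (subst continuous_on_cong[OF refl]) auto
    then show ?thesis by (simp add: continuous_on_eq_continuous_at)
  qed
  then show ?thesis by (intro continuous_at_imp_continuous_on) auto
qed

text \<open>Unfolding: cut \<open>u\<close> along the translates of the half-open cube, which tile
  the space, and move every piece back into the cube. Bounded support keeps the sums finite.\<close>

lemma integral_periodize:
  fixes u :: "real ^ 'd \<Rightarrow> 'b::euclidean_space"
  assumes u: "integrable lborel u" and supp: "\<And>x. u x \<noteq> 0 \<Longrightarrow> norm x \<le> K"
  shows "integrable torus (periodize u)"
    and "integral\<^sup>L torus (periodize u) = (\<integral>x. u x \<partial>lborel)"
proof -
  define L where "L = (freqs (K + real CARD('d)) :: (real ^ 'd) set)"
  have L: "finite L" "L \<subseteq> int_lattice"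
    unfolding L_def by (rule finite_freqs) (auto simp: freqs_def)
  have in_L: "l \<in> L" if "x \<in> unit_cube" "l \<in> int_lattice" "u (x + l) \<noteq> 0" for x l
    using finite_lattice_support(1)[of u K l x] supp that norm_unit_cube[OF that(1)]
    by (auto simp: L_def freqs_def)
  define w where "w = (\<lambda>l x. indicator unit_cube (x - l) *\<^sub>R u x)"
  have int_w: "integrable lborel (w l)" for l
  proof -
    have "(\<lambda>x :: real ^ 'd. x - l) -` unit_cube \<in> sets borel"
      using measurable_sets[OF _ borel_unit_cube, of "\<lambda>x. x - l" borel] by simp
    moreover have "w l = (\<lambda>x. indicator ((\<lambda>x. x - l) -` unit_cube) x *\<^sub>R u x)"
      by (auto simp: w_def indicator_def)
    ultimately show ?thesis using u by (simp add: integrable_mult_indicator)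
  qed
  have per: "indicator unit_cube x *\<^sub>R periodize u x = (\<Sum>l\<in>L. w l (x + l))" for x
  proof (cases "x \<in> unit_cube")
    case True
    then show ?thesis
      using periodize_eq_sum[OF L, of u x] in_L[OF True] by (simp add: w_def)
  qed (simp add: w_def)
  have sum_w: "(\<Sum>l\<in>L. w l x) = u x" for x
  proof (cases "u x = 0")
    case False
    obtain l where l: "l \<in> int_lattice" "x + l \<in> unit_cube" using unit_cube_translate by blast
    have "- l \<in> L" using in_L[OF l(2), of "- l"] False l(1) by (simp add: int_lattice_minus)
    moreover have "w k x = 0" if "k \<in> L - {- l}" for k
    proof -
      have "k \<in> int_lattice" using that L by auto
      then have "x - k \<notin> unit_cube"
        using unit_cube_unique[OF l(2), of "- k"] l(1) that by (auto simp: int_lattice_minus)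
      then show ?thesis by (simp add: w_def)
    qed
    ultimately have "(\<Sum>k\<in>L. w k x) = w (- l) x"
      using L(1) by (simp add: sum.remove)
    then show ?thesis using l by (simp add: w_def)
  qed (simp add: w_def)
  have int: "integrable lborel (\<lambda>x. \<Sum>l\<in>L. w l (x + l))"
    by (intro Bochner_Integration.integrable_sum lborel_translation int_w)
  then show "integrable torus (periodize u)" by (simp add: integrable_torus per)
  have "integral\<^sup>L torus (periodize u) = (\<integral>x. (\<Sum>l\<in>L. w l (x + l)) \<partial>lborel)"
    by (simp add: integral_torus per)
  also have "\<dots> = (\<Sum>l\<in>L. \<integral>x. w l (x + l) \<partial>lborel)"
    by (intro Bochner_Integration.integral_sum lborel_translation int_w)
  also have "\<dots> = (\<Sum>l\<in>L. \<integral>x. w l x \<partial>lborel)"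
    by (intro sum.cong refl lborel_translation int_w)
  also have "\<dots> = (\<integral>x. (\<Sum>l\<in>L. w l x) \<partial>lborel)"
    by (intro Bochner_Integration.integral_sum[symmetric] int_w)
  finally show "integral\<^sup>L torus (periodize u) = (\<integral>x. u x \<partial>lborel)" by (simp add: sum_w)
qed

text \<open>Cut \<open>F\<close> off outside the cube and translate. The periodization of the result
  is the translate of \<open>F\<close>, so unfolding reduces the claim to translation invariance of
  Lebesgue measure.\<close>

lemma integral_torus_translation:
  fixes F :: "real ^ 'd \<Rightarrow> 'b::euclidean_space"
  assumes per: "periodic F" and F: "integrable torus F"
  shows "integral\<^sup>L torus (\<lambda>x. F (x + y)) = integral\<^sup>L torus F"
proof -
  define u where "u = (\<lambda>x. indicator unit_cube x *\<^sub>R F x)"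
  have u: "integrable lborel u" using F by (simp add: integrable_torus u_def)
  have pu: "periodize (\<lambda>x. u (x + y)) = (\<lambda>x. F (x + y))"
  proof
    fix x
    obtain l where l: "l \<in> int_lattice" "x + y + l \<in> unit_cube"
      using unit_cube_translate[of "x + y"] by blast
    have "periodize (\<lambda>x. u (x + y)) x = (\<Sum>l\<in>{l}. u (x + l + y))"
    proof (rule periodize_eq_sum)
      fix k assume "k \<in> int_lattice" "u (x + k + y) \<noteq> 0"
      then show "k \<in> {l}"
        using unit_cube_unique[OF l(2), of k] l(1)
        by (auto simp: u_def indicator_def add_ac split: if_splits)
    qed (use l in auto)
    also have "\<dots> = F (x + y + l)" using l by (simp add: u_def add_ac)
    also have "\<dots> = F (x + y)" using per l(1) by (simp add: periodic_def)
    finally show "periodize (\<lambda>x. u (x + y)) x = F (x + y)" .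
  qed
  have "integral\<^sup>L torus (periodize (\<lambda>x. u (x + y))) = (\<integral>x. u (x + y) \<partial>lborel)"
  proof (rule integral_periodize)
    show "norm x \<le> real CARD('d) + norm y" if "u (x + y) \<noteq> 0" for x
    proof -
      have "x + y \<in> unit_cube" using that by (auto simp: u_def indicator_def split: if_splits)
      then show ?thesis
        using norm_unit_cube[of "x + y"] norm_triangle_ineq4[of "x + y" y] by simp
    qed
  qed (rule lborel_translation[OF u])
  also have "\<dots> = (\<integral>x. u x \<partial>lborel)" by (rule lborel_translation[OF u])
  finally show ?thesis unfolding pu by (simp add: integral_torus u_def)
qed

section \<open>Characters and density of trigonometric polynomials\<close>

definition character :: "real ^ 'd \<Rightarrow> real ^ 'd \<Rightarrow> complex" where
  "character k x = cis (2 * pi * (k \<bullet> x))"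

lemma character_add_right: "character k (x + y) = character k x * character k y"
  and character_add: "character (k + l) x = character k x * character l x"
  by (simp_all add: character_def inner_add_left inner_add_right distrib_left cis_mult)

lemma cnj_character: "cnj (character k x) = character (- k) x"
  by (simp add: character_def cis_cnj)

lemma character_0 [simp]: "character 0 x = 1"
  by (simp add: character_def)

lemma norm_character [simp]: "cmod (character k x) = 1"
  by (simp add: character_def)

lemma cis_2pi_eq_1_iff: "cis (2 * pi * a) = 1 \<longleftrightarrow> a \<in> \<int>"
proof
  assume "cis (2 * pi * a) = 1"
  then have "cos (2 * pi * a) = 1" by (metis cis.sel(1) one_complex.sel(1))
  then obtain n where "2 * pi * a = real_of_int n * 2 * pi"
    using cos_one_2pi_int by blast
  then show "a \<in> \<int>" by simp
next
  assume "a \<in> \<int>"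
  then show "cis (2 * pi * a) = 1" by (rule cis_multiple_2pi)
qed

lemma periodic_character: "k \<in> int_lattice \<Longrightarrow> periodic (character k)"
  unfolding periodic_def character_add_right
  by (simp add: character_def[of k] cis_2pi_eq_1_iff int_lattice_inner)

lemma continuous_character [continuous_intros]:
  "continuous_on S f \<Longrightarrow> continuous_on S (\<lambda>x. character k (f x))"
  unfolding character_def by (intro continuous_intros)

lemma measurable_character [measurable]: "character k \<in> borel_measurable borel"
  by (intro borel_measurable_continuous_onI continuous_intros)

lemma integrable_torus_bounded:
  fixes F :: "real ^ 'd \<Rightarrow> 'b::{banach, second_countable_topology}"
  assumes "F \<in> borel_measurable borel" "\<And>x. norm (F x) \<le> B"
  shows "integrable torus F"
  using assms by (intro finite_measure.integrable_const_bound[OF finite_measure_torus, of _ B]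
      measurable_torus) auto

lemma integral_character:
  assumes k: "k \<in> int_lattice"
  shows "integral\<^sup>L torus (character k) = (if k = 0 then 1 else 0)"
proof (cases "k = 0")
  case True
  then show ?thesis by (simp add: character_0[abs_def] measure_torus)
next
  case False
  \<comment> \<open>Half a period in the direction of k: k \<bullet> y = 1 / 2. Translation by y
    changes the sign of the character, so its integral equals its own negative.\<close>
  define y where "y = (1 / (2 * (k \<bullet> k))) *\<^sub>R k"
  have "2 * pi * (k \<bullet> y) = pi" using False by (simp add: y_def)
  then have "character k y = cis pi" by (simp only: character_def)
  then have cy: "character k y = -1" by simp
  have int: "integrable torus (character k)"
    by (rule integrable_torus_bounded[where B = 1]) auto
  have "integral\<^sup>L torus (character k) = integral\<^sup>L torus (\<lambda>x. character k (x + y))"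
    by (rule integral_torus_translation[symmetric, OF periodic_character[OF k] int])
  also have "\<dots> = - integral\<^sup>L torus (character k)"
    unfolding character_add_right cy by simp
  finally show ?thesis using False by (simp add: eq_neg_iff_add_eq_0)
qed

text \<open>Defined by closure, so that products are handled by induction on both factors;
  \<open>trig_polynomial_expansion\<close> recovers the explicit sum.\<close>

inductive trig_polynomial :: "(real ^ 'd \<Rightarrow> complex) \<Rightarrow> bool" where
  character: "k \<in> int_lattice \<Longrightarrow> trig_polynomial (character k)"
| add: "trig_polynomial F \<Longrightarrow> trig_polynomial G \<Longrightarrow> trig_polynomial (\<lambda>x. F x + G x)"
| scale: "trig_polynomial F \<Longrightarrow> trig_polynomial (\<lambda>x. c * F x)"

lemma trig_polynomial_const: "trig_polynomial (\<lambda>x. c)"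
  using trig_polynomial.scale[OF trig_polynomial.character[OF int_lattice_0], of c] by simp

lemma trig_polynomial_sum:
  "(\<And>i. i \<in> A \<Longrightarrow> trig_polynomial (F i)) \<Longrightarrow> trig_polynomial (\<lambda>x. \<Sum>i\<in>A. F i x)"
  by (induction A rule: infinite_finite_induct)
    (auto intro: trig_polynomial_const trig_polynomial.add)

lemma trig_polynomial_mult:
  assumes "trig_polynomial F" "trig_polynomial G"
  shows "trig_polynomial (\<lambda>x. F x * G x)"
  using assms(1)
proof induction
  case (character k)
  show ?case
    using assms(2)
  proof induction
    case (character l)
    then have "trig_polynomial (character (k + l))"
      using \<open>k \<in> int_lattice\<close> by (intro trig_polynomial.character int_lattice_add)
    moreover have "character (k + l) = (\<lambda>x. character k x * character l x)"
      by (rule ext) (rule character_add)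
    ultimately show ?case by simp
  next
    case (add F G)
    then show ?case by (simp add: distrib_left trig_polynomial.add)
  next
    case (scale F c)
    then show ?case using trig_polynomial.scale[of _ c] by (simp add: mult.left_commute)
  qed
next
  case (add F F')
  then show ?case by (simp add: distrib_right trig_polynomial.add)
next
  case (scale F c)
  then show ?case using trig_polynomial.scale[of _ c] by (simp add: mult.assoc)
qed

lemma trig_polynomial_expansion:
  assumes "trig_polynomial F"
  shows "\<exists>S p. finite S \<and> S \<subseteq> int_lattice \<and> F = (\<lambda>x. \<Sum>k\<in>S. p k * character k x)"
  using assms
proof induction
  case (character k)
  then show ?case by (intro exI[of _ "{k}"] exI[of _ "\<lambda>_. 1"]) auto
next
  case (add F G)
  then obtain S p S' p' where S: "finite S" "S \<subseteq> int_lattice" "F = (\<lambda>x. \<Sum>k\<in>S. p k * character k x)"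
    and S': "finite S'" "S' \<subseteq> int_lattice" "G = (\<lambda>x. \<Sum>k\<in>S'. p' k * character k x)"
    by blast
  define r where "r = (\<lambda>k. (if k \<in> S then p k else 0) + (if k \<in> S' then p' k else 0))"
  have "F x = (\<Sum>k\<in>S \<union> S'. (if k \<in> S then p k else 0) * character k x)"
    "G x = (\<Sum>k\<in>S \<union> S'. (if k \<in> S' then p' k else 0) * character k x)" for x
    unfolding S(3) S'(3) by (rule sum.mono_neutral_cong_left; use S(1) S'(1) in force)+
  then have "(\<lambda>x. F x + G x) = (\<lambda>x. \<Sum>k\<in>S \<union> S'. r k * character k x)"
    unfolding r_def by (simp add: distrib_right sum.distrib)
  then show ?case using S(1,2) S'(1,2) by (intro exI[of _ "S \<union> S'"] exI[of _ r]) auto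
next
  case (scale F c)
  then obtain S p where "finite S" "S \<subseteq> int_lattice" "F = (\<lambda>x. \<Sum>k\<in>S. p k * character k x)"
    by blast
  then show ?case
    by (intro exI[of _ S] exI[of _ "\<lambda>k. c * p k"]) (auto simp: sum_distrib_left mult.assoc)
qed

text \<open>Identifies the torus with a compact subset of a Euclidean space, where the
  Stone-Weierstrass theorem for polynomials applies.\<close>

definition torus_embedding :: "real ^ 'd \<Rightarrow> complex ^ 'd" where
  "torus_embedding x = (\<chi> i. cis (2 * pi * x $ i))"

lemma continuous_torus_embedding: "continuous_on S torus_embedding"
  unfolding torus_embedding_def by (intro continuous_intros)

lemma torus_embedding_eq_iff: "torus_embedding x = torus_embedding y \<longleftrightarrow> x - y \<in> int_lattice"
proof -
  have "cis (2 * pi * a) = cis (2 * pi * b) \<longleftrightarrow> a - b \<in> \<int>" for a b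
  proof -
    have "cis (2 * pi * (a - b)) = cis (2 * pi * a) / cis (2 * pi * b)"
      by (simp add: cis_divide right_diff_distrib)
    then show ?thesis using cis_2pi_eq_1_iff[of "a - b"] by (auto simp: cis_neq_zero)
  qed
  then show ?thesis by (simp add: torus_embedding_def Finite_Cartesian_Product.vec_eq_iff int_lattice_def)
qed

text \<open>Sums and products stay inside the class, so linear functionals are the main case. The
  real and imaginary parts of the coordinates are cosines and sines, hence combinations of the
  characters of plus and minus a unit vector.\<close>

lemma trig_polynomial_real_polynomial:
  fixes r :: "complex ^ 'd \<Rightarrow> real"
  assumes "real_polynomial_function r"
  shows "trig_polynomial (\<lambda>x. complex_of_real (r (torus_embedding x)))"
  using assms
proof induction
  case (linear r)
  interpret bounded_linear r by (rule linear)
  have exp: "complex_of_real (r (torus_embedding x))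
      = (\<Sum>i\<in>UNIV. of_real (r (axis i 1) / 2) * (character (axis i 1) x + character (- axis i 1) x)
          + (of_real (r (axis i \<i>)) / (2 * \<i>)) * (character (axis i 1) x + (-1) * character (- axis i 1) x))"
    for x :: "real ^ 'd"
  proof -
    have ax: "axis i (cis (2 * pi * x $ i))
        = cos (2 * pi * x $ i) *\<^sub>R (axis i 1 :: complex ^ 'd) + sin (2 * pi * x $ i) *\<^sub>R axis i \<i>" for i
      by (auto simp: Finite_Cartesian_Product.vec_eq_iff axis_def complex_eq_iff)
    have "torus_embedding x = (\<Sum>i\<in>UNIV. axis i (cis (2 * pi * x $ i)))"
      by (simp add: Finite_Cartesian_Product.vec_eq_iff torus_embedding_def axis_def if_distrib sum.delta' cong: if_cong)
    then have "r (torus_embedding x)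
        = (\<Sum>i\<in>UNIV. cos (2 * pi * x $ i) * r (axis i 1) + sin (2 * pi * x $ i) * r (axis i \<i>))"
      by (simp add: ax sum add scaleR)
    moreover have cs: "complex_of_real (cos (2 * pi * x $ i)) = (character (axis i 1) x + character (- axis i 1) x) / 2"
      "complex_of_real (sin (2 * pi * x $ i)) = (character (axis i 1) x + (-1) * character (- axis i 1) x) / (2 * \<i>)" for i
      by (simp_all add: character_def inner_axis' complex_eq_iff Re_divide Im_divide)
    ultimately show ?thesis
      by (simp only: of_real_sum of_real_add of_real_mult cs) (simp add: mult_ac)
  qed
  show ?case
    unfolding exp
    by (intro trig_polynomial_sum trig_polynomial.intros int_lattice_axis int_lattice_minus)
next
  case (const c)
  show ?case by (rule trig_polynomial_const)
next
  case (add f g)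
  then show ?case by (simp add: trig_polynomial.add)
next
  case (mult f g)
  then show ?case by (simp add: trig_polynomial_mult)
qed

lemma trig_polynomials_dense:
  fixes F :: "real ^ 'd \<Rightarrow> complex"
  assumes cont: "continuous_on UNIV F" and per: "periodic F" and e: "\<epsilon> > 0"
  shows "\<exists>P. trig_polynomial P \<and> (\<forall>x. cmod (F x - P x) < \<epsilon>)"
proof -
  let ?E = "torus_embedding :: real ^ 'd \<Rightarrow> complex ^ 'd"
  let ?S = "?E ` cbox 0 1"
  define F' where "F' = (\<lambda>z. F (SOME x. ?E x = z))"
  have F_eq: "F x = F y" if "?E x = ?E y" for x y
  proof -
    have "F (y + (x - y)) = F y"
      using per that unfolding periodic_def torus_embedding_eq_iff by blast
    then show ?thesis by simp
  qed
  have F': "F' (?E x) = F x" for x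
    unfolding F'_def using someI[of "\<lambda>y. ?E y = ?E x" x] by (intro F_eq) simp
  have in_S: "?E x \<in> ?S" for x
  proof -
    obtain l where l: "l \<in> int_lattice" "x + l \<in> unit_cube" using unit_cube_translate by blast
    have "?E x = ?E (x + l)" using l by (simp add: torus_embedding_eq_iff int_lattice_minus)
    moreover have "x + l \<in> cbox 0 1" using l by (auto simp: unit_cube_def mem_box_cart less_imp_le)
    ultimately show ?thesis by blast
  qed
  have S: "compact ?S" by (intro compact_continuous_image continuous_torus_embedding) auto
  \<comment> \<open>Continuity descends to the quotient by compactness: the preimage of a closed set
    under \<open>F'\<close> is the image of a compact part of the cube.\<close>
  have "continuous_on ?S F'"
    unfolding continuous_on_closed_vimage[OF compact_imp_closed[OF S]]
  proof (intro allI impI)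
    fix C :: "complex set"
    assume "closed C"
    then have "closed (F -` C)"
      using continuous_closed_vimage cont by (auto simp: continuous_on_eq_continuous_at)
    then have "compact (cbox 0 1 \<inter> F -` C)" by (intro compact_Int_closed) auto
    then have "compact (?E ` (cbox 0 1 \<inter> F -` C))"
      by (intro compact_continuous_image continuous_torus_embedding)
    moreover have "F' -` C \<inter> ?S = ?E ` (cbox 0 1 \<inter> F -` C)" using F' by auto
    ultimately show "closed (F' -` C \<inter> ?S)" by (simp add: compact_imp_closed)
  qed
  from Stone_Weierstrass_polynomial_function[OF S this e]
  obtain g where g: "polynomial_function g" "\<And>z. z \<in> ?S \<Longrightarrow> cmod (F' z - g z) < \<epsilon>" by blast
  have "real_polynomial_function (\<lambda>z. Re (g z))" "real_polynomial_function (\<lambda>z. Im (g z))"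
    using g(1) bounded_linear_Re bounded_linear_Im unfolding polynomial_function_def o_def by blast+
  note this[THEN trig_polynomial_real_polynomial]
  from trig_polynomial.add[OF this(1) trig_polynomial.scale[OF this(2), of \<i>]]
  have "trig_polynomial (\<lambda>x. g (?E x))"
    by (simp add: complex_eq[symmetric])
  then show ?thesis using g(2)[OF in_S] by (auto simp: F')
qed

section \<open>Fourier coefficients and one-sided forms of Parseval\<close>

definition fourier_coeff :: "(real ^ 'd \<Rightarrow> complex) \<Rightarrow> real ^ 'd \<Rightarrow> complex" where
  "fourier_coeff F k = integral\<^sup>L torus (\<lambda>x. F x * cnj (character k x))"

lemma square_integrable_integrable:
  fixes F :: "real ^ 'd \<Rightarrow> complex"
  assumes F: "F \<in> borel_measurable torus" "integrable torus (\<lambda>x. (cmod (F x))\<^sup>2)"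
  shows "integrable torus F"
proof (rule Bochner_Integration.integrable_bound)
  interpret finite_measure torus by (rule finite_measure_torus)
  show "integrable torus (\<lambda>x. 1 + (cmod (F x))\<^sup>2)" using F by simp
  show "AE x in torus. norm (F x) \<le> norm (1 + (cmod (F x))\<^sup>2)"
  proof (rule AE_I2)
    fix x
    have "2 * cmod (F x) \<le> 1 + (cmod (F x))\<^sup>2"
      using sum_squares_bound[of 1 "cmod (F x)"] by simp
    then have "cmod (F x) \<le> 1 + (cmod (F x))\<^sup>2"
      using norm_ge_zero[of "F x"] by linarith
    then show "norm (F x) \<le> norm (1 + (cmod (F x))\<^sup>2)" by simp
  qed
qed (rule F)

lemma integrable_mult_character:
  assumes "integrable torus F"
  shows "integrable torus (\<lambda>x. F x * cnj (character k x))"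
proof (rule Bochner_Integration.integrable_bound[OF assms])
  have "(\<lambda>x. cnj (character k x)) \<in> borel_measurable torus"
    unfolding cnj_character by (intro measurable_torus measurable_character)
  then show "(\<lambda>x. F x * cnj (character k x)) \<in> borel_measurable torus"
    using borel_measurable_integrable[OF assms] by simp
qed (simp add: norm_mult)

text \<open>Completing the square in the coefficients. If \<open>p\<close> are the Fourier
  coefficients, the last sum is 0 and Bessel's inequality follows; for an approximating polynomial,
  dropping that sum bounds the mass that the coefficients miss.\<close>

lemma integral_trig_polynomial_distance:
  fixes F :: "real ^ 'd \<Rightarrow> complex"
  assumes F: "F \<in> borel_measurable torus" "integrable torus (\<lambda>x. (cmod (F x))\<^sup>2)"
    and S: "finite S" "S \<subseteq> int_lattice"
  shows "(\<integral>x. (cmod (F x - (\<Sum>k\<in>S. p k * character k x)))\<^sup>2 \<partial>torus)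
    = (\<integral>x. (cmod (F x))\<^sup>2 \<partial>torus) - (\<Sum>k\<in>S. (cmod (fourier_coeff F k))\<^sup>2)
      + (\<Sum>k\<in>S. (cmod (fourier_coeff F k - p k))\<^sup>2)" (is "?lhs = ?rhs")
proof -
  let ?c = "fourier_coeff F"
  define N where "N = (\<lambda>x. complex_of_real ((cmod (F x))\<^sup>2))"
  define A where "A = (\<lambda>x. \<Sum>k\<in>S. cnj (p k) * (F x * cnj (character k x)))"
  define B where "B = (\<lambda>x. \<Sum>k\<in>S. \<Sum>l\<in>S. (p k * cnj (p l)) * character (k - l) x)"
  have intF: "integrable torus F" by (rule square_integrable_integrable[OF F])
  have int_char: "integrable torus (character k)" for k :: "real ^ 'd"
    by (rule integrable_torus_bounded[where B = 1]) auto
  have intA: "integrable torus A"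
    unfolding A_def
    by (intro Bochner_Integration.integrable_sum integrable_mult_right integrable_mult_character intF)
  have intB: "integrable torus B"
    unfolding B_def by (intro Bochner_Integration.integrable_sum integrable_mult_right int_char)
  have intN: "integrable torus N"
    unfolding N_def using F(2) by (rule integrable_of_real)
  have eq: "complex_of_real ((cmod (F x - (\<Sum>k\<in>S. p k * character k x)))\<^sup>2)
      = N x - A x - cnj (A x) + B x" for x
  proof -
    let ?P = "\<Sum>k\<in>S. p k * character k x"
    have "B x = ?P * cnj ?P"
      unfolding B_def cnj_sum sum_product
      by (intro sum.cong refl) (simp add: character_add cnj_character diff_conv_add_uminus
          del: add_uminus_conv_diff)
    moreover have "A x = F x * cnj ?P"
      by (simp add: A_def sum_distrib_left mult_ac)
    moreover have "N x = F x * cnj (F x)"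
      unfolding N_def by (rule complex_norm_square)
    ultimately show ?thesis
      unfolding complex_norm_square by (simp add: algebra_simps)
  qed
  have "complex_of_real ?lhs = (\<integral>x. N x - A x - cnj (A x) + B x \<partial>torus)"
    unfolding integral_complex_of_real[symmetric] eq ..
  also have "\<dots> = integral\<^sup>L torus N - integral\<^sup>L torus A - cnj (integral\<^sup>L torus A) + integral\<^sup>L torus B"
    using intN intA intB by simp
  also have "integral\<^sup>L torus N = complex_of_real (\<integral>x. (cmod (F x))\<^sup>2 \<partial>torus)"
    unfolding N_def by (rule integral_complex_of_real)
  also have "integral\<^sup>L torus A = (\<Sum>k\<in>S. cnj (p k) * ?c k)"
    unfolding fourier_coeff_def A_def
    by (simp add: Bochner_Integration.integral_sum integrable_mult_character intF)
  also have "integral\<^sup>L torus B = (\<Sum>k\<in>S. p k * cnj (p k))"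
  proof -
    have "integral\<^sup>L torus B = (\<Sum>k\<in>S. \<Sum>l\<in>S. (p k * cnj (p l)) * integral\<^sup>L torus (character (k - l)))"
      unfolding B_def by (simp add: Bochner_Integration.integral_sum int_char)
    also have "\<dots> = (\<Sum>k\<in>S. \<Sum>l\<in>S. if k = l then p k * cnj (p l) else 0)"
      using S(2) by (intro sum.cong refl) (auto simp: integral_character int_lattice_diff subset_iff)
    also have "\<dots> = (\<Sum>k\<in>S. p k * cnj (p k))" using S(1) by simp
    finally show ?thesis .
  qed
  also have "complex_of_real (\<integral>x. (cmod (F x))\<^sup>2 \<partial>torus) - (\<Sum>k\<in>S. cnj (p k) * ?c k)
      - cnj (\<Sum>k\<in>S. cnj (p k) * ?c k) + (\<Sum>k\<in>S. p k * cnj (p k)) = complex_of_real ?rhs"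
  proof -
    have "complex_of_real ((cmod (?c k - p k))\<^sup>2) - complex_of_real ((cmod (?c k))\<^sup>2)
        = p k * cnj (p k) - cnj (p k) * ?c k - p k * cnj (?c k)" for k
      unfolding complex_norm_square by (simp add: algebra_simps)
    then have coeffs: "complex_of_real (\<Sum>k\<in>S. (cmod (?c k - p k))\<^sup>2) - complex_of_real (\<Sum>k\<in>S. (cmod (?c k))\<^sup>2)
        = (\<Sum>k\<in>S. p k * cnj (p k)) - (\<Sum>k\<in>S. cnj (p k) * ?c k) - (\<Sum>k\<in>S. p k * cnj (?c k))"
      by (simp only: of_real_sum sum_subtractf[symmetric])
    have rearrange: "z - a - c + p = z - y + x" if "x - y = p - a - c" for x y z a c p :: complex
    proof -
      have "x = p - a - c + y" using that by (simp add: diff_eq_eq)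
      then show ?thesis by simp
    qed
    have cnj: "cnj (\<Sum>k\<in>S. cnj (p k) * ?c k) = (\<Sum>k\<in>S. p k * cnj (?c k))" by simp
    show ?thesis unfolding cnj of_real_add of_real_diff by (rule rearrange[OF coeffs])
  qed
  finally show ?thesis by (simp only: of_real_eq_iff)
qed

lemma bessel_inequality:
  fixes F :: "real ^ 'd \<Rightarrow> complex"
  assumes F: "F \<in> borel_measurable torus" "integrable torus (\<lambda>x. (cmod (F x))\<^sup>2)"
    and S: "finite S" "S \<subseteq> int_lattice"
  shows "(\<Sum>k\<in>S. (cmod (fourier_coeff F k))\<^sup>2) \<le> (\<integral>x. (cmod (F x))\<^sup>2 \<partial>torus)"
proof -
  have "0 \<le> (\<integral>x. (cmod (F x - (\<Sum>k\<in>S. fourier_coeff F k * character k x)))\<^sup>2 \<partial>torus)"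
    by (rule Bochner_Integration.integral_nonneg) simp
  also have "\<dots> = (\<integral>x. (cmod (F x))\<^sup>2 \<partial>torus) - (\<Sum>k\<in>S. (cmod (fourier_coeff F k))\<^sup>2)"
    by (subst integral_trig_polynomial_distance[OF F S]) simp
  finally show ?thesis by simp
qed

text \<open>The functions \<open>G i\<close> are the partial derivatives of \<open>F\<close>, given only by their Fourier coefficients.\<close>

lemma low_frequency_inequality:
  fixes F :: "real ^ 'd \<Rightarrow> complex" and G :: "'d \<Rightarrow> real ^ 'd \<Rightarrow> complex"
  assumes F: "continuous_on UNIV F" "periodic F"
    and F2: "integrable torus (\<lambda>x. (cmod (F x))\<^sup>2)"
    and G: "\<And>i. G i \<in> borel_measurable torus" "\<And>i. integrable torus (\<lambda>x. (cmod (G i x))\<^sup>2)"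
    and deriv: "\<And>i k. k \<in> int_lattice \<Longrightarrow> cmod (fourier_coeff (G i) k) = 2 * pi * \<bar>k $ i\<bar> * cmod (fourier_coeff F k)"
    and n: "n > 0"
  shows "(\<integral>x. (cmod (F x))\<^sup>2 \<partial>torus) - (\<Sum>i\<in>UNIV. \<integral>x. (cmod (G i x))\<^sup>2 \<partial>torus) / (2 * pi * n)\<^sup>2
    \<le> (\<Sum>k\<in>freqs n. (1 - (norm k / n)\<^sup>2) * (cmod (fourier_coeff F k))\<^sup>2)" (is "?mF - ?mG / _ \<le> ?low")
proof (rule field_le_epsilon)
  fix e :: real
  assume e: "e > 0"
  let ?c = "\<lambda>k. (cmod (fourier_coeff F k))\<^sup>2"
  have mF: "F \<in> borel_measurable torus"
    by (intro measurable_torus borel_measurable_continuous_onI F)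
  obtain P where P: "trig_polynomial P" "\<And>x. cmod (F x - P x) < sqrt e"
    using trig_polynomials_dense[OF F, of "sqrt e"] e by auto
  obtain S p where S: "finite S" "S \<subseteq> int_lattice" "P = (\<lambda>x. \<Sum>k\<in>S. p k * character k x)"
    using trig_polynomial_expansion[OF P(1)] by blast
  \<comment> \<open>One finite set for both sums, large enough for the approximation and for all
    frequencies up to n, so that they can be subtracted termwise.\<close>
  define U where "U = S \<union> freqs n"
  have U: "finite U" "U \<subseteq> int_lattice"
    using S finite_freqs by (auto simp: U_def freqs_def)
  have "?mF - (\<Sum>k\<in>S. ?c k) \<le> (\<integral>x. (cmod (F x - P x))\<^sup>2 \<partial>torus)"
    unfolding S(3) by (subst integral_trig_polynomial_distance[OF mF F2 S(1,2)]) (simp add: sum_nonneg)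
  also have "\<dots> \<le> e"
  proof -
    have "(\<integral>x. (cmod (F x - P x))\<^sup>2 \<partial>torus) \<le> integral\<^sup>L (torus :: (real ^ 'd) measure) (\<lambda>x. e)"
    proof (rule integral_mono_AE'; (rule AE_I2)?)
      interpret finite_measure torus by (rule finite_measure_torus)
      show "integrable torus (\<lambda>x :: real ^ 'd. e)" by simp
      show "(cmod (F x - P x))\<^sup>2 \<le> e" for x
        using power_mono[OF less_imp_le[OF P(2)[of x]], of 2] e by simp
    qed (use e in simp)
    then show ?thesis by (simp add: measure_torus)
  qed
  finally have "?mF \<le> (\<Sum>k\<in>S. ?c k) + e" by simp
  also have "(\<Sum>k\<in>S. ?c k) \<le> (\<Sum>k\<in>U. ?c k)"
    using U by (intro sum_mono2) (auto simp: U_def)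
  finally have upper: "?mF \<le> (\<Sum>k\<in>U. ?c k) + e" by simp
  \<comment> \<open>This sum is subtracted, so an upper bound is enough: Bessel's inequality, which
    also covers discontinuous \<open>G i\<close>.\<close>
  have "(\<Sum>k\<in>U. (2 * pi * norm k)\<^sup>2 * ?c k) = (\<Sum>i\<in>UNIV. \<Sum>k\<in>U. (cmod (fourier_coeff (G i) k))\<^sup>2)"
  proof -
    have "(\<Sum>i\<in>UNIV. (cmod (fourier_coeff (G i) k))\<^sup>2) = (2 * pi * norm k)\<^sup>2 * ?c k" if "k \<in> U" for k
    proof -
      have "(\<Sum>i\<in>UNIV. (cmod (fourier_coeff (G i) k))\<^sup>2) = (\<Sum>i\<in>UNIV. (k $ i)\<^sup>2 * ((2 * pi)\<^sup>2 * ?c k))"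
        using U that by (intro sum.cong refl) (auto simp: deriv power_mult_distrib)
      also have "\<dots> = (k \<bullet> k) * ((2 * pi)\<^sup>2 * ?c k)"
        unfolding sum_distrib_right[symmetric] by (simp add: inner_vec_def power2_eq_square)
      finally show ?thesis by (simp add: dot_square_norm power_mult_distrib)
    qed
    then show ?thesis by (subst sum.swap) simp
  qed
  also have "\<dots> \<le> ?mG"
    by (intro sum_mono bessel_inequality G U)
  finally have lower: "(\<Sum>k\<in>U. (2 * pi * norm k)\<^sup>2 * ?c k) \<le> ?mG" .
  have "?mF - ?mG / (2 * pi * n)\<^sup>2 \<le> (\<Sum>k\<in>U. ?c k) + e - (\<Sum>k\<in>U. (2 * pi * norm k)\<^sup>2 * ?c k) / (2 * pi * n)\<^sup>2"
    using upper divide_right_mono[OF lower, of "(2 * pi * n)\<^sup>2"] by simp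
  also have "\<dots> = (\<Sum>k\<in>U. (1 - (norm k / n)\<^sup>2) * ?c k) + e"
    using n by (simp add: sum_divide_distrib left_diff_distrib sum_subtractf power_divide power_mult_distrib)
  also have "(\<Sum>k\<in>U. (1 - (norm k / n)\<^sup>2) * ?c k) \<le> ?low"
  proof -
    have "(\<Sum>k\<in>U. (1 - (norm k / n)\<^sup>2) * ?c k) = ?low + (\<Sum>k\<in>U - freqs n. (1 - (norm k / n)\<^sup>2) * ?c k)"
      by (subst sum.subset_diff[OF _ U(1), of "freqs n"]) (auto simp: U_def)
    moreover have "(\<Sum>k\<in>U - freqs n. (1 - (norm k / n)\<^sup>2) * ?c k) \<le> 0"
    proof (rule sum_nonpos)
      fix k assume "k \<in> U - freqs n"
      then have "norm k > n" using U(2) by (auto simp: freqs_def)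
      then have "(norm k / n)\<^sup>2 \<ge> 1" using n by (simp add: one_le_power)
      then show "(1 - (norm k / n)\<^sup>2) * ?c k \<le> 0" by (intro mult_nonpos_nonneg) auto
    qed
    ultimately show ?thesis by simp
  qed
  finally show "?mF - ?mG / (2 * pi * n)\<^sup>2 \<le> ?low + e" by simp
qed

section \<open>Bumps at the nodes\<close>

lemma sum_single_nonzero:
  assumes "finite A" "\<And>s t. s \<in> A \<Longrightarrow> t \<in> A \<Longrightarrow> w s \<noteq> 0 \<Longrightarrow> w t \<noteq> 0 \<Longrightarrow> s = t"
  shows "(cmod (\<Sum>t\<in>A. w t))\<^sup>2 = (\<Sum>t\<in>A. (cmod (w t))\<^sup>2)"
proof (cases "\<exists>t\<in>A. w t \<noteq> 0")
  case True
  then obtain t where t: "t \<in> A" "w t \<noteq> 0" by blast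
  then have "\<forall>s\<in>A - {t}. w s = 0" using assms(2) by blast
  then have "(\<Sum>t\<in>A. w t) = w t" "(\<Sum>t\<in>A. (cmod (w t))\<^sup>2) = (cmod (w t))\<^sup>2"
    by (simp_all add: sum.remove[OF assms(1) t(1)])
  then show ?thesis by simp
qed simp

text \<open>The case t = t' is included: a ball must also miss its own lattice translates. The bound
  is not strict because the balls are closed.\<close>

locale torus_balls =
  fixes R :: real and Y :: "(real ^ 'd) set"
  assumes R: "R > 0" and finite_Y: "finite Y"
    and disjoint: "\<And>t t' l. t \<in> Y \<Longrightarrow> t' \<in> Y \<Longrightarrow> l \<in> int_lattice \<Longrightarrow>
      norm (t - t' + l) \<le> 2 * R \<Longrightarrow> t = t' \<and> l = 0"
begin

definition bumps :: "(real ^ 'd \<Rightarrow> real ^ 'd \<Rightarrow> complex) \<Rightarrow> real ^ 'd \<Rightarrow> complex" where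
  "bumps \<phi> x = (\<Sum>t\<in>Y. indicator (cball 0 R) (x - t) *\<^sub>R \<phi> t (x - t))"

lemma bumps_support: "bumps \<phi> x \<noteq> 0 \<Longrightarrow> \<exists>t\<in>Y. norm (x - t) \<le> R"
  unfolding bumps_def by (erule contrapos_np, rule sum.neutral) auto

lemma bumps_bounded_support:
  obtains K where "\<And>\<phi> x. bumps \<phi> x \<noteq> 0 \<Longrightarrow> norm x \<le> K"
proof -
  have "norm x \<le> (\<Sum>t\<in>Y. norm t) + R" if x: "bumps \<phi> x \<noteq> 0" for \<phi> x
  proof -
    obtain t where t: "t \<in> Y" "norm (x - t) \<le> R" using bumps_support[OF x] by blast
    have "norm t \<le> (\<Sum>t\<in>Y. norm t)" using t finite_Y by (intro member_le_sum) auto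
    then show ?thesis using t norm_triangle_sub[of x t] by simp
  qed
  then show ?thesis by (rule that)
qed

lemma norm_bumps: "(cmod (bumps \<phi> x))\<^sup>2 = (\<Sum>t\<in>Y. indicator (cball 0 R) (x - t) *\<^sub>R (cmod (\<phi> t (x - t)))\<^sup>2)"
proof -
  have "(cmod (bumps \<phi> x))\<^sup>2 = (\<Sum>t\<in>Y. (cmod (indicator (cball 0 R) (x - t) *\<^sub>R \<phi> t (x - t)))\<^sup>2)"
    unfolding bumps_def
  proof (rule sum_single_nonzero[OF finite_Y])
    fix s t assume st: "s \<in> Y" "t \<in> Y"
      "indicator (cball 0 R) (x - s) *\<^sub>R \<phi> s (x - s) \<noteq> 0" "indicator (cball 0 R) (x - t) *\<^sub>R \<phi> t (x - t) \<noteq> 0"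
    then have "norm (x - s) \<le> R" "norm (x - t) \<le> R" by (auto simp: indicator_def split: if_splits)
    then have "norm (s - t + 0) \<le> 2 * R"
      using norm_triangle_ineq4[of "x - t" "x - s"] by simp
    then show "s = t" using disjoint st(1,2) int_lattice_0 by blast
  qed
  also have "\<dots> = (\<Sum>t\<in>Y. indicator (cball 0 R) (x - t) *\<^sub>R (cmod (\<phi> t (x - t)))\<^sup>2)"
    by (intro sum.cong refl) (simp add: indicator_def)
  finally show ?thesis .
qed

text \<open>At each point at most one lattice translate contributes, so taking the squared modulus
  commutes with periodization.\<close>

lemma norm_periodize_bumps:
  "(cmod (periodize (bumps \<phi>) x))\<^sup>2 = periodize (\<lambda>x. (cmod (bumps \<phi> x))\<^sup>2) x"
proof -
  obtain K where K: "\<And>x. bumps \<phi> x \<noteq> 0 \<Longrightarrow> norm x \<le> K" using bumps_bounded_support by metis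
  have "(cmod (periodize (bumps \<phi>) x))\<^sup>2
      = (\<Sum>l | l \<in> int_lattice \<and> bumps \<phi> (x + l) \<noteq> 0. (cmod (bumps \<phi> (x + l)))\<^sup>2)"
    unfolding periodize_def
  proof (rule sum_single_nonzero)
    show "finite {l \<in> int_lattice. bumps \<phi> (x + l) \<noteq> 0}"
      by (rule finite_lattice_support(2)[OF K])
    fix k l
    assume k: "k \<in> {l \<in> int_lattice. bumps \<phi> (x + l) \<noteq> 0}" and l: "l \<in> {l \<in> int_lattice. bumps \<phi> (x + l) \<noteq> 0}"
    then obtain s t where "s \<in> Y" "norm (x + k - s) \<le> R" "t \<in> Y" "norm (x + l - t) \<le> R"
      using bumps_support by blast
    moreover from this have "norm (s - t + (l - k)) \<le> 2 * R"
      using norm_triangle_ineq4[of "x + l - t" "x + k - s"] by (simp add: algebra_simps)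
    ultimately have "l - k = 0" using disjoint k l int_lattice_diff by blast
    then show "k = l" by simp
  qed
  then show ?thesis by (simp add: periodize_def)
qed

context
  fixes \<phi> :: "real ^ 'd \<Rightarrow> real ^ 'd \<Rightarrow> complex"
  assumes cont: "\<And>t. continuous_on UNIV (\<phi> t)"
begin

lemma integral_bump:
  fixes \<psi> :: "real ^ 'd \<Rightarrow> 'b::euclidean_space"
  assumes "continuous_on UNIV \<psi>"
  shows "integrable lborel (\<lambda>x. indicator (cball 0 R) (x - t) *\<^sub>R \<psi> (x - t))"
    and "(\<integral>x. indicator (cball 0 R) (x - t) *\<^sub>R \<psi> (x - t) \<partial>lborel) = ball_integral R \<psi>"
  using lborel_translation[of "\<lambda>x. indicator (cball 0 R) x *\<^sub>R \<psi> x" "- t"] set_integrable_cball[OF assms, of R]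
  by (simp_all add: set_integrable_def set_lebesgue_integral_def)

lemma integrable_bumps: "integrable lborel (bumps \<phi>)"
  unfolding bumps_def by (intro Bochner_Integration.integrable_sum integral_bump cont)

lemma measurable_periodize_bumps: "periodize (bumps \<phi>) \<in> borel_measurable torus"
proof -
  obtain K where K: "\<And>x. bumps \<phi> x \<noteq> 0 \<Longrightarrow> norm x \<le> K" using bumps_bounded_support by metis
  show ?thesis
    by (intro borel_measurable_integrable integral_periodize(1)[OF integrable_bumps K])
qed

lemma integral_norm_periodize_bumps:
  "integrable torus (\<lambda>x. (cmod (periodize (bumps \<phi>) x))\<^sup>2)"
  "(\<integral>x. (cmod (periodize (bumps \<phi>) x))\<^sup>2 \<partial>torus) = (\<Sum>t\<in>Y. ball_integral R (\<lambda>x. (cmod (\<phi> t x))\<^sup>2))"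
proof -
  obtain K where K: "\<And>x. bumps \<phi> x \<noteq> 0 \<Longrightarrow> norm x \<le> K" using bumps_bounded_support by metis
  then have K': "\<And>x. (cmod (bumps \<phi> x))\<^sup>2 \<noteq> 0 \<Longrightarrow> norm x \<le> K" by simp
  have c: "continuous_on UNIV (\<lambda>x. (cmod (\<phi> t x))\<^sup>2)" for t
    by (intro continuous_intros cont)
  have int: "integrable lborel (\<lambda>x. (cmod (bumps \<phi> x))\<^sup>2)"
    unfolding norm_bumps by (intro Bochner_Integration.integrable_sum integral_bump(1)[OF c])
  show "integrable torus (\<lambda>x. (cmod (periodize (bumps \<phi>) x))\<^sup>2)"
    unfolding norm_periodize_bumps using integral_periodize(1)[OF int K'] .
  have "(\<integral>x. (cmod (periodize (bumps \<phi>) x))\<^sup>2 \<partial>torus) = (\<integral>x. (cmod (bumps \<phi> x))\<^sup>2 \<partial>lborel)"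
    unfolding norm_periodize_bumps using integral_periodize(2)[OF int K'] .
  also have "\<dots> = (\<Sum>t\<in>Y. ball_integral R (\<lambda>x. (cmod (\<phi> t x))\<^sup>2))"
    unfolding norm_bumps
    by (subst Bochner_Integration.integral_sum) (intro integral_bump(1)[OF c] sum.cong refl integral_bump(2)[OF c])+
  finally show "(\<integral>x. (cmod (periodize (bumps \<phi>) x))\<^sup>2 \<partial>torus)
      = (\<Sum>t\<in>Y. ball_integral R (\<lambda>x. (cmod (\<phi> t x))\<^sup>2))" .
qed

text \<open>Moving each ball to the origin produces the factor \<open>cnj (character k t)\<close>,
  which is the entry of the Fourier matrix.\<close>

lemma fourier_coeff_periodize_bumps:
  assumes k: "k \<in> int_lattice"
  shows "fourier_coeff (periodize (bumps \<phi>)) k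
    = (\<Sum>t\<in>Y. cnj (character k t) * ball_integral R (\<lambda>x. \<phi> t x * cnj (character k x)))"
proof -
  obtain K where K: "\<And>x. bumps \<phi> x \<noteq> 0 \<Longrightarrow> norm x \<le> K" using bumps_bounded_support by metis
  let ?h = "\<lambda>t x. indicator (cball 0 R) (x - t) *\<^sub>R (\<phi> t (x - t) * cnj (character k (x - t)))"
  have eq: "bumps \<phi> x * cnj (character k x) = (\<Sum>t\<in>Y. cnj (character k t) * ?h t x)" for x
  proof -
    have "cnj (character k x) = cnj (character k t) * cnj (character k (x - t))" for t
      using character_add_right[of k t "x - t"] by simp
    then have "a *\<^sub>R z * cnj (character k x) = cnj (character k t) * (a *\<^sub>R (z * cnj (character k (x - t))))"
      for a z t by simp
    then show ?thesis
      unfolding bumps_def sum_distrib_right by (intro sum.cong refl)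
  qed
  have c: "continuous_on UNIV (\<lambda>x. \<phi> t x * cnj (character k x))" for t
    by (intro continuous_intros cont)
  have int: "integrable lborel (\<lambda>x. bumps \<phi> x * cnj (character k x))"
    unfolding eq by (intro Bochner_Integration.integrable_sum integrable_mult_right integral_bump(1)[OF c])
  \<comment> \<open>The character is periodic, so it can be pulled into the sum; it has no zeros, so
    both sums have the same index set.\<close>
  have "periodize (bumps \<phi>) x * cnj (character k x) = periodize (\<lambda>x. bumps \<phi> x * cnj (character k x)) x" for x
  proof -
    have "character k (x + l) = character k x" if "l \<in> int_lattice" for l
      using periodic_character[OF k] that by (simp add: periodic_def)
    moreover have "cnj (character k y) \<noteq> 0" for y
      using norm_character[of k y] by (metis complex_cnj_zero_iff norm_zero zero_neq_one)
    ultimately show ?thesis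
      unfolding periodize_def sum_distrib_right by (intro sum.cong) auto
  qed
  then have "fourier_coeff (periodize (bumps \<phi>)) k = integral\<^sup>L torus (periodize (\<lambda>x. bumps \<phi> x * cnj (character k x)))"
    unfolding fourier_coeff_def by simp
  also have "\<dots> = (\<integral>x. bumps \<phi> x * cnj (character k x) \<partial>lborel)"
    by (rule integral_periodize(2)[OF int, of K]) (use K in auto)
  also have "\<dots> = (\<Sum>t\<in>Y. \<integral>x. cnj (character k t) * ?h t x \<partial>lborel)"
    unfolding eq by (intro Bochner_Integration.integral_sum integrable_mult_right integral_bump(1)[OF c])
  also have "\<dots> = (\<Sum>t\<in>Y. cnj (character k t) * ball_integral R (\<lambda>x. \<phi> t x * cnj (character k x)))"
    by (simp only: integral_mult_right_zero integral_bump(2)[OF c])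
  finally show ?thesis .
qed

text \<open>The cutoff is continuous for profiles that vanish on the sphere. This covers
  combinations of \<open>f\<close> and \<open>V\<close>; those with second derivatives may
  jump.\<close>

lemma continuous_bumps:
  assumes zero: "\<And>t x. norm x = R \<Longrightarrow> \<phi> t x = 0"
  shows "continuous_on UNIV (bumps \<phi>)"
proof -
  have "continuous_on UNIV (\<lambda>x. indicator (cball 0 R) x *\<^sub>R \<phi> t x)" for t
  proof -
    have "continuous_on (cball 0 R \<union> - ball 0 R) (\<lambda>x. if x \<in> cball 0 R then \<phi> t x else 0)"
      by (rule continuous_on_cases) (auto intro: zero continuous_on_subset[OF cont])
    moreover have "cball 0 R \<union> - ball 0 R = (UNIV :: (real ^ 'd) set)" by auto
    moreover have "(\<lambda>x. indicator (cball 0 R) x *\<^sub>R \<phi> t x) = (\<lambda>x. if x \<in> cball 0 R then \<phi> t x else 0)"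
      by (auto simp: indicator_def)
    ultimately show ?thesis by (simp only:)
  qed
  then have "continuous_on UNIV (\<lambda>x. indicator (cball 0 R) (x - t) *\<^sub>R \<phi> t (x - t))" for t
    by (rule continuous_on_compose2) (auto intro!: continuous_intros)
  then show ?thesis
    unfolding bumps_def by (rule continuous_on_sum)
qed

end
end

section \<open>Differentiation and Fourier transforms on a ball\<close>

lemma has_partial_character:
  fixes k :: "real ^ 'd"
  shows "has_partial i (character k) (\<lambda>x. 2 * pi * \<i> * of_real (k $ i) * character k x)"
  unfolding has_partial_def
proof
  fix x :: "real ^ 'd"
  have eq: "character k (x + t *\<^sub>R axis i 1) = character k x * exp (\<i> * of_real (2 * pi * k $ i * t))" for t
    by (simp add: character_add_right) (simp add: character_def inner_axis cis_conv_exp mult_ac)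
  have "((\<lambda>t. \<i> * of_real (2 * pi * k $ i * t)) has_vector_derivative \<i> * of_real (2 * pi * k $ i)) (at 0)"
    by (auto intro!: derivative_eq_intros has_vector_derivative_mult_right has_vector_derivative_of_real)
  from field_vector_diff_chain_at[OF this, of exp "exp 0"]
  have "((\<lambda>t. exp (\<i> * of_real (2 * pi * k $ i * t))) has_vector_derivative \<i> * of_real (2 * pi * k $ i)) (at 0)"
    by (simp add: o_def DERIV_exp[of 0, simplified])
  from has_vector_derivative_mult_right[OF this, of "character k x"]
  show "((\<lambda>t. character k (x + t *\<^sub>R axis i 1)) has_vector_derivative
      2 * pi * \<i> * of_real (k $ i) * character k x) (at 0)"
    unfolding eq by (simp add: mult_ac)
qed

lemma has_partial_combination:
  assumes "has_partial l f g" "\<And>i. has_partial l (V i) (H i)"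
  shows "has_partial l (\<lambda>x. a * complex_of_real (f x) + (\<Sum>i\<in>A. b i * complex_of_real (V i x)))
    (\<lambda>x. a * complex_of_real (g x) + (\<Sum>i\<in>A. b i * complex_of_real (H i x)))"
proof -
  have "has_partial l (\<lambda>x. c * complex_of_real (\<phi> x)) (\<lambda>x. c * complex_of_real (\<psi> x))"
    if "has_partial l \<phi> \<psi>" for \<phi> \<psi> c
    using has_partial_of_real[OF that]
    by (auto simp: has_partial_def intro!: has_vector_derivative_mult_right)
  then show ?thesis
    using assms
    by (intro has_partial_add) (auto simp: has_partial_def intro!: has_vector_derivative_sum)
qed

text \<open>Integration by parts against the conjugate character. It is used once to express the
  transform of \<open>V\<close> by that of \<open>f\<close>, and once for the gradient of a whole
  bump.\<close>

lemma ball_integral_character_partial: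
  fixes \<phi> \<psi> :: "real ^ 'd \<Rightarrow> complex"
  assumes "has_partial i \<phi> \<psi>" "continuous_on UNIV \<phi>" "continuous_on UNIV \<psi>"
    and zero: "\<And>x. norm x = R \<Longrightarrow> \<phi> x = 0"
  shows "ball_integral R (\<lambda>x. \<psi> x * cnj (character k x))
    = 2 * pi * \<i> * of_real (k $ i) * ball_integral R (\<lambda>x. \<phi> x * cnj (character k x))"
proof -
  let ?e = "\<lambda>x. cnj (character k x)"
  let ?c = "2 * pi * \<i> * of_real (k $ i)"
  have e: "has_partial i ?e (\<lambda>x. - ?c * ?e x)"
    using has_partial_character[of i "- k"] unfolding cnj_character by simp
  have "ball_integral R (\<lambda>x. \<phi> x * (- ?c * ?e x) + \<psi> x * ?e x) = 0"
    by (rule integral_partial_ball[OF has_partial_mult[OF assms(1) e]])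
      (auto intro!: continuous_intros assms simp: zero)
  then have "ball_integral R (\<lambda>x. \<phi> x * (- ?c * ?e x)) + ball_integral R (\<lambda>x. \<psi> x * ?e x) = 0"
    by (subst (asm) ball_integral_add) (auto intro!: continuous_intros assms)
  moreover have "(\<lambda>x. \<phi> x * (- ?c * ?e x)) = (\<lambda>x. (- ?c) * (\<phi> x * ?e x))"
    by (simp add: mult_ac)
  ultimately have "(- ?c) * ball_integral R (\<lambda>x. \<phi> x * ?e x) + ball_integral R (\<lambda>x. \<psi> x * ?e x) = 0"
    by (simp only: set_integral_mult_right)
  then show ?thesis by (simp add: add_eq_0_iff2)
qed

section \<open>The lower bound from the low frequencies\<close>

context buckling_mode
begin

text \<open>Cauchy-Schwarz, as characters have modulus 1. The volume of the ball is the source of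
  the power of n in the final estimate.\<close>

lemma fourier_bound:
  "(cmod (ball_integral R (\<lambda>x. complex_of_real (f x) * cnj (character k x))))\<^sup>2
     \<le> measure lborel (cball (0 :: real ^ 'd) R) * mass"
proof -
  let ?v = "measure lborel (cball (0 :: real ^ 'd) R)"
  have v: "?v > 0" using R content_cball_gt_0_iff[of "0 :: real ^ 'd" R] by simp
  \<comment> \<open>The mean of |f| over the ball. Expanding \<integral> (|f| - c)^2 \<ge> 0 with
    this value is Cauchy-Schwarz against the constant 1.\<close>
  define c where "c = I (\<lambda>x. \<bar>f x\<bar>) / ?v"
  have "0 \<le> I (\<lambda>x. (\<bar>f x\<bar> - c) * (\<bar>f x\<bar> - c))" by (rule ball_integral_nonneg) simp
  also have "(\<lambda>x. (\<bar>f x\<bar> - c) * (\<bar>f x\<bar> - c)) = (\<lambda>x. f x * f x + (- 2 * c) * \<bar>f x\<bar> + c * c)"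
    by (auto simp: algebra_simps)
  also have "I \<dots> = mass + (- 2 * c) * I (\<lambda>x. \<bar>f x\<bar>) + I (\<lambda>x :: real ^ 'd. c * c)"
    unfolding mass_def set_integral_mult_right[symmetric]
    by (subst ball_integral_add; (intro continuous_intros)?)+ simp
  also have "I (\<lambda>x :: real ^ 'd. c * c) = c * c * ?v"
    by (simp add: set_lebesgue_integral_def)
  also have "I (\<lambda>x. \<bar>f x\<bar>) = c * ?v" using v by (simp add: c_def)
  finally have "(c * ?v)\<^sup>2 \<le> ?v * mass"
    using v by (simp add: power2_eq_square)
  moreover have "cmod (I (\<lambda>x. complex_of_real (f x) * cnj (character k x))) \<le> c * ?v"
  proof -
    have "cmod (I (\<lambda>x. complex_of_real (f x) * cnj (character k x)))
        \<le> (\<integral>x. norm (indicator (cball 0 R) x *\<^sub>R (complex_of_real (f x) * cnj (character k x))) \<partial>lborel)"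
      unfolding set_lebesgue_integral_def by (rule integral_norm_bound)
    also have "\<dots> = I (\<lambda>x. \<bar>f x\<bar>)"
      unfolding set_lebesgue_integral_def by (simp add: norm_mult)
    also have "\<dots> = c * ?v" using v by (simp add: c_def)
    finally show ?thesis .
  qed
  ultimately show ?thesis by (meson norm_ge_zero order_trans power_mono)
qed

text \<open>The mass of \<open>f\<close> becomes a common factor and cancels, so \<open>f\<close>
  enters only through \<theta> and the volume of the ball. The factors 2 pi i k_s are, up to sign,
  those of the derivative columns.\<close>

lemma vandermonde_lower_bound:
  fixes Y :: "(real ^ 'd) set" and a :: "real ^ 'd \<Rightarrow> complex" and b :: "'d \<Rightarrow> real ^ 'd \<Rightarrow> complex"
  assumes Y: "torus_balls R Y" and n: "n > 0" and \<theta>: "\<mu> / (2 * pi * n)\<^sup>2 = \<theta>" "\<theta> < 1" and half: "R \<le> 1 / 2"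
  shows "(1 - \<theta>) * (\<Sum>t\<in>Y. (cmod (a t))\<^sup>2 + (\<Sum>i\<in>UNIV. (cmod (b i t))\<^sup>2))
    \<le> measure lborel (cball (0 :: real ^ 'd) R)
      * (\<Sum>k\<in>freqs n. (cmod (\<Sum>t\<in>Y. cnj (character k t)
          * (a t + (\<Sum>i\<in>UNIV. b i t * (2 * pi * \<i> * of_real (k $ i))))))\<^sup>2)"
proof -
  interpret torus_balls R Y by (rule Y)
  let ?d = "real CARD('d)"
  let ?v = "measure lborel (cball (0 :: real ^ 'd) R)"
  define P where "P = (\<lambda>k. \<Sum>t\<in>Y. cnj (character k t)
          * (a t + (\<Sum>i\<in>UNIV. b i t * (2 * pi * \<i> * of_real (k $ i)))))"
  define g where "g = (\<lambda>k. I (\<lambda>x. complex_of_real (f x) * cnj (character k x)))"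
  define \<phi> where "\<phi> = (\<lambda>t x. a t * of_real (f x) + (\<Sum>i\<in>UNIV. b i t * of_real (V i x)))"
  define \<psi> where "\<psi> = (\<lambda>l t x. a t * of_real (V l x) + (\<Sum>i\<in>UNIV. b i t * of_real (H l i x)))"
  have cont_\<phi>: "continuous_on UNIV (\<phi> t)" and cont_\<psi>: "continuous_on UNIV (\<psi> l t)" for l t
    unfolding \<phi>_def \<psi>_def by (intro continuous_intros)+
  have zero_\<phi>: "\<phi> t x = 0" if "norm x = R" for t x
    using that by (simp add: \<phi>_def sphere)
  have partial_\<phi>: "has_partial l (\<phi> t) (\<psi> l t)" for l t
    unfolding \<phi>_def \<psi>_def by (intro has_partial_combination partial)
  define F where "F = periodize (bumps \<phi>)"
  define G where "G = (\<lambda>l. periodize (bumps (\<psi> l)))"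
  obtain K where K: "\<And>x. bumps \<phi> x \<noteq> 0 \<Longrightarrow> norm x \<le> K" using bumps_bounded_support by metis
  have F: "continuous_on UNIV F" "periodic F"
    unfolding F_def
    by (rule continuous_periodize[OF continuous_bumps[OF cont_\<phi>] K], rule zero_\<phi>, assumption+)
      (rule periodic_periodize)
  have coeff_G: "fourier_coeff (G l) k = 2 * pi * \<i> * of_real (k $ l) * fourier_coeff F k"
    if k: "k \<in> int_lattice" for l k
  proof -
    have "I (\<lambda>x. \<psi> l t x * cnj (character k x))
        = 2 * pi * \<i> * of_real (k $ l) * I (\<lambda>x. \<phi> t x * cnj (character k x))" for t
      by (rule ball_integral_character_partial[OF partial_\<phi> cont_\<phi> cont_\<psi> zero_\<phi>])
    then show ?thesis
      unfolding F_def G_def fourier_coeff_periodize_bumps[OF cont_\<phi> k] fourier_coeff_periodize_bumps[OF cont_\<psi> k]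
      by (simp only: sum_distrib_left mult.left_commute)
  qed
  have coeff_F: "fourier_coeff F k = P k * g k" if k: "k \<in> int_lattice" for k
  proof -
    have V: "I (\<lambda>x. of_real (V i x) * cnj (character k x)) = 2 * pi * \<i> * of_real (k $ i) * g k" for i
      unfolding g_def
      by (rule ball_integral_character_partial)
        (auto intro!: has_partial_of_real partial continuous_intros simp: sphere)
    have "I (\<lambda>x. \<phi> t x * cnj (character k x))
        = (a t + (\<Sum>i\<in>UNIV. b i t * (2 * pi * \<i> * of_real (k $ i)))) * g k" for t
    proof -
      have "(\<lambda>x. \<phi> t x * cnj (character k x)) = (\<lambda>x. a t * (of_real (f x) * cnj (character k x))
          + (\<Sum>i\<in>UNIV. b i t * (of_real (V i x) * cnj (character k x))))"
        by (simp add: \<phi>_def algebra_simps sum_distrib_left)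
      then have "I (\<lambda>x. \<phi> t x * cnj (character k x)) = a t * g k
          + (\<Sum>i\<in>UNIV. b i t * I (\<lambda>x. of_real (V i x) * cnj (character k x)))"
        by (simp add: ball_integral_add ball_integral_sum continuous_intros cont g_def)
      then show ?thesis
        unfolding V by (simp add: distrib_right sum_distrib_right mult.assoc)
    qed
    then show ?thesis
      unfolding F_def fourier_coeff_periodize_bumps[OF cont_\<phi> k] P_def
      by (simp only: sum_distrib_right mult.assoc)
  qed
  \<comment> \<open>\<open>f\<close>, \<open>V\<close> and \<open>H\<close> are real, so a complex
    combination splits into two real ones, to which the mass and energy formulas apply.\<close>
  have norm_split: "(cmod (a t * of_real u + (\<Sum>i\<in>UNIV. b i t * of_real (w i))))\<^sup>2
      = (Re (a t) * u + (\<Sum>i\<in>UNIV. Re (b i t) * w i))\<^sup>2 + (Im (a t) * u + (\<Sum>i\<in>UNIV. Im (b i t) * w i))\<^sup>2"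
    for t u and w :: "'d \<Rightarrow> real"
    by (simp add: cmod_power2)
  have sq: "(\<Sum>i\<in>UNIV. (Re (b i t))\<^sup>2) + (\<Sum>i\<in>UNIV. (Im (b i t))\<^sup>2) = (\<Sum>i\<in>UNIV. (cmod (b i t))\<^sup>2)" for t
    by (simp add: cmod_power2 sum.distrib)
  have mF: "I (\<lambda>x. (cmod (\<phi> t x))\<^sup>2) = (cmod (a t))\<^sup>2 * mass + m * (\<Sum>i\<in>UNIV. (cmod (b i t))\<^sup>2)" for t
  proof -
    have "I (\<lambda>x. (cmod (\<phi> t x))\<^sup>2)
        = I (\<lambda>x. (Re (a t) * f x + (\<Sum>i\<in>UNIV. Re (b i t) * V i x))\<^sup>2)
        + I (\<lambda>x. (Im (a t) * f x + (\<Sum>i\<in>UNIV. Im (b i t) * V i x))\<^sup>2)"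
      unfolding \<phi>_def norm_split by (intro ball_integral_add continuous_intros)
    then show ?thesis
      unfolding mass_combination sq[symmetric] by (simp add: cmod_power2[of "a t"] algebra_simps)
  qed
  have mG: "(\<Sum>l\<in>UNIV. I (\<lambda>x. (cmod (\<psi> l t x))\<^sup>2))
      = (cmod (a t))\<^sup>2 * (?d * m) + \<mu> * m * (\<Sum>i\<in>UNIV. (cmod (b i t))\<^sup>2)" for t
  proof -
    have "I (\<lambda>x. (cmod (\<psi> l t x))\<^sup>2)
        = I (\<lambda>x. (Re (a t) * V l x + (\<Sum>i\<in>UNIV. Re (b i t) * H l i x))\<^sup>2)
        + I (\<lambda>x. (Im (a t) * V l x + (\<Sum>i\<in>UNIV. Im (b i t) * H l i x))\<^sup>2)" for l
      unfolding \<psi>_def norm_split by (intro ball_integral_add continuous_intros)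
    then show ?thesis
      unfolding sq[symmetric] by (simp add: sum.distrib energy_combination cmod_power2[of "a t"] algebra_simps)
  qed
  \<comment> \<open>For R \<le> 1 / 2 the Poincare constant is at most 1, so the terms of
    \<open>b\<close> are at least as strong as those of \<open>a\<close>.\<close>
  have m_ge: "m \<ge> mass"
  proof -
    have "?d * mass \<le> 4 * R\<^sup>2 * m" by (rule poincare)
    moreover have "m \<ge> 0"
      using moments[of undefined undefined] ball_integral_nonneg[of "\<lambda>x. V undefined x * V undefined x" R]
      by simp
    moreover have "4 * R\<^sup>2 \<le> 1"
      using power_mono[OF half, of 2] R by (simp add: power_divide)
    ultimately have "?d * mass \<le> m" by (smt (verit) mult_right_mono mult_cancel_right1)
    moreover have "1 * mass \<le> ?d * mass"
      using mass_pos by (intro mult_right_mono) (auto simp: Suc_leI)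
    ultimately show ?thesis by simp
  qed
  define N where "N = (2 * pi * n)\<^sup>2"
  have N: "N > 0" using n by (simp add: N_def)
  \<comment> \<open>For \<open>b\<close> the energy is exactly \<mu> times the mass; for
    \<open>a\<close> it is at most that, by \<open>gradient_le\<close>. Hence one \<theta> serves
    both.\<close>
  have dm: "?d * m / N \<le> \<theta> * mass"
    using gradient_le N by (simp add: \<theta>(1)[symmetric] N_def[symmetric] divide_right_mono)
  have \<theta>_eq: "\<theta> = \<mu> / N" using \<theta>(1) by (simp add: N_def)
  have pointwise: "(cmod (a t))\<^sup>2 * (mass - ?d * m / N) + (1 - \<theta>) * m * (\<Sum>i\<in>UNIV. (cmod (b i t))\<^sup>2)
      = I (\<lambda>x. (cmod (\<phi> t x))\<^sup>2) - (\<Sum>l\<in>UNIV. I (\<lambda>x. (cmod (\<psi> l t x))\<^sup>2)) / N" for t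
    unfolding mF mG \<theta>_eq using N by (simp add: field_simps)
  have "(1 - \<theta>) * mass * (\<Sum>t\<in>Y. (cmod (a t))\<^sup>2 + (\<Sum>i\<in>UNIV. (cmod (b i t))\<^sup>2))
      = (\<Sum>t\<in>Y. (cmod (a t))\<^sup>2 * (mass - \<theta> * mass) + (1 - \<theta>) * mass * (\<Sum>i\<in>UNIV. (cmod (b i t))\<^sup>2))"
    by (subst sum_distrib_left, intro sum.cong refl) (simp add: algebra_simps)
  also have "\<dots> \<le> (\<Sum>t\<in>Y. (cmod (a t))\<^sup>2 * (mass - ?d * m / N) + (1 - \<theta>) * m * (\<Sum>i\<in>UNIV. (cmod (b i t))\<^sup>2))"
    using dm m_ge \<theta>(2) by (intro sum_mono add_mono mult_left_mono mult_right_mono sum_nonneg) auto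
  also have "\<dots> = (\<Sum>t\<in>Y. I (\<lambda>x. (cmod (\<phi> t x))\<^sup>2)) - (\<Sum>t\<in>Y. \<Sum>l\<in>UNIV. I (\<lambda>x. (cmod (\<psi> l t x))\<^sup>2)) / N"
    unfolding pointwise sum_subtractf sum_divide_distrib ..
  also have "\<dots> = (\<integral>x. (cmod (F x))\<^sup>2 \<partial>torus) - (\<Sum>l\<in>UNIV. \<integral>x. (cmod (G l x))\<^sup>2 \<partial>torus) / N"
    unfolding F_def G_def integral_norm_periodize_bumps(2)[OF cont_\<phi>] integral_norm_periodize_bumps(2)[OF cont_\<psi>]
    by (subst sum.swap) simp
  also have "\<dots> \<le> (\<Sum>k\<in>freqs n. (1 - (norm k / n)\<^sup>2) * (cmod (fourier_coeff F k))\<^sup>2)"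
    unfolding N_def
  proof (rule low_frequency_inequality[OF F _ _ _ _ n])
    show "integrable torus (\<lambda>x. (cmod (F x))\<^sup>2)" "integrable torus (\<lambda>x. (cmod (G i x))\<^sup>2)" for i
      unfolding F_def G_def by (intro integral_norm_periodize_bumps cont_\<phi> cont_\<psi>)+
    show "G i \<in> borel_measurable torus" for i
      unfolding G_def by (intro measurable_periodize_bumps cont_\<psi>)
    show "cmod (fourier_coeff (G i) k) = 2 * pi * \<bar>k $ i\<bar> * cmod (fourier_coeff F k)"
      if "k \<in> int_lattice" for i k
      unfolding coeff_G[OF that] by (simp add: norm_mult)
  qed
  also have "\<dots> \<le> (\<Sum>k\<in>freqs n. ?v * mass * (cmod (P k))\<^sup>2)"
  proof (rule sum_mono)
    fix k :: "real ^ 'd"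
    assume k: "k \<in> freqs n"
    then have k': "k \<in> int_lattice" "norm k \<le> n" by (auto simp: freqs_def)
    have "(1 - (norm k / n)\<^sup>2) * (cmod (fourier_coeff F k))\<^sup>2 \<le> 1 * (cmod (fourier_coeff F k))\<^sup>2"
      by (intro mult_right_mono) auto
    also have "\<dots> = (cmod (g k))\<^sup>2 * (cmod (P k))\<^sup>2"
      unfolding coeff_F[OF k'(1)] by (simp add: norm_mult power_mult_distrib)
    also have "\<dots> \<le> ?v * mass * (cmod (P k))\<^sup>2"
      unfolding g_def by (intro mult_right_mono fourier_bound) auto
    finally show "(1 - (norm k / n)\<^sup>2) * (cmod (fourier_coeff F k))\<^sup>2 \<le> ?v * mass * (cmod (P k))\<^sup>2" .
  qed
  also have "\<dots> = mass * (?v * (\<Sum>k\<in>freqs n. (cmod (P k))\<^sup>2))"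
    by (simp add: sum_distrib_left mult_ac)
  finally have "mass * ((1 - \<theta>) * (\<Sum>t\<in>Y. (cmod (a t))\<^sup>2 + (\<Sum>i\<in>UNIV. (cmod (b i t))\<^sup>2)))
      \<le> mass * (?v * (\<Sum>k\<in>freqs n. (cmod (P k))\<^sup>2))"
    by (simp add: mult_ac)
  then show ?thesis using mass_pos unfolding P_def by simp
qed

end

section \<open>The Fisher information matrix\<close>

lemma sum_params:
  fixes h :: "'d::finite option \<times> (real ^ 'd) \<Rightarrow> 'b::comm_monoid_add"
  shows "(\<Sum>p\<in>params Y. h p) = (\<Sum>t\<in>Y. h (None, t) + (\<Sum>s\<in>UNIV. h (Some s, t)))"
proof -
  have "(\<Sum>p\<in>params Y. h p) = (\<Sum>o'\<in>UNIV. \<Sum>t\<in>Y. h (o', t))"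
    unfolding params_def by (simp add: sum.cartesian_product)
  also have "\<dots> = (\<Sum>t\<in>Y. \<Sum>o'\<in>UNIV. h (o', t))" by (rule sum.swap)
  also have "\<dots> = (\<Sum>t\<in>Y. h (None, t) + (\<Sum>s\<in>UNIV. h (Some s, t)))"
    unfolding UNIV_option_conv by (intro sum.cong refl) (simp add: sum.reindex)
  finally show ?thesis .
qed

text \<open>\<open>sep\<close> ignores the zero vector, so the remaining case is t - t' + l = 0,
  where the uniqueness of representatives gives t = t'.\<close>

lemma torus_balls_sep:
  fixes Y :: "(real ^ 'd) set"
  assumes Y: "torus_config Y" and R: "R > 0" "2 * R < sep Y"
  shows "torus_balls R Y"
proof
  show "R > 0" by (rule R)
  show "finite Y" using Y by (simp add: torus_config_def)
  fix t t' l :: "real ^ 'd"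
  assume *: "t \<in> Y" "t' \<in> Y" "l \<in> int_lattice" "norm (t - t' + l) \<le> 2 * R"
  have "t - t' + l = 0"
  proof (rule ccontr)
    assume "t - t' + l \<noteq> 0"
    with * have "sep Y \<le> norm (t - t' + l)"
      unfolding sep_def by (intro cInf_lower bdd_belowI[of _ 0]) auto
    with * R show False by simp
  qed
  then have "t - t' = - l" by (simp add: add_eq_0_iff2)
  then have "t - t' \<in> int_lattice" using *(3) by (simp add: int_lattice_minus)
  then have "t = t'" using Y * unfolding torus_config_def by blast
  with \<open>t - t' + l = 0\<close> show "t = t' \<and> l = 0" by simp
qed

text \<open>A unit lattice vector competes in the minimum with t = t'. This keeps the radius below 1
  / 2, as the Poincare comparison requires.\<close>

lemma sep_le_1:
  fixes Y :: "(real ^ 'd) set"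
  assumes "Y \<noteq> {}"
  shows "sep Y \<le> 1"
proof -
  obtain t where "t \<in> Y" using assms by blast
  let ?a = "axis undefined 1 :: real ^ 'd"
  have "sep Y \<le> norm (t - t + ?a)"
    unfolding sep_def
  proof (intro cInf_lower bdd_belowI[of _ 0] CollectI exI conjI)
    show "t - t + ?a \<noteq> 0" by (simp add: axis_eq_0_iff)
  qed (use \<open>t \<in> Y\<close> in \<open>auto intro: int_lattice_axis\<close>)
  then show ?thesis by simp
qed

lemma fourier_mat_character: "fourier_mat k t = cnj (character k t)"
  by (simp add: fourier_mat_def character_def cis_conv_exp exp_cnj inner_commute mult_ac)

lemma fourier_deriv_mat_character:
  "fourier_deriv_mat s k t = - (2 * pi * \<i> * of_real (k $ s)) * cnj (character k t)"
proof -
  have "fourier_deriv_mat s k t = - (2 * pi * \<i> * of_real (k $ s)) * fourier_mat k t"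
    by (simp add: fourier_deriv_mat_def fourier_mat_def)
  then show ?thesis by (simp add: fourier_mat_character)
qed

lemma fisher_quadratic_form:
  assumes "finite Y"
  shows "(\<Sum>p\<in>params Y. cnj (v p) * (\<Sum>q\<in>params Y. fisher_information n \<delta> \<alpha> p q * v q))
    = complex_of_real (1 / \<delta>\<^sup>2 * (\<Sum>k\<in>freqs n. (cmod (\<Sum>q\<in>params Y. fisher_G \<alpha> k q * v q))\<^sup>2))"
proof -
  let ?g = "\<lambda>k. \<Sum>q\<in>params Y. fisher_G \<alpha> k q * v q"
  let ?d = "complex_of_real (1 / \<delta>\<^sup>2)"
  have "(\<Sum>q\<in>params Y. fisher_information n \<delta> \<alpha> p q * v q)
      = ?d * (\<Sum>k\<in>freqs n. cnj (fisher_G \<alpha> k p) * ?g k)" for p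
    unfolding fisher_information_def sum_distrib_left sum_distrib_right
    by (subst sum.swap) (simp add: mult_ac)
  moreover have factor: "(\<Sum>p\<in>params Y. ?d * (cnj (fisher_G \<alpha> k p * v p) * z))
      = ?d * (cnj (?g k) * z)" for k z
    unfolding cnj_sum sum_distrib_right sum_distrib_left ..
  ultimately have "(\<Sum>p\<in>params Y. cnj (v p) * (\<Sum>q\<in>params Y. fisher_information n \<delta> \<alpha> p q * v q))
      = (\<Sum>p\<in>params Y. \<Sum>k\<in>freqs n. ?d * (cnj (fisher_G \<alpha> k p * v p) * ?g k))"
    by (simp add: sum_distrib_left mult_ac)
  also have "\<dots> = (\<Sum>k\<in>freqs n. ?d * (cnj (?g k) * ?g k))"
    by (subst sum.swap) (simp only: factor)
  also have "\<dots> = ?d * (\<Sum>k\<in>freqs n. cnj (?g k) * ?g k)"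
    by (rule sum_distrib_left[symmetric])
  also have "(\<Sum>k\<in>freqs n. cnj (?g k) * ?g k) = (\<Sum>k\<in>freqs n. complex_of_real ((cmod (?g k))\<^sup>2))"
    by (intro sum.cong refl) (simp only: complex_norm_square mult.commute)
  also have "?d * \<dots> = complex_of_real (1 / \<delta>\<^sup>2 * (\<Sum>k\<in>freqs n. (cmod (?g k))\<^sup>2))"
    by (simp only: of_real_mult of_real_sum)
  finally show ?thesis .
qed

text \<open>The node weights and the sign of the derivative columns move into the coefficients
  \<open>b\<close>. This costs the factor \<open>min 1 (A\<^sup>2)\<close>, where the 1 stands for
  the columns that carry no weight.\<close>

lemma fisher_lower_bound:
  fixes Y :: "(real ^ 'd) set" and \<alpha> :: "real ^ 'd \<Rightarrow> complex"
  assumes "buckling_mode R \<mu> m (f :: real ^ 'd \<Rightarrow> real) V H T"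
    and Y: "torus_balls R Y" and n: "n > 0" and \<theta>: "\<mu> / (2 * pi * n)\<^sup>2 = \<theta>" "\<theta> < 1" and half: "R \<le> 1 / 2"
    and \<alpha>: "\<And>t. t \<in> Y \<Longrightarrow> A \<le> cmod (\<alpha> t)" "A > 0"
  shows "(1 - \<theta>) * min 1 (A\<^sup>2) * (\<Sum>p\<in>params Y. (cmod (v p))\<^sup>2)
    \<le> measure lborel (cball (0 :: real ^ 'd) R)
      * (\<Sum>k\<in>freqs n. (cmod (\<Sum>q\<in>params Y. fisher_G \<alpha> k q * v q))\<^sup>2)"
proof -
  interpret buckling_mode R \<mu> m f V H T by fact
  define a where "a = (\<lambda>t. v (None, t))"
  define b where "b = (\<lambda>s t. - \<alpha> t * v (Some s, t))"
  have G: "(\<Sum>q\<in>params Y. fisher_G \<alpha> k q * v q)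
      = (\<Sum>t\<in>Y. cnj (character k t) * (a t + (\<Sum>i\<in>UNIV. b i t * (2 * pi * \<i> * of_real (k $ i)))))" for k
    unfolding sum_params fisher_G_def
    by (simp add: fourier_mat_character fourier_deriv_mat_character a_def b_def sum_distrib_left
        distrib_left mult_ac)
  have "min 1 (A\<^sup>2) * (\<Sum>p\<in>params Y. (cmod (v p))\<^sup>2)
      = (\<Sum>t\<in>Y. min 1 (A\<^sup>2) * (cmod (a t))\<^sup>2 + (\<Sum>s\<in>UNIV. min 1 (A\<^sup>2) * (cmod (v (Some s, t)))\<^sup>2))"
    by (simp add: sum_params a_def sum_distrib_left distrib_left)
  also have "\<dots> \<le> (\<Sum>t\<in>Y. (cmod (a t))\<^sup>2 + (\<Sum>s\<in>UNIV. (cmod (b s t))\<^sup>2))"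
  proof (intro sum_mono add_mono)
    fix t s assume t: "t \<in> Y"
    show "min 1 (A\<^sup>2) * (cmod (a t))\<^sup>2 \<le> (cmod (a t))\<^sup>2"
      by (intro mult_left_le_one_le) (auto simp: min_def)
    have "A\<^sup>2 \<le> (cmod (\<alpha> t))\<^sup>2"
      by (rule power_mono[OF \<alpha>(1)[OF t] less_imp_le[OF \<alpha>(2)]])
    then have "min 1 (A\<^sup>2) \<le> (cmod (\<alpha> t))\<^sup>2" by (rule min.coboundedI2)
    then have "min 1 (A\<^sup>2) * (cmod (v (Some s, t)))\<^sup>2 \<le> (cmod (\<alpha> t))\<^sup>2 * (cmod (v (Some s, t)))\<^sup>2"
      by (rule mult_right_mono) simp
    then show "min 1 (A\<^sup>2) * (cmod (v (Some s, t)))\<^sup>2 \<le> (cmod (b s t))\<^sup>2"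
      by (simp only: b_def norm_mult norm_minus_cancel power_mult_distrib)
  qed
  finally have "(1 - \<theta>) * (min 1 (A\<^sup>2) * (\<Sum>p\<in>params Y. (cmod (v p))\<^sup>2))
      \<le> (1 - \<theta>) * (\<Sum>t\<in>Y. (cmod (a t))\<^sup>2 + (\<Sum>s\<in>UNIV. (cmod (b s t))\<^sup>2))"
    using \<theta>(2) by (intro mult_left_mono) auto
  also note vandermonde_lower_bound[OF Y n \<theta> half, of a b]
  finally show ?thesis unfolding G by (simp only: mult.assoc)
qed

theorem corollary2p5:
  fixes q :: real
  assumes "q > bessel_first_zero (real CARD('d::finite) / 2) / pi"
  shows "\<forall>\<alpha>min>0. \<exists>c>0. \<forall>n>0. \<forall>\<delta>>0. \<forall>(Y :: (real ^ 'd) set) (\<alpha> :: real ^ 'd \<Rightarrow> complex).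
           torus_config Y \<and> n * sep Y \<ge> q \<and> Min ((\<lambda>t. cmod (\<alpha> t)) ` Y) = \<alpha>min \<longrightarrow>
           inverse (n ^ CARD('d)) * lambda_min (params Y) (fisher_information n \<delta> \<alpha>)
             \<ge> inverse (\<delta>\<^sup>2) * c"
proof (intro allI impI)
  fix A :: real
  assume A: "A > 0"
  define j where "j = bessel_first_zero (real CARD('d) / 2)"
  have d: "real CARD('d) / 2 > 0" by simp
  have j: "j > 0" "bessel_series (real CARD('d) / 2) (j\<^sup>2 / 4) = 0"
    unfolding j_def by (rule bessel_first_zero[OF d])+
  \<comment> \<open>Room on both sides: \<open>j / pi < r\<close> makes \<theta> < 1, and
    \<open>r < q\<close> makes 2 R strictly smaller than the separation.\<close>
  obtain r where r: "j / pi < r" "r < q"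
    using assms dense unfolding j_def by blast
  have r0: "r > 0" using j r by (smt (verit) divide_pos_pos pi_gt_zero)
  define \<theta> where "\<theta> = (j / (pi * r))\<^sup>2"
  have "j / (pi * r) < 1" "j / (pi * r) > 0" using r r0 j by (simp_all add: field_simps)
  then have \<theta>: "\<theta> < 1" unfolding \<theta>_def by (simp add: power_less_one_iff)
  \<comment> \<open>n^d times the volume of the ball of radius r / (2 n), hence free of n.\<close>
  define U where "U = unit_ball_vol (real CARD('d)) * (r / 2) ^ CARD('d)"
  have U: "U > 0" using r0 by (simp add: U_def)
  define c where "c = (1 - \<theta>) * min 1 (A\<^sup>2) / U"
  have c: "c > 0" using \<theta> A U by (simp add: c_def)
  have bound: "inverse (\<delta>\<^sup>2) * c \<le> inverse (n ^ CARD('d)) * lambda_min (params Y) (fisher_information n \<delta> \<alpha>)"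
    if n: "n > 0" and \<delta>: "\<delta> > 0" and Y: "torus_config Y" "n * sep Y \<ge> q"
      and \<alpha>: "Min ((\<lambda>t. cmod (\<alpha> t)) ` Y) = A"
    for n \<delta> :: real and Y :: "(real ^ 'd) set" and \<alpha> :: "real ^ 'd \<Rightarrow> complex"
  proof -
    \<comment> \<open>With this radius the load (j / R)^2 is the same fraction \<theta> of (2 pi
      n)^2 for every n.\<close>
    define R where "R = r / (2 * n)"
    have R: "R > 0" using r0 n by (simp add: R_def)
    have finY: "finite Y" and neY: "Y \<noteq> {}" using Y by (auto simp: torus_config_def)
    have "r / n < sep Y"
      using r Y(2) n by (simp add: field_simps)
    then have sepR: "2 * R < sep Y" by (simp add: R_def)
    have balls: "torus_balls R Y" by (rule torus_balls_sep[OF Y(1) R sepR])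
    have half: "R \<le> 1 / 2" using sepR sep_le_1[OF neY] by simp
    obtain m f V H T where mode: "buckling_mode R ((j / R)\<^sup>2) m (f :: real ^ 'd \<Rightarrow> real) V H T"
      using bessel_buckling_mode[OF j R] by blast
    have \<theta>_eq: "(j / R)\<^sup>2 / (2 * pi * n)\<^sup>2 = \<theta>"
      unfolding \<theta>_def R_def using n r0 by (simp add: field_simps power2_eq_square)
    have A_le: "A \<le> cmod (\<alpha> t)" if "t \<in> Y" for t
      using \<alpha> that finY by (metis Min_le finite_imageI imageI)
    have vol: "measure lborel (cball (0 :: real ^ 'd) R) = U / n ^ CARD('d)"
    proof -
      have "measure lborel (cball (0 :: real ^ 'd) R) = unit_ball_vol (real CARD('d)) * R ^ CARD('d)"
        using R by (simp add: content_cball)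
      then show ?thesis using n by (simp add: U_def R_def power_divide power_mult_distrib)
    qed
    have "n ^ CARD('d) * (inverse (\<delta>\<^sup>2) * c) \<le> lambda_min (params Y) (fisher_information n \<delta> \<alpha>)"
    proof (rule lambda_min_ge)
      show "finite (params Y)" "params Y \<noteq> {}" using finY neY by (auto simp: params_def)
      fix v
      let ?v = "\<Sum>p\<in>params Y. (cmod (v p))\<^sup>2"
      let ?S = "\<Sum>k\<in>freqs n. (cmod (\<Sum>q\<in>params Y. fisher_G \<alpha> k q * v q))\<^sup>2"
      have "(1 - \<theta>) * min 1 (A\<^sup>2) * ?v \<le> U / n ^ CARD('d) * ?S"
        using fisher_lower_bound[OF mode balls n \<theta>_eq \<theta> half A_le A, where v = v] unfolding vol .
      then have "n ^ CARD('d) * c * ?v \<le> ?S"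
        unfolding c_def using U n by (simp add: field_simps)
      then have "inverse (\<delta>\<^sup>2) * (n ^ CARD('d) * c * ?v) \<le> inverse (\<delta>\<^sup>2) * ?S"
        by (intro mult_left_mono) auto
      then have "n ^ CARD('d) * (inverse (\<delta>\<^sup>2) * c) * ?v \<le> 1 / \<delta>\<^sup>2 * ?S"
        by (simp only: inverse_eq_divide mult_ac)
      then show "\<exists>x\<ge>n ^ CARD('d) * (inverse (\<delta>\<^sup>2) * c) * ?v.
          (\<Sum>p\<in>params Y. cnj (v p) * (\<Sum>q\<in>params Y. fisher_information n \<delta> \<alpha> p q * v q)) = complex_of_real x"
        using fisher_quadratic_form[OF finY] by blast
    qed
    then show ?thesis using n by (simp add: field_simps)
  qed
  show "\<exists>c>0. \<forall>n>0. \<forall>\<delta>>0. \<forall>(Y :: (real ^ 'd) set) (\<alpha> :: real ^ 'd \<Rightarrow> complex).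
           torus_config Y \<and> n * sep Y \<ge> q \<and> Min ((\<lambda>t. cmod (\<alpha> t)) ` Y) = A \<longrightarrow>
           inverse (n ^ CARD('d)) * lambda_min (params Y) (fisher_information n \<delta> \<alpha>)
             \<ge> inverse (\<delta>\<^sup>2) * c"
    using c bound by blast
qed

end
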